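(* Let $\{\mathbf{S}_N\}_{N\ge1}$ be the vectors of sample inclusion indicators of a sequence of measurable Poisson sampling designs with first order inclusion probabilities $$\pi_{i,N}=\min\left\{c_N\frac{w(X_i)}{\sum_{j=1}^Nw(X_j)};1\right\},\quad i=1,\dots,N,$$ where $w:\mathcal{X}\to(0,\infty)$ and $c_N=c_N(X_1,\dots,X_N)>0$ is such that $\sum_{i=1}^N\pi_{i,N}=n_N$, with $n_N=n_N(X_1,\dots,X_N)\in[0,N]$ the expected sample size. Let $\mathcal{F}$ be a class of measurable functions $f:\mathcal{Y}\to\mathbb{R}$ and let $\{\mathbb{G}_N'\}_{N\ge1}$ be the corresponding sequence of Horvitz-Thompson empirical processes. Assume: (B0) $n_N:\mathcal{X}^N\to[0,N]$ is measurable and $n_N/N\to\alpha$ in probability for some constant $\alpha\in(0,1)$; (B1) $w$ is measurable and $Ew(X_1)<\infty$; (B2* ) the class $\mathcal{F}/w_\theta:=\{(y,x)\mapsto f(y)/w_\theta(x):f\in\mathcal{F}\}$ is a $P_{y,x}$-Donsker class; (B3) $\sup\{|P_{y,x}(f/w_\theta)|:f\in\mathcal{F}\}<\infty$. Here $\theta>0$ is the unique constant with $E\min\{\theta w(X_1)/Ew(X_1);1\}=\alpha$ and $w_\theta(x):=\min\{w(x),Ew(X_1)/\theta\}$. Let $$\Sigma'(f,g):=E\left[w_\theta(X_1)\left(\frac{Ew(X_1)}{\theta}-w_\theta(X_1)\right)\frac{f(Y_1)g(Y_1)}{w_\theta(X_1)^2}\right],\quad f,g\in\mathcal{F},$$ and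 let $\mathbb{G}'$ be the zero-mean Gaussian process indexed by $\mathcal{F}$ with covariance function $\Sigma'$ which is a Borel measurable and tight random element of $l^\infty(\mathcal{F})$ (under these assumptions such a process exists, and it is the weak limit of $\mathbb{G}_N'$ in $l^\infty(\mathcal{F})$). Then $$\sup_{h\in BL_1(l^\infty(\mathcal{F}))}\left|E_dh(\mathbb{G}_N')-Eh(\mathbb{G}')\right|\to0\quad\text{in outer probability}.$$
   Context: Setting. $\mathcal{Y},\mathcal{X}$ are separable Banach spaces. The underlying probability space is the product $\prod_{i=1}^\infty(\Omega_{y,x},\mathcal{A}_{y,x},P_{y,x})\times(\Omega_d,\mathcal{A}_d,P_d)\times\prod_{i=1}^\infty(\Omega_\varepsilon,\mathcal{A}_\varepsilon,P_\varepsilon)$ with product measure $P$; outer probabilities and expectations $P^*,E^*$ refer to it. The pairs $(Y_i,X_i)$, $i\ge1$, are the coordinate projections of the first factor: they are i.i.d. with values in $\mathcal{Y}\times\mathcal{X}$ and law $P_{y,x}$; $P_y$ is the law of $Y_1$. (The third factor carries an auxiliary i.i.d. Rademacher sequence.) Write $Qf:=\int f\,dQ$, $\mathbf{Y}_N=(Y_1,\dots,Y_N)$, $\mathbf{X}_N=(X_1,\dots,X_N)$; in particular $P_{y,x}(f/w_\theta)=E[f(Y_1)/w_\theta(X_1)]$. Poisson design. $D$ is a uniform-$[0,1]$ random variable depending only on the $\Omega_d$-coordinate. For each $N$ the inclusion probabilities $\pi_{i,N}$, $i\le N$, are functions of $\mathbf{X}_N$; put $\mathfrak{p}_N(\mathbf{s})=\prod_{i=1}^N\pi_{i,N}^{s_i}(1-\pi_{i,N})^{1-s_i}$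 for $\mathbf{s}\in\{0,1\}^N$. With a fixed enumeration $\mathbf{s}^{(1)},\dots,\mathbf{s}^{(2^N)}$ of $\{0,1\}^N$, $\mathbf{S}_N=(S_{1,N},\dots,S_{N,N}):=\mathbf{s}^{(1)}$ if $D\le\mathfrak{p}_N(\mathbf{s}^{(1)})$ and $:=\mathbf{s}^{(k)}$ if $\sum_{j<k}\mathfrak{p}_N(\mathbf{s}^{(j)})<D\le\sum_{j\le k}\mathfrak{p}_N(\mathbf{s}^{(j)})$. Thus, given $\mathbf{X}_N$, the indicators are independent Bernoulli($\pi_{i,N}$) and conditionally independent of $\mathbf{Y}_N$. The design is measurable if each $\mathfrak{p}_N(\mathbf{s})$ is a measurable function of $\mathbf{X}_N$. $E_d$ denotes expectation over $D$ with all else fixed: for any function $g$, $E_dg(\mathbf{S}_N,\mathbf{Y}_N,\mathbf{X}_N)=\sum_{\mathbf{s}}g(\mathbf{s},\mathbf{Y}_N,\mathbf{X}_N)\mathfrak{p}_N(\mathbf{s})$. Horvitz-Thompson empirical process: $\mathbb{G}_N'f:=\frac1{\sqrt N}\sum_{i=1}^N\left(\frac{S_{i,N}}{\pi_{i,N}}-1\right)f(Y_i)$, $f\in\mathcal{F}$. $l^\infty(\mathcal{F})$ is the space of bounded functions $z:\mathcal{F}\to\mathbb{R}$ with norm $\|z\|_{\mathcal{F}}=\sup_{f\in\mathcal{F}}|z(f)|$. $BL_1(l^\infty(\mathcal{F}))$ is the set of all $h:l^\infty(\mathcal{F})\to[0,1]$ with $|h(z_1)-h(z_2)|\le\|z_1-z_2\|_{\mathcal{F}}$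 for all $z_1,z_2$. $T_N\to0$ in outer probability means $P^*\{|T_N|>\epsilon\}\to0$ for every $\epsilon>0$. A class $\mathcal{H}$ of measurable functions is $Q$-Donsker (usual sense) if $\sup_{f\in\mathcal{H}}|f(z)-Qf|<\infty$ for every $z$ and, for $Z_1,Z_2,\dots$ i.i.d. with law $Q$ (coordinate projections), the processes $f\mapsto N^{-1/2}\sum_{i=1}^N(f(Z_i)-Qf)$ converge weakly (in the sense $E^*h(\cdot)\to Eh(\cdot)$ for bounded continuous $h$) in $l^\infty(\mathcal{H})$ to a tight Borel measurable random element. *)

theory Defs
  imports "HOL-Probability.Probability"
begin

section \<open>Outer probability and outer expectation\<close>

definition outer_prob :: "'a measure \<Rightarrow> 'a set \<Rightarrow> real" where
  "outer_prob M A = Inf {measure M B |B. B \<in> sets M \<and> A \<subseteq> B}"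

definition tendsto_zero_outer_prob :: "'a measure \<Rightarrow> (nat \<Rightarrow> 'a \<Rightarrow> real) \<Rightarrow> bool" where
  "tendsto_zero_outer_prob M T \<longleftrightarrow>
     (\<forall>\<epsilon>>0. (\<lambda>N. outer_prob M {\<omega> \<in> space M. \<bar>T N \<omega>\<bar> > \<epsilon>}) \<longlonglongrightarrow> 0)"

text \<open>Only used for bounded \<open>T\<close> on a probability space; there, restricting the measurable
  majorants to integrable real-valued ones does not change the infimum.\<close>

definition outer_expectation :: "'a measure \<Rightarrow> ('a \<Rightarrow> real) \<Rightarrow> real" where
  "outer_expectation M T =
     Inf {integral\<^sup>L M U |U. integrable M U \<and> (\<forall>\<omega>\<in>space M. T \<omega> \<le> U \<omega>)}"


section \<open>The space of bounded functions on a set\<close>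

text \<open>A bounded function on \<open>F\<close> is represented by its extension by \<^const>\<open>undefined\<close>
  outside \<open>F\<close>, so that it is determined by its values on \<open>F\<close>.\<close>

definition linf :: "'i set \<Rightarrow> ('i \<Rightarrow> real) set" where
  "linf F = {z \<in> extensional F. bounded (z ` F)}"

text \<open>The element \<open>0\<close> only matters for empty \<open>F\<close>, where \<^const>\<open>Sup\<close> on the reals is unspecified.\<close>

definition linf_norm :: "'i set \<Rightarrow> ('i \<Rightarrow> real) \<Rightarrow> real" where
  "linf_norm F z = Sup (insert 0 ((\<lambda>f. \<bar>z f\<bar>) ` F))"

text \<open>The value \<open>0\<close> off \<^const>\<open>linf\<close> is there because \<^const>\<open>Metric_space\<close> asks for
  nonnegativity on the whole type.\<close>

definition linf_dist :: "'i set \<Rightarrow> ('i \<Rightarrow> real) \<Rightarrow> ('i \<Rightarrow> real) \<Rightarrow> real" where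
  "linf_dist F z1 z2 =
     (if z1 \<in> linf F \<and> z2 \<in> linf F then linf_norm F (\<lambda>f. z1 f - z2 f) else 0)"

lemma linf_dist_upper:
  assumes "z1 \<in> linf F" "z2 \<in> linf F" "f \<in> F"
  shows "\<bar>z1 f - z2 f\<bar> \<le> linf_dist F z1 z2"
proof -
  have "bounded ((\<lambda>f. z1 f - z2 f) ` F)"
    using assms unfolding linf_def by (intro bounded_minus_comp) auto
  then obtain B where B: "\<And>f. f \<in> F \<Longrightarrow> \<bar>z1 f - z2 f\<bar> \<le> B"
    unfolding bounded_iff by auto
  have "bdd_above (insert 0 ((\<lambda>f. \<bar>z1 f - z2 f\<bar>) ` F))"
    unfolding bdd_above_insert using B by (intro bdd_aboveI2)
  then have "\<bar>z1 f - z2 f\<bar> \<le> linf_norm F (\<lambda>f. z1 f - z2 f)"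
    unfolding linf_norm_def using assms(3) by (intro cSup_upper) auto
  then show ?thesis using assms by (simp add: linf_dist_def)
qed

lemma linf_dist_least:
  assumes "\<And>f. f \<in> F \<Longrightarrow> \<bar>z1 f - z2 f\<bar> \<le> B" "0 \<le> B"
  shows "linf_dist F z1 z2 \<le> B"
proof -
  have "linf_norm F (\<lambda>f. z1 f - z2 f) \<le> B"
    unfolding linf_norm_def using assms by (intro cSup_least) auto
  then show ?thesis using assms(2) by (simp add: linf_dist_def)
qed

lemma linf_dist_nonneg: "0 \<le> linf_dist F z1 z2"
proof (cases "F \<noteq> {} \<and> z1 \<in> linf F \<and> z2 \<in> linf F")
  case True
  then show ?thesis
    using linf_dist_upper by (meson abs_ge_zero all_not_in_conv order_trans)
qed (auto simp: linf_dist_def linf_norm_def)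

lemma Metric_space_linf: "Metric_space (linf F) (linf_dist F)"
proof (rule Metric_space.intro)
  fix z1 z2 :: "'a \<Rightarrow> real"
  show "0 \<le> linf_dist F z1 z2" by (rule linf_dist_nonneg)
  show "linf_dist F z1 z2 = linf_dist F z2 z1"
    by (simp add: linf_dist_def linf_norm_def abs_minus_commute)
next
  fix z1 z2 :: "'a \<Rightarrow> real" assume z: "z1 \<in> linf F" "z2 \<in> linf F"
  show "linf_dist F z1 z2 = 0 \<longleftrightarrow> z1 = z2"
  proof
    assume "linf_dist F z1 z2 = 0"
    then have "\<And>f. f \<in> F \<Longrightarrow> z1 f = z2 f"
      using linf_dist_upper[OF z] by fastforce
    then show "z1 = z2" using z unfolding linf_def by (auto intro: extensionalityI)
  next
    assume "z1 = z2"
    then show "linf_dist F z1 z2 = 0"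
      using linf_dist_nonneg[of F z1 z2] linf_dist_least[of F z1 z2 0] by auto
  qed
next
  fix z1 z2 z3 :: "'a \<Rightarrow> real" assume z: "z1 \<in> linf F" "z2 \<in> linf F" "z3 \<in> linf F"
  show "linf_dist F z1 z3 \<le> linf_dist F z1 z2 + linf_dist F z2 z3"
  proof (rule linf_dist_least)
    fix f assume "f \<in> F"
    then show "\<bar>z1 f - z3 f\<bar> \<le> linf_dist F z1 z2 + linf_dist F z2 z3"
      using linf_dist_upper[OF z(1,2)] linf_dist_upper[OF z(2,3)] by fastforce
  qed (simp add: linf_dist_nonneg)
qed

definition linf_topology :: "'i set \<Rightarrow> ('i \<Rightarrow> real) topology" where
  "linf_topology F = Metric_space.mtopology (linf F) (linf_dist F)"

lemma topspace_linf_topology [simp]: "topspace (linf_topology F) = linf F"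
  unfolding linf_topology_def by (rule Metric_space.topspace_mtopology[OF Metric_space_linf])

definition linf_borel :: "'i set \<Rightarrow> ('i \<Rightarrow> real) measure" where
  "linf_borel F = sigma (linf F) {U. openin (linf_topology F) U}"

lemma space_linf_borel [simp]: "space (linf_borel F) = linf F"
  unfolding linf_borel_def by (rule space_measure_of) (use openin_subset in fastforce)

lemma sets_linf_borel: "sets (linf_borel F) = sigma_sets (linf F) {U. openin (linf_topology F) U}"
  unfolding linf_borel_def by (rule sets_measure_of) (use openin_subset in fastforce)

definition BL1_linf :: "'i set \<Rightarrow> (('i \<Rightarrow> real) \<Rightarrow> real) set" where
  "BL1_linf F = {h. (\<forall>z\<in>linf F. h z \<in> {0..1}) \<and>
     (\<forall>z1\<in>linf F. \<forall>z2\<in>linf F. \<bar>h z1 - h z2\<bar> \<le> linf_dist F z1 z2)}"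

definition tight_measure_on :: "'a topology \<Rightarrow> 'a measure \<Rightarrow> bool" where
  "tight_measure_on T L \<longleftrightarrow> (\<forall>\<epsilon>>0. \<exists>K. compactin T K \<and> K \<in> sets L \<and> measure L K \<ge> 1 - \<epsilon>)"

text \<open>Weak convergence of possibly non-measurable maps \<open>X N\<close>, defined on the probability space
  \<open>M\<close>, to a random element with law \<open>L\<close>.\<close>

definition weakly_converges_linf ::
    "'a measure \<Rightarrow> 'i set \<Rightarrow> (nat \<Rightarrow> 'a \<Rightarrow> ('i \<Rightarrow> real)) \<Rightarrow> ('i \<Rightarrow> real) measure \<Rightarrow> bool" where
  "weakly_converges_linf M F X L \<longleftrightarrow>
     (\<forall>h. continuous_map (linf_topology F) euclideanreal h \<and> bounded (h ` linf F) \<longrightarrow>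
       (\<lambda>N. outer_expectation M (\<lambda>\<omega>. h (X N \<omega>))) \<longlonglongrightarrow> integral\<^sup>L L h)"


section \<open>Donsker classes\<close>

definition empirical_process ::
    "'z measure \<Rightarrow> ('z \<Rightarrow> real) set \<Rightarrow> nat \<Rightarrow> (nat \<Rightarrow> 'z) \<Rightarrow> (('z \<Rightarrow> real) \<Rightarrow> real)" where
  "empirical_process Q H N z =
     (\<lambda>f\<in>H. (1 / sqrt (real N)) * (\<Sum>i<N. f (z i) - integral\<^sup>L Q f))"

definition Donsker_class :: "'z measure \<Rightarrow> ('z \<Rightarrow> real) set \<Rightarrow> bool" where
  "Donsker_class Q H \<longleftrightarrow>
     (\<forall>f\<in>H. f \<in> borel_measurable Q \<and> integrable Q f) \<and>
     (\<forall>z\<in>space Q. bounded ((\<lambda>f. f z - integral\<^sup>L Q f) ` H)) \<and>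
     (\<exists>L. prob_space L \<and> sets L = sets (linf_borel H) \<and> tight_measure_on (linf_topology H) L \<and>
        weakly_converges_linf (\<Pi>\<^sub>M i\<in>(UNIV :: nat set). Q) H (empirical_process Q H) L)"


section \<open>Gaussian processes\<close>

definition normal_law :: "real measure \<Rightarrow> bool" where
  "normal_law L \<longleftrightarrow>
     (\<exists>\<mu> \<sigma>. \<sigma> > 0 \<and> L = density lborel (\<lambda>x. ennreal (normal_density \<mu> \<sigma> x))) \<or>
     (\<exists>\<mu>. L = return borel \<mu>)"

definition gaussian_process :: "'a measure \<Rightarrow> 'i set \<Rightarrow> ('a \<Rightarrow> 'i \<Rightarrow> real) \<Rightarrow> bool" where
  "gaussian_process M F G \<longleftrightarrow>
     (\<forall>f\<in>F. (\<lambda>\<omega>. G \<omega> f) \<in> borel_measurable M) \<and>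
     (\<forall>J a. finite J \<and> J \<subseteq> F \<longrightarrow> normal_law (distr M borel (\<lambda>\<omega>. \<Sum>f\<in>J. a f * G \<omega> f)))"

definition centered_gaussian_process ::
    "'a measure \<Rightarrow> 'i set \<Rightarrow> ('i \<Rightarrow> 'i \<Rightarrow> real) \<Rightarrow> ('a \<Rightarrow> 'i \<Rightarrow> real) \<Rightarrow> bool" where
  "centered_gaussian_process M F C G \<longleftrightarrow> gaussian_process M F G \<and>
     (\<forall>f\<in>F. (\<integral>\<omega>. G \<omega> f \<partial>M) = 0) \<and>
     (\<forall>f\<in>F. \<forall>g\<in>F. (\<integral>\<omega>. G \<omega> f * G \<omega> g \<partial>M) = C f g)"


section \<open>Poisson sampling\<close>

text \<open>Sequences and units are indexed from \<open>0\<close>: a sample of size \<open>N\<close> has units \<open>i < N\<close>, and the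
  elements of \<open>{0,1}\<^sup>N\<close> are enumerated as \<open>enum 0, \<dots>, enum (2 ^ N - 1)\<close>.\<close>

definition indicator_vectors :: "nat \<Rightarrow> (nat \<Rightarrow> nat) set" where
  "indicator_vectors N = {..<N} \<rightarrow>\<^sub>E {0, 1}"

definition poisson_prob :: "nat \<Rightarrow> (nat \<Rightarrow> real) \<Rightarrow> (nat \<Rightarrow> nat) \<Rightarrow> real" where
  "poisson_prob N \<pi> s = (\<Prod>i<N. \<pi> i ^ s i * (1 - \<pi> i) ^ (1 - s i))"

definition measurable_poisson_design ::
    "'x measure \<Rightarrow> nat \<Rightarrow> ((nat \<Rightarrow> 'x) \<Rightarrow> nat \<Rightarrow> real) \<Rightarrow> bool" where
  "measurable_poisson_design MX N \<pi> \<longleftrightarrow>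
     (\<forall>x\<in>space (\<Pi>\<^sub>M i\<in>{..<N}. MX). \<forall>i<N. \<pi> x i \<in> {0..1}) \<and>
     (\<forall>s\<in>indicator_vectors N.
        (\<lambda>x. poisson_prob N (\<pi> x) s) \<in> borel_measurable (\<Pi>\<^sub>M i\<in>{..<N}. MX))"

text \<open>Inversion sampling: the vector selected by a point \<open>u\<close> of the unit interval.  The first cell
  also contains all \<open>u \<le> p (enum 0)\<close>.\<close>

definition inversion_sample ::
    "(nat \<Rightarrow> nat \<Rightarrow> nat) \<Rightarrow> nat \<Rightarrow> ((nat \<Rightarrow> nat) \<Rightarrow> real) \<Rightarrow> real \<Rightarrow> (nat \<Rightarrow> nat)" where
  "inversion_sample enum N p u = enum (THE k. k < 2 ^ N \<and>
     (k = 0 \<or> (\<Sum>j<k. p (enum j)) < u) \<and> u \<le> (\<Sum>j\<le>k. p (enum j)))"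

lemma sum_poisson_prob: "(\<Sum>s\<in>indicator_vectors N. poisson_prob N \<pi> s) = 1"
proof -
  have "(\<Sum>s\<in>indicator_vectors N. poisson_prob N \<pi> s) =
      (\<Prod>i<N. \<Sum>b\<in>{0, 1::nat}. \<pi> i ^ b * (1 - \<pi> i) ^ (1 - b))"
    unfolding indicator_vectors_def poisson_prob_def by (subst prod_sum_PiE) auto
  then show ?thesis by simp
qed

lemma poisson_prob_nonneg:
  assumes "\<And>i. i < N \<Longrightarrow> \<pi> i \<in> {0..1}"
  shows "0 \<le> poisson_prob N \<pi> s"
  unfolding poisson_prob_def using assms by (intro prod_nonneg) auto

text \<open>The inversion construction selects \<open>s\<close> with probability \<open>p s\<close>, so that the expectation over
  the design is the usual finite sum.\<close>

lemma integral_inversion_sample: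
  fixes D :: "'d \<Rightarrow> real" and p :: "(nat \<Rightarrow> nat) \<Rightarrow> real" and g :: "(nat \<Rightarrow> nat) \<Rightarrow> real"
  assumes D: "D \<in> borel_measurable Pd" "distr Pd borel D = uniform_measure lborel {0..1}"
    and enum: "bij_betw enum {..<2 ^ N} S"
    and p: "\<And>s. s \<in> S \<Longrightarrow> 0 \<le> p s" "(\<Sum>s\<in>S. p s) = 1"
  shows "(\<integral>d. g (inversion_sample enum N p (D d)) \<partial>Pd) = (\<Sum>s\<in>S. g s * p s)"
proof -
  define K where "K = (2::nat) ^ N"
  have K: "K > 0" by (simp add: K_def)
  define q where "q k = p (enum k)" for k
  define c where "c k = (\<Sum>j<k. q j)" for k
  have q: "0 \<le> q k" if "k < K" for k
    using that enum p(1) unfolding q_def K_def bij_betw_def by auto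
  have c_mono: "c k \<le> c l" if "k \<le> l" "l \<le> K" for k l
    unfolding c_def using that q by (intro sum_mono2) auto
  have cK: "c K = 1"
    unfolding c_def q_def K_def using p(2) sum.reindex_bij_betw[OF enum, of p] by simp
  have c0: "c 0 = 0" by (simp add: c_def)
  define R where "R u k \<longleftrightarrow> k < K \<and> (k = 0 \<or> c k < u) \<and> u \<le> c (Suc k)" for u k
  have inv: "inversion_sample enum N p u = enum (THE k. R u k)" for u
    unfolding inversion_sample_def R_def c_def q_def K_def by (simp add: lessThan_Suc_atMost)
  have R_uniq: "(THE k. R u k) = k" if "R u k" for u k
  proof (rule the_equality[of "R u", OF that])
    fix l assume l: "R u l"
    show "l = k"
    proof (rule ccontr)
      assume "l \<noteq> k"
      then consider "l < k" | "k < l" by linarith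
      then show False
      proof cases
        case 1
        then show False using l that c_mono[of "Suc l" k] unfolding R_def by auto
      next
        case 2
        then show False using l that c_mono[of "Suc k" l] unfolding R_def by auto
      qed
    qed
  qed
  have R_ex: "\<exists>k. R u k" if "u \<le> 1" for u
  proof -
    define k where "k = (LEAST k. u \<le> c (Suc k))"
    have ex: "u \<le> c (Suc (K - 1))" using that K cK by simp
    have k1: "u \<le> c (Suc k)" unfolding k_def by (rule LeastI[of "\<lambda>k. u \<le> c (Suc k)", OF ex])
    have "k \<le> K - 1" unfolding k_def by (rule Least_le[of "\<lambda>k. u \<le> c (Suc k)", OF ex])
    moreover have "c k < u" if k0: "k \<noteq> 0"
    proof -
      obtain m where m: "k = Suc m" using not0_implies_Suc[OF k0] ..
      have "m < (LEAST k. u \<le> c (Suc k))" unfolding k_def[symmetric] m by (rule lessI)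
      then have "\<not> u \<le> c (Suc m)" by (rule not_less_Least)
      then show ?thesis using m by simp
    qed
    ultimately show ?thesis using k1 K unfolding R_def by (intro exI[of _ k]) auto
  qed
  define G where "G u = (\<Sum>k<K. g (enum k) * indicator {c k<..c (Suc k)} u)" for u :: real
  have G: "g (inversion_sample enum N p u) = G u" if u: "0 < u" "u \<le> 1" for u
  proof -
    obtain k where k: "R u k" using R_ex[OF u(2)] by blast
    have "R u l \<longleftrightarrow> u \<in> {c l<..c (Suc l)}" if "l < K" for l
      using that u(1) c0 unfolding R_def by auto
    then have "G u = (\<Sum>l<K. g (enum l) * (if R u l then 1 else 0))"
      unfolding G_def by (intro sum.cong) (auto simp: indicator_def)
    also have "\<dots> = (\<Sum>l<K. if l = k then g (enum l) else 0)"
    proof (intro sum.cong refl)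
      fix l
      have "R u l \<longleftrightarrow> l = k" using k R_uniq[of u l] R_uniq[of u k] by auto
      then show "g (enum l) * (if R u l then 1 else 0) = (if l = k then g (enum l) else 0)" by simp
    qed
    also have "\<dots> = g (enum k)" using k unfolding R_def by auto
    finally show ?thesis using inv R_uniq[OF k] by simp
  qed
  have pieces: "g (inversion_sample enum N p u) =
      (if u \<le> 0 then g (enum 0) else if u \<le> 1 then G u else g (enum (THE k. False)))" for u
  proof -
    consider "u \<le> 0" | "0 < u" "u \<le> 1" | "1 < u" by linarith
    then show ?thesis
    proof cases
      case 1
      then have "R u 0" using K q[OF K] unfolding R_def c_def by auto
      then show ?thesis using 1 inv R_uniq by simp
    next
      case 2
      then show ?thesis using G by simp
    next
      case 3
      have "\<not> R u k" for k
        using 3 c_mono[of "Suc k" K] cK unfolding R_def by auto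
      then show ?thesis using 3 inv by simp
    qed
  qed
  have Gm [measurable]: "G \<in> borel_measurable borel" unfolding G_def by measurable
  have m: "(\<lambda>u. g (inversion_sample enum N p u)) \<in> borel_measurable borel"
    unfolding pieces by measurable
  have ci: "{c k<..c (Suc k)} \<subseteq> {0..1}" if "k < K" for k
    using c_mono[of 0 k] c_mono[of "Suc k" K] that c0 cK by auto
  let ?U = "uniform_measure lborel {0..1::real}"
  interpret U: prob_space ?U by (rule prob_space_uniform_measure) auto
  have "(\<integral>d. g (inversion_sample enum N p (D d)) \<partial>Pd) = (\<integral>u. g (inversion_sample enum N p u) \<partial>distr Pd borel D)"
    by (rule integral_distr[symmetric]) (use D m in auto)
  also have "\<dots> = (\<integral>u. G u \<partial>?U)"
    unfolding D(2)
  proof (rule integral_cong_AE)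
    have "AE u in lborel. u \<noteq> (0::real)" by (rule AE_lborel_singleton)
    then have "AE u in ?U. 0 < u \<and> u \<le> 1"
      by (intro AE_uniform_measureI) auto
    then show "AE u in ?U. g (inversion_sample enum N p u) = G u"
      using G by auto
  qed (use m Gm in simp_all)
  also have "\<dots> = (\<Sum>k<K. g (enum k) * measure ?U {c k<..c (Suc k)})"
  proof -
    have int: "integrable ?U (\<lambda>u. indicator {c k<..c (Suc k)} u :: real)" for k
      by (rule U.integrable_const_bound[where B = 1]) (auto simp: indicator_def)
    then have "(\<integral>u. G u \<partial>?U) = (\<Sum>k<K. \<integral>u. g (enum k) * indicator {c k<..c (Suc k)} u \<partial>?U)"
      unfolding G_def by (intro Bochner_Integration.integral_sum integrable_mult_right)
    then show ?thesis by simp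
  qed
  also have "\<dots> = (\<Sum>k<K. g (enum k) * q k)"
  proof (intro sum.cong refl)
    fix k assume "k \<in> {..<K}"
    then have k: "k < K" by simp
    have "measure ?U {c k<..c (Suc k)} = measure lborel ({0..1} \<inter> {c k<..c (Suc k)})"
      by (subst measure_uniform_measure) auto
    also have "{0..1} \<inter> {c k<..c (Suc k)} = {c k<..c (Suc k)}" using ci[OF k] by auto
    also have "measure lborel {c k<..c (Suc k)} = q k"
      using q[OF k] by (simp add: c_def)
    finally show "g (enum k) * measure ?U {c k<..c (Suc k)} = g (enum k) * q k" by simp
  qed
  also have "\<dots> = (\<Sum>s\<in>S. g s * p s)"
    unfolding q_def K_def by (rule sum.reindex_bij_betw[OF enum])
  finally show ?thesis .
qed


section \<open>The underlying probability space\<close>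

text \<open>\<open>P\<close> is the joint law of \<open>(Y\<^sub>1, X\<^sub>1)\<close>; a point is \<open>(z, d, e)\<close> with \<open>z i = (Y\<^sub>i, X\<^sub>i)\<close>.\<close>

definition sampling_space ::
    "('y \<times> 'x) measure \<Rightarrow> 'd measure \<Rightarrow> 'e measure \<Rightarrow> ((nat \<Rightarrow> 'y \<times> 'x) \<times> 'd \<times> (nat \<Rightarrow> 'e)) measure" where
  "sampling_space P Pd Pe =
     (\<Pi>\<^sub>M i\<in>(UNIV :: nat set). P) \<Otimes>\<^sub>M Pd \<Otimes>\<^sub>M (\<Pi>\<^sub>M i\<in>(UNIV :: nat set). Pe)"

definition Yseq :: "(nat \<Rightarrow> 'y \<times> 'x) \<times> 'd \<times> 'e \<Rightarrow> nat \<Rightarrow> 'y" where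
  "Yseq \<omega> i = fst (fst \<omega> i)"

definition Xvec :: "nat \<Rightarrow> (nat \<Rightarrow> 'y \<times> 'x) \<times> 'd \<times> 'e \<Rightarrow> nat \<Rightarrow> 'x" where
  "Xvec N \<omega> = (\<lambda>i\<in>{..<N}. snd (fst \<omega> i))"

definition sample_indicators ::
    "('d \<Rightarrow> real) \<Rightarrow> (nat \<Rightarrow> nat \<Rightarrow> nat \<Rightarrow> nat) \<Rightarrow> (nat \<Rightarrow> (nat \<Rightarrow> 'x) \<Rightarrow> nat \<Rightarrow> real) \<Rightarrow> nat \<Rightarrow>
      (nat \<Rightarrow> 'y \<times> 'x) \<times> 'd \<times> 'e \<Rightarrow> (nat \<Rightarrow> nat)" where
  "sample_indicators D enum \<pi> N \<omega> =
     inversion_sample (enum N) N (poisson_prob N (\<pi> N (Xvec N \<omega>))) (D (fst (snd \<omega>)))"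

definition HT_process ::
    "('y \<Rightarrow> real) set \<Rightarrow> ('d \<Rightarrow> real) \<Rightarrow> (nat \<Rightarrow> nat \<Rightarrow> nat \<Rightarrow> nat) \<Rightarrow> (nat \<Rightarrow> (nat \<Rightarrow> 'x) \<Rightarrow> nat \<Rightarrow> real) \<Rightarrow>
      nat \<Rightarrow> (nat \<Rightarrow> 'y \<times> 'x) \<times> 'd \<times> 'e \<Rightarrow> (('y \<Rightarrow> real) \<Rightarrow> real)" where
  "HT_process F D enum \<pi> N \<omega> =
     (\<lambda>f\<in>F. (1 / sqrt (real N)) *
        (\<Sum>i<N. (real (sample_indicators D enum \<pi> N \<omega> i) / \<pi> N (Xvec N \<omega>) i - 1) * f (Yseq \<omega> i)))"

text \<open>Expectation \<open>E\<^sub>d\<close> over the \<open>d\<close>-coordinate, all other coordinates of \<open>\<omega>\<close> being held fixed.\<close>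

definition design_expectation :: "'d measure \<Rightarrow> ('z \<times> 'd \<times> 'e \<Rightarrow> real) \<Rightarrow> 'z \<times> 'd \<times> 'e \<Rightarrow> real" where
  "design_expectation Pd T \<omega> = (\<integral>d. T (fst \<omega>, d, snd (snd \<omega>)) \<partial>Pd)"

lemma design_expectation_eq_sum:
  assumes "D \<in> borel_measurable Pd" "distr Pd borel D = uniform_measure lborel {0..1}"
    and "bij_betw (enum N) {..<2 ^ N} (indicator_vectors N)"
    and "\<And>i. i < N \<Longrightarrow> \<pi> N (Xvec N \<omega>) i \<in> {0..1}"
  shows "design_expectation Pd (\<lambda>\<eta>. g (sample_indicators D enum \<pi> N \<eta>) (Yseq \<eta>) (Xvec N \<eta>)) \<omega> =
    (\<Sum>s\<in>indicator_vectors N. g s (Yseq \<omega>) (Xvec N \<omega>) * poisson_prob N (\<pi> N (Xvec N \<omega>)) s)"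
proof -
  have [simp]: "Xvec N (fst \<omega>, d, snd (snd \<omega>)) = Xvec N \<omega>"
    "Yseq (fst \<omega>, d, snd (snd \<omega>)) = Yseq \<omega>" for d
    by (auto simp: Xvec_def Yseq_def)
  show ?thesis
    unfolding design_expectation_def sample_indicators_def
    using integral_inversion_sample[OF assms(1,2,3) poisson_prob_nonneg[OF assms(4)] sum_poisson_prob,
        where g = "\<lambda>s. g s (Yseq \<omega>) (Xvec N \<omega>)"]
    by simp
qed


section \<open>Truncated size variable and limit covariance\<close>

definition mean_size :: "('y \<times> 'x) measure \<Rightarrow> ('x \<Rightarrow> real) \<Rightarrow> real" where
  "mean_size P w = (\<integral>(y, x). w x \<partial>P)"

definition w_trunc :: "('y \<times> 'x) measure \<Rightarrow> ('x \<Rightarrow> real) \<Rightarrow> real \<Rightarrow> 'x \<Rightarrow> real" where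
  "w_trunc P w \<theta> x = min (w x) (mean_size P w / \<theta>)"

definition Sigma_HT ::
    "('y \<times> 'x) measure \<Rightarrow> ('x \<Rightarrow> real) \<Rightarrow> real \<Rightarrow> ('y \<Rightarrow> real) \<Rightarrow> ('y \<Rightarrow> real) \<Rightarrow> real" where
  "Sigma_HT P w \<theta> f g =
     (\<integral>(y, x). w_trunc P w \<theta> x * (mean_size P w / \<theta> - w_trunc P w \<theta> x) *
        (f y * g y / (w_trunc P w \<theta> x)\<^sup>2) \<partial>P)"

end

theory Submission
  imports Defs
begin

text \<open>
  With \<open>z\<^sub>i = (Y\<^sub>i, X\<^sub>i)\<close> and \<open>g = f / w\<^sub>\<theta>\<close>, the Horvitz--Thompson process is
  \<open>N\<^sup>-\<^sup>1\<^sup>/\<^sup>2 \<Sum>\<^sub>i \<xi>\<^sub>i g(z\<^sub>i)\<close> with multipliers \<open>\<xi>\<^sub>i = (S\<^sub>i / \<pi>\<^sub>i - 1) w\<^sub>\<theta>(X\<^sub>i)\<close> that are, given the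
  population, independent, centred and bounded, because \<open>\<pi>\<^sub>i = min (w(X\<^sub>i) / A\<^sub>N) 1\<close> and \<open>A\<^sub>N\<close>
  converges to \<open>E w / \<theta>\<close>.

  Oscillations over the cells of a fine finite partition of \<open>F\<close>: each \<open>\<xi>\<^sub>i\<close> is, up to scaling, a
  conditional expectation of a Rademacher sign, so the conditional tail of the oscillation is bounded by
  a Rademacher tail.  For fixed signs a signed sum is a difference of two unsigned sums with at least \<open>N\<close>
  terms each, which are controlled by the Donsker property through tightness of the limit.  All
  comparisons are between tail probabilities, hence no moments of suprema occur.

  Values at the finitely many cell representatives: a Lindeberg estimate for characteristic functions,
  given the population, and the weak law of large numbers for the conditional covariances.  Convergence of
  characteristic functions is made uniform over bounded Lipschitz functions by interpolation with products
  of tents, which are Fourier integrals.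
\<close>

section \<open>Products of finitely many weights and Rademacher sums\<close>

text \<open>The Donsker property controls centred functions only, and only their tail probabilities:
  suprema over \<open>F\<close> need be neither measurable nor integrable. Given the population,
  every expectation is a finite sum \<open>prod_exp\<close>, so non-measurable events and
  functionals may stand inside it; outer probabilities are needed only for the population. The
  multipliers act on uncentred functions. Since the means over the class are bounded, the partition
  can also make them nearly constant on each cell; what centring leaves over is then a small
  multiple of the single variable \<Sum>\<xi>. Truncating the size variable at E w / \<theta> is
  what bounds the multipliers: the quotient of the truncated size and the inclusion probability is
  at most the larger of the random and the limiting normalization. The population limits hold in
  probability, not almost surely. The finite-dimensional limit theorem is therefore put as an
  \<epsilon>-\<delta> statement about arbitrary finite arrays, so that it applies at each single
  population outside a small exceptional set.\<close>

definition prod_exp :: "nat \<Rightarrow> 'b set \<Rightarrow> (nat \<Rightarrow> 'b \<Rightarrow> real) \<Rightarrow> ((nat \<Rightarrow> 'b) \<Rightarrow> real) \<Rightarrow> real" where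
  "prod_exp N B q G = (\<Sum>s\<in>{..<N} \<rightarrow>\<^sub>E B. (\<Prod>i<N. q i (s i)) * G s)"

lemma prod_exp_0 [simp]: "prod_exp 0 B q G = G (\<lambda>_. undefined)"
  by (simp add: prod_exp_def)

text \<open>Conditioning on the last coordinate; the moment computations below are inductions along
  this identity.\<close>

lemma prod_exp_Suc:
  "prod_exp (Suc N) B q G = (\<Sum>b\<in>B. q N b * prod_exp N B q (\<lambda>s. G (s(N := b))))"
proof -
  let ?I = "B \<times> ({..<N} \<rightarrow>\<^sub>E B)"
  have inj: "inj_on (\<lambda>(b, s). s(N := b)) ?I"
    using inj_combinator[of N "{..<N}" "\<lambda>_. B"] by simp
  have "prod_exp (Suc N) B q G =
      (\<Sum>s\<in>(\<lambda>(b, s). s(N := b)) ` ?I. (\<Prod>i<Suc N. q i (s i)) * G s)"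
    unfolding prod_exp_def lessThan_Suc PiE_insert_eq ..
  also have "\<dots> = (\<Sum>(b, s)\<in>?I. q N b * ((\<Prod>i<N. q i (s i)) * G (s(N := b))))"
    by (subst sum.reindex[OF inj]) (intro sum.cong refl, simp add: case_prod_unfold)
  also have "\<dots> = (\<Sum>b\<in>B. \<Sum>s\<in>{..<N} \<rightarrow>\<^sub>E B. q N b * ((\<Prod>i<N. q i (s i)) * G (s(N := b))))"
    by (rule sum.cartesian_product[symmetric])
  finally show ?thesis by (simp add: prod_exp_def sum_distrib_left)
qed

lemma prod_exp_add: "prod_exp N B q (\<lambda>s. G s + H s) = prod_exp N B q G + prod_exp N B q H"
  by (simp add: prod_exp_def algebra_simps sum.distrib)

lemma prod_exp_diff: "prod_exp N B q (\<lambda>s. G s - H s) = prod_exp N B q G - prod_exp N B q H"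
  by (simp add: prod_exp_def algebra_simps sum_subtractf)

lemma prod_exp_cmult: "prod_exp N B q (\<lambda>s. c * G s) = c * prod_exp N B q G"
  by (simp add: prod_exp_def algebra_simps sum_distrib_left)

locale product_weights =
  fixes N :: nat and B :: "'b set" and q :: "nat \<Rightarrow> 'b \<Rightarrow> real"
  assumes fin: "finite B"
    and nonneg: "\<And>i b. i < N \<Longrightarrow> b \<in> B \<Longrightarrow> 0 \<le> q i b"
    and total: "\<And>i. i < N \<Longrightarrow> (\<Sum>b\<in>B. q i b) = 1"
begin

lemma weight_nonneg: "s \<in> {..<N} \<rightarrow>\<^sub>E B \<Longrightarrow> 0 \<le> (\<Prod>i<N. q i (s i))"
  using nonneg by (auto intro!: prod_nonneg)

lemma prod_exp_mono:
  assumes "\<And>s. s \<in> {..<N} \<rightarrow>\<^sub>E B \<Longrightarrow> G s \<le> H s"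
  shows "prod_exp N B q G \<le> prod_exp N B q H"
  unfolding prod_exp_def using assms weight_nonneg by (auto intro!: sum_mono mult_left_mono)

lemma prod_exp_const: "prod_exp N B q (\<lambda>_. c) = c"
proof -
  have "(\<Sum>s\<in>{..<N} \<rightarrow>\<^sub>E B. \<Prod>i<N. q i (s i)) = 1"
    using prod_sum_PiE[of "{..<N}" "\<lambda>_. B" q] fin total by simp
  then show ?thesis by (simp add: prod_exp_def sum_distrib_right[symmetric])
qed

lemma prod_exp_abs: "\<bar>prod_exp N B q G\<bar> \<le> prod_exp N B q (\<lambda>s. \<bar>G s\<bar>)"
  unfolding prod_exp_def using weight_nonneg
  by (auto intro!: order_trans[OF sum_abs] sum_mono simp: abs_mult)

lemma prod_exp_markov:
  assumes "\<And>s. 0 \<le> G s" "u > 0"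
  shows "prod_exp N B q (\<lambda>s. of_bool (G s > u)) \<le> prod_exp N B q G / u"
proof -
  have "prod_exp N B q (\<lambda>s. of_bool (G s > u)) \<le> prod_exp N B q (\<lambda>s. (1 / u) * G s)"
    using assms by (intro prod_exp_mono) (auto simp: field_simps)
  then show ?thesis by (simp only: prod_exp_cmult) simp
qed

end

lemma product_weights_Suc:
  "product_weights (Suc N) B q \<Longrightarrow> product_weights N B q"
  by (simp add: product_weights_def)

lemma prod_exp_linear_centered:
  assumes "product_weights N B q" "\<And>i. i < N \<Longrightarrow> (\<Sum>b\<in>B. q i b * \<xi> i b) = 0"
  shows "prod_exp N B q (\<lambda>s. \<Sum>i<N. \<xi> i (s i)) = 0"
  using assms
proof (induction N)
  case (Suc N)
  interpret product_weights N B q using product_weights_Suc[OF Suc.prems(1)] .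
  have "prod_exp N B q (\<lambda>s. \<Sum>i<N. \<xi> i (s i)) = 0"
    using Suc product_weights_Suc[OF Suc.prems(1)] by simp
  then show ?case
    using Suc.prems(2)[of N] by (simp add: prod_exp_Suc prod_exp_add prod_exp_const)
qed simp

text \<open>Independence removes the cross terms: a last coordinate of value x turns the second
  moment into E W^2 + 2 x E W + x^2, and W is centred.\<close>

lemma prod_exp_square_centered:
  assumes "product_weights N B q" "\<And>i. i < N \<Longrightarrow> (\<Sum>b\<in>B. q i b * \<xi> i b) = 0"
  shows "prod_exp N B q (\<lambda>s. (\<Sum>i<N. \<xi> i (s i))\<^sup>2) = (\<Sum>i<N. \<Sum>b\<in>B. q i b * (\<xi> i b)\<^sup>2)"
  using assms
proof (induction N)
  case (Suc N)
  interpret product_weights N B q using product_weights_Suc[OF Suc.prems(1)] .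
  interpret S: product_weights "Suc N" B q using Suc.prems(1) .
  let ?W = "\<lambda>s. \<Sum>i<N. \<xi> i (s i)"
  have IH: "prod_exp N B q (\<lambda>s. (?W s)\<^sup>2) = (\<Sum>i<N. \<Sum>b\<in>B. q i b * (\<xi> i b)\<^sup>2)"
    using Suc product_weights_Suc[OF Suc.prems(1)] by simp
  have lin: "prod_exp N B q ?W = 0"
    using prod_exp_linear_centered[OF product_weights_Suc[OF Suc.prems(1)]] Suc.prems(2) by simp
  have "prod_exp N B q (\<lambda>s. (?W s + x)\<^sup>2) = prod_exp N B q (\<lambda>s. (?W s)\<^sup>2) + x\<^sup>2" for x
  proof -
    have "(\<lambda>s. (?W s + x)\<^sup>2) = (\<lambda>s. (?W s)\<^sup>2 + ((2 * x) * ?W s + x\<^sup>2))"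
      by (rule ext) (simp add: power2_sum)
    then show ?thesis by (simp only: prod_exp_add prod_exp_const prod_exp_cmult lin mult_zero_right add_0)
  qed
  then have "prod_exp (Suc N) B q (\<lambda>s. (\<Sum>i<Suc N. \<xi> i (s i))\<^sup>2) =
      (\<Sum>b\<in>B. q N b * (prod_exp N B q (\<lambda>s. (?W s)\<^sup>2) + (\<xi> N b)\<^sup>2))"
    by (simp add: prod_exp_Suc)
  also have "\<dots> = (\<Sum>b\<in>B. q N b) * prod_exp N B q (\<lambda>s. (?W s)\<^sup>2) + (\<Sum>b\<in>B. q N b * (\<xi> N b)\<^sup>2)"
    by (simp only: distrib_left sum.distrib sum_distrib_right)
  finally show ?case using S.total[of N] IH by simp
qed simp

section \<open>Moments and tails of Rademacher sums\<close>

abbreviation rademacher_exp :: "nat \<Rightarrow> ((nat \<Rightarrow> real) \<Rightarrow> real) \<Rightarrow> real" where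
  "rademacher_exp N \<equiv> prod_exp N {-1, 1} (\<lambda>_ _. 1 / 2)"

lemma rademacher_weights: "product_weights N {-1, 1 :: real} (\<lambda>_ _. 1 / 2)"
  by unfold_locales auto

lemma rademacher_square: "rademacher_exp N (\<lambda>e. (\<Sum>i<N. e i * k i)\<^sup>2) = (\<Sum>i<N. (k i)\<^sup>2)"
  using prod_exp_square_centered[OF rademacher_weights, of N "\<lambda>i e. e * k i"] by simp

text \<open>Averaging over the last sign cancels the odd powers and leaves W^4 + 6 k^2 W^2 + k^4.
  Enlarging k^4 to 3 k^4 completes the square of the new variance.\<close>

lemma rademacher_fourth:
  "rademacher_exp N (\<lambda>e. (\<Sum>i<N. e i * k i) ^ 4) \<le> 3 * (\<Sum>i<N. (k i)\<^sup>2)\<^sup>2"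
proof (induction N)
  case (Suc N)
  interpret product_weights N "{-1, 1 :: real}" "\<lambda>_ _. 1 / 2" by (rule rademacher_weights)
  let ?W = "\<lambda>e :: nat \<Rightarrow> real. \<Sum>i<N. e i * k i"
  have "rademacher_exp (Suc N) (\<lambda>e. (\<Sum>i<Suc N. e i * k i) ^ 4) =
      rademacher_exp N (\<lambda>e. (1 / 2) * (?W e - k N) ^ 4 + (1 / 2) * (?W e + k N) ^ 4)"
    by (simp only: prod_exp_Suc prod_exp_add prod_exp_cmult) simp
  also have "(\<lambda>e. (1 / 2) * (?W e - k N) ^ 4 + (1 / 2) * (?W e + k N) ^ 4) =
      (\<lambda>e. (?W e) ^ 4 + (6 * (k N)\<^sup>2 * (?W e)\<^sup>2 + (k N) ^ 4))"
    by (rule ext) (simp add: power2_eq_square power4_eq_xxxx algebra_simps)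
  also have "rademacher_exp N \<dots> = rademacher_exp N (\<lambda>e. (?W e) ^ 4) +
      (6 * (k N)\<^sup>2 * (\<Sum>i<N. (k i)\<^sup>2) + (k N) ^ 4)"
    unfolding prod_exp_add prod_exp_cmult prod_exp_const rademacher_square ..
  also have "\<dots> \<le> 3 * (\<Sum>i<N. (k i)\<^sup>2)\<^sup>2 + (6 * (k N)\<^sup>2 * (\<Sum>i<N. (k i)\<^sup>2) + 3 * (k N) ^ 4)"
  proof -
    have "0 \<le> k N ^ 4" by simp
    then show ?thesis using Suc.IH by linarith
  qed
  also have "\<dots> = 3 * (\<Sum>i<Suc N. (k i)\<^sup>2)\<^sup>2"
    by (simp add: power2_eq_square power4_eq_xxxx algebra_simps)
  finally show ?case .
qed simp

text \<open>Paley--Zygmund: \<open>S\<^sup>2 \<le> t\<^sup>2 + S\<^sup>4 / (12\<sigma>\<^sup>2) + 3\<sigma>\<^sup>2 1{\<bar>S\<bar> > t}\<close> pointwise, and the fourth moment is at most \<open>3\<sigma>\<^sup>4\<close>.\<close>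

lemma rademacher_variance_bound:
  assumes "rademacher_exp N (\<lambda>e. of_bool (\<exists>k\<in>K. \<bar>\<Sum>i<N. e i * k i\<bar> > t)) < 1 / 12" "k \<in> K" "t \<ge> 0"
  shows "(\<Sum>i<N. (k i)\<^sup>2) \<le> 2 * t\<^sup>2"
proof (cases "(\<Sum>i<N. (k i)\<^sup>2) = 0")
  case False
  interpret product_weights N "{-1, 1 :: real}" "\<lambda>_ _. 1 / 2" by (rule rademacher_weights)
  define v where "v = (\<Sum>i<N. (k i)\<^sup>2)"
  have v: "v > 0" using False sum_nonneg[of "{..<N}" "\<lambda>i. (k i)\<^sup>2"] by (simp add: v_def)
  let ?W = "\<lambda>e :: nat \<Rightarrow> real. \<Sum>i<N. e i * k i"
  let ?p = "rademacher_exp N (\<lambda>e. of_bool (\<exists>k\<in>K. \<bar>\<Sum>i<N. e i * k i\<bar> > t))"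
  have pw: "(?W e)\<^sup>2 \<le> t\<^sup>2 + ((1 / (12 * v)) * (?W e) ^ 4 +
      (3 * v) * of_bool (\<exists>k\<in>K. \<bar>\<Sum>i<N. e i * k i\<bar> > t))" for e
  proof (cases "\<bar>?W e\<bar> > t")
    case True
    define W where "W = (?W e)\<^sup>2"
    \<comment> \<open>Completing the square at W = 6v produces the coefficients 1 / (12v) and
      3v.\<close>
    have "0 \<le> (W - 6 * v)\<^sup>2 / (12 * v)" using v by simp
    also have "\<dots> = (1 / (12 * v)) * W\<^sup>2 - W + 3 * v"
      using v by (simp add: power2_eq_square field_simps)
    finally have "W \<le> (1 / (12 * v)) * W\<^sup>2 + 3 * v" by simp
    moreover have "W\<^sup>2 = (?W e) ^ 4" by (simp add: W_def)
    moreover have "\<exists>k\<in>K. \<bar>\<Sum>i<N. e i * k i\<bar> > t" using True assms(2) by blast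
    ultimately show ?thesis by (simp add: W_def add_increasing)
  next
    case False
    then have "(?W e)\<^sup>2 \<le> t\<^sup>2" using assms(3) by (simp add: abs_le_square_iff[symmetric])
    moreover have "0 \<le> (1 / (12 * v)) * (?W e) ^ 4" using v by simp
    moreover have "0 \<le> (3 * v) * of_bool (\<exists>k\<in>K. \<bar>\<Sum>i<N. e i * k i\<bar> > t)" using v by simp
    ultimately show ?thesis by linarith
  qed
  have "v = rademacher_exp N (\<lambda>e. (?W e)\<^sup>2)" by (simp add: rademacher_square v_def)
  also have "\<dots> \<le> rademacher_exp N (\<lambda>e. t\<^sup>2 + ((1 / (12 * v)) * (?W e) ^ 4 +
      (3 * v) * of_bool (\<exists>k\<in>K. \<bar>\<Sum>i<N. e i * k i\<bar> > t)))"
    by (rule prod_exp_mono) (rule pw)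
  also have "\<dots> = t\<^sup>2 + ((1 / (12 * v)) * rademacher_exp N (\<lambda>e. (?W e) ^ 4) + (3 * v) * ?p)"
    unfolding prod_exp_add prod_exp_cmult prod_exp_const ..
  \<comment> \<open>With fourth moment at most 3 v^2 and tail probability below 1/12, each of the
    two error terms is at most v / 4. Half of the variance remains and is bounded by t^2.\<close>
  also have "\<dots> \<le> t\<^sup>2 + ((1 / (12 * v)) * (3 * v\<^sup>2) + (3 * v) * (1 / 12))"
    using v assms(1) rademacher_fourth[of N k] unfolding v_def[symmetric]
    by (intro add_mono mult_left_mono order_refl) auto
  also have "\<dots> = t\<^sup>2 + v / 2" using v by (simp add: power2_eq_square)
  finally show ?thesis by (simp add: v_def)
qed (use assms(3) in simp)

text \<open>Centred weights \<open>\<xi>\<^sub>i \<in> [-1, 1]\<close> are conditional expectations \<open>E[\<epsilon>\<^sub>i | s]\<close> of independent fair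
  signs: choose \<open>\<epsilon>\<^sub>i = \<plusminus>1\<close> with probability \<open>(1 \<plusminus> \<xi>\<^sub>i) / 2\<close>.  Chebyshev's inequality given \<open>s\<close>
  then compares the two tails; this does symmetrization and contraction in one step.\<close>

lemma tail_le_rademacher_tail:
  fixes K :: "(nat \<Rightarrow> real) set"
  assumes pw: "product_weights N B q"
    and centered: "\<And>i. i < N \<Longrightarrow> (\<Sum>b\<in>B. q i b * \<xi> i b) = 0"
    and bound: "\<And>i b. i < N \<Longrightarrow> b \<in> B \<Longrightarrow> \<bar>\<xi> i b\<bar> \<le> 1"
    and small: "rademacher_exp N (\<lambda>e. of_bool (\<exists>k\<in>K. \<bar>\<Sum>i<N. e i * k i\<bar> > t)) < 1 / 12"
    and t: "t > 0"
  shows "prod_exp N B q (\<lambda>s. of_bool (\<exists>k\<in>K. \<bar>\<Sum>i<N. \<xi> i (s i) * k i\<bar> > 4 * t))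
    \<le> 9 / 7 * rademacher_exp N (\<lambda>e. of_bool (\<exists>k\<in>K. \<bar>\<Sum>i<N. e i * k i\<bar> > t))"
proof -
  interpret product_weights N B q by fact
  let ?E = "\<lambda>e :: nat \<Rightarrow> real. of_bool (\<exists>k\<in>K. \<bar>\<Sum>i<N. e i * k i\<bar> > t) :: real"
  let ?r = "\<lambda>s i e. (1 + e * \<xi> i (s i)) / 2"
  \<comment> \<open>Given s, the sum of the signs has a mean exceeding 4t in absolute value and a
    variance of at most 2 t^2. It drops to t or below with probability at most 2 t^2 / (3t)^2 =
    2/9.\<close>
  have given_s: "7 / 9 * of_bool (\<exists>k\<in>K. \<bar>\<Sum>i<N. \<xi> i (s i) * k i\<bar> > 4 * t)
      \<le> prod_exp N {-1, 1} (?r s) ?E" if s: "s \<in> {..<N} \<rightarrow>\<^sub>E B" for s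
  proof -
    have r: "product_weights N {-1, 1} (?r s)"
    proof
      fix i e assume i: "i < N" and e: "e \<in> {-1, 1::real}"
      have "\<bar>\<xi> i (s i)\<bar> \<le> 1" using bound i s by auto
      then show "0 \<le> ?r s i e" using e by (auto simp: abs_le_iff)
    qed (auto simp: field_simps)
    interpret R: product_weights N "{-1, 1}" "?r s" by (rule r)
    show ?thesis
    proof (cases "\<exists>k\<in>K. \<bar>\<Sum>i<N. \<xi> i (s i) * k i\<bar> > 4 * t")
      case True
      then obtain k where k: "k \<in> K" "\<bar>\<Sum>i<N. \<xi> i (s i) * k i\<bar> > 4 * t" by blast
      let ?D = "\<lambda>e. (\<Sum>i<N. (e i - \<xi> i (s i)) * k i)\<^sup>2"
      have "prod_exp N {-1, 1} (?r s) ?D =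
          (\<Sum>i<N. \<Sum>e\<in>{-1, 1}. ?r s i e * ((e - \<xi> i (s i)) * k i)\<^sup>2)"
        by (rule prod_exp_square_centered[OF r, of "\<lambda>i e. (e - \<xi> i (s i)) * k i"])
          (simp add: field_simps)
      also have "\<dots> = (\<Sum>i<N. (1 - (\<xi> i (s i))\<^sup>2) * (k i)\<^sup>2)"
        by (intro sum.cong refl) (simp add: power2_eq_square field_simps)
      also have "\<dots> \<le> (\<Sum>i<N. 1 * (k i)\<^sup>2)"
        by (intro sum_mono mult_right_mono) auto
      also have "\<dots> \<le> 2 * t\<^sup>2"
        using rademacher_variance_bound[OF small k(1)] t by simp
      finally have var: "prod_exp N {-1, 1} (?r s) ?D \<le> 2 * t\<^sup>2" .
      have "1 - (1 / (9 * t\<^sup>2)) * ?D e \<le> ?E e" for e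
      proof (cases "\<bar>\<Sum>i<N. e i * k i\<bar> > t")
        case True
        then have "?E e = 1" using k(1) by auto
        then show ?thesis by simp
      next
        case False
        have "(\<Sum>i<N. (e i - \<xi> i (s i)) * k i) = (\<Sum>i<N. e i * k i) - (\<Sum>i<N. \<xi> i (s i) * k i)"
          by (simp add: left_diff_distrib sum_subtractf)
        then have "3 * t \<le> \<bar>\<Sum>i<N. (e i - \<xi> i (s i)) * k i\<bar>" using False k(2) by linarith
        then have "(3 * t)\<^sup>2 \<le> ?D e" using t power_mono[of "3 * t" _ 2] by fastforce
        then have "1 \<le> (1 / (9 * t\<^sup>2)) * ?D e" using t by (simp add: power_mult_distrib)
        moreover have "0 \<le> ?E e" by simp
        ultimately show ?thesis by linarith
      qed
      then have "prod_exp N {-1, 1} (?r s) (\<lambda>e. 1 - (1 / (9 * t\<^sup>2)) * ?D e) \<le> prod_exp N {-1, 1} (?r s) ?E"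
        by (rule R.prod_exp_mono)
      then have "1 - (1 / (9 * t\<^sup>2)) * prod_exp N {-1, 1} (?r s) ?D \<le> prod_exp N {-1, 1} (?r s) ?E"
        unfolding prod_exp_diff prod_exp_cmult R.prod_exp_const .
      moreover have "(1 / (9 * t\<^sup>2)) * prod_exp N {-1, 1} (?r s) ?D \<le> (1 / (9 * t\<^sup>2)) * (2 * t\<^sup>2)"
        using var by (intro mult_left_mono) auto
      ultimately show ?thesis using True t by simp
    next
      case False
      have "0 \<le> prod_exp N {-1, 1} (?r s) ?E"
        using R.prod_exp_mono[of "\<lambda>_. 0" ?E] R.prod_exp_const by simp
      then show ?thesis using False by simp
    qed
  qed
  have "7 / 9 * prod_exp N B q (\<lambda>s. of_bool (\<exists>k\<in>K. \<bar>\<Sum>i<N. \<xi> i (s i) * k i\<bar> > 4 * t))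
      \<le> prod_exp N B q (\<lambda>s. prod_exp N {-1, 1} (?r s) ?E)"
    unfolding prod_exp_cmult[symmetric] by (rule prod_exp_mono) (rule given_s)
  \<comment> \<open>Now the average over s is taken first. Because \<xi> is centred, each sign gets
    weight 1/2, so without conditioning the signs are independent and fair.\<close>
  also have "\<dots> = (\<Sum>e\<in>{..<N} \<rightarrow>\<^sub>E {-1, 1}.
      (\<Sum>s\<in>{..<N} \<rightarrow>\<^sub>E B. \<Prod>i<N. q i (s i) * ((1 + e i * \<xi> i (s i)) / 2)) * ?E e)"
    unfolding prod_exp_def sum_distrib_left sum_distrib_right
    by (subst sum.swap) (simp only: prod.distrib mult.assoc)
  also have "\<dots> = rademacher_exp N ?E"
    unfolding prod_exp_def
  proof (intro sum.cong refl arg_cong2[of _ _ _ _ "(*)"])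
    fix e :: "nat \<Rightarrow> real"
    have "(\<Sum>s\<in>{..<N} \<rightarrow>\<^sub>E B. \<Prod>i<N. q i (s i) * ((1 + e i * \<xi> i (s i)) / 2)) =
        (\<Prod>i<N. \<Sum>b\<in>B. q i b * ((1 + e i * \<xi> i b) / 2))"
      using prod_sum_PiE[of "{..<N}" "\<lambda>_. B" "\<lambda>i b. q i b * ((1 + e i * \<xi> i b) / 2)"] fin by simp
    also have "\<dots> = (\<Prod>i<N. 1 / 2)"
    proof (intro prod.cong refl)
      fix i assume "i \<in> {..<N}"
      then have "(\<Sum>b\<in>B. q i b) = 1" "(\<Sum>b\<in>B. q i b * \<xi> i b) = 0" using total centered by auto
      moreover have "(\<Sum>b\<in>B. q i b * ((1 + e i * \<xi> i b) / 2)) =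
          (\<Sum>b\<in>B. q i b) / 2 + e i * (\<Sum>b\<in>B. q i b * \<xi> i b) / 2"
        by (simp add: sum_divide_distrib sum_distrib_left sum.distrib[symmetric] field_simps)
      ultimately show "(\<Sum>b\<in>B. q i b * ((1 + e i * \<xi> i b) / 2)) = 1 / 2" by simp
    qed
    finally show "(\<Sum>s\<in>{..<N} \<rightarrow>\<^sub>E B. \<Prod>i<N. q i (s i) * ((1 + e i * \<xi> i (s i)) / 2)) = (\<Prod>i<N. 1 / 2)" .
  qed
  finally show ?thesis by simp
qed

section \<open>Outer probabilities and symmetrization\<close>

lemma outer_prob_le:
  assumes "B \<in> sets M" "A \<subseteq> B"
  shows "outer_prob M A \<le> measure M B"
  unfolding outer_prob_def using assms by (intro cInf_lower bdd_belowI[of _ 0]) auto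

lemma outer_prob_lessE:
  assumes "outer_prob M A < e" "A \<subseteq> space M"
  obtains B where "B \<in> sets M" "A \<subseteq> B" "measure M B < e"
proof -
  have "{measure M B |B. B \<in> sets M \<and> A \<subseteq> B} \<noteq> {}" using assms(2) sets.top[of M] by blast
  then obtain v where "v \<in> {measure M B |B. B \<in> sets M \<and> A \<subseteq> B}" "v < e"
    using cInf_lessD[of "{measure M B |B. B \<in> sets M \<and> A \<subseteq> B}" e] assms(1) unfolding outer_prob_def by blast
  then show ?thesis using that by blast
qed

lemma outer_prob_nonneg:
  assumes "A \<subseteq> space M"
  shows "0 \<le> outer_prob M A"
  unfolding outer_prob_def using assms sets.top[of M] by (intro cInf_greatest) auto

lemma outer_prob_mono:
  assumes "A \<subseteq> A'" "A' \<subseteq> space M"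
  shows "outer_prob M A \<le> outer_prob M A'"
  unfolding outer_prob_def
proof (rule cInf_superset_mono)
  show "{measure M B |B. B \<in> sets M \<and> A' \<subseteq> B} \<noteq> {}" using assms(2) sets.top[of M] by blast
  show "bdd_below {measure M B |B. B \<in> sets M \<and> A \<subseteq> B}" by (intro bdd_belowI[of _ 0]) auto
qed (use assms(1) in blast)

lemma outer_prob_Un:
  assumes "finite_measure M" "A \<subseteq> space M" "A' \<subseteq> space M"
  shows "outer_prob M (A \<union> A') \<le> outer_prob M A + outer_prob M A'"
proof (rule field_le_epsilon)
  fix e :: real assume e: "e > 0"
  obtain B where B: "B \<in> sets M" "A \<subseteq> B" "measure M B < outer_prob M A + e / 2"
    using outer_prob_lessE[of M A "outer_prob M A + e / 2"] assms(2) e by auto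
  obtain B' where B': "B' \<in> sets M" "A' \<subseteq> B'" "measure M B' < outer_prob M A' + e / 2"
    using outer_prob_lessE[of M A' "outer_prob M A' + e / 2"] assms(3) e by auto
  have "outer_prob M (A \<union> A') \<le> measure M (B \<union> B')"
    using B B' by (intro outer_prob_le) auto
  also have "\<dots> \<le> measure M B + measure M B'"
    using B(1) B'(1) by (rule measure_Un_le)
  finally show "outer_prob M (A \<union> A') \<le> outer_prob M A + outer_prob M A' + e" using B(3) B'(3) by linarith
qed

text \<open>A measurable cover pulls back to a cover of the same measure. This serves for
  permutations of i.i.d. coordinates and for the projection of the full space to the
  population.\<close>

lemma outer_prob_preimage_le:
  assumes T: "T \<in> measurable M N" "distr M N T = N" and A: "A \<subseteq> space N"
  shows "outer_prob M {\<omega> \<in> space M. T \<omega> \<in> A} \<le> outer_prob N A"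
proof (rule field_le_epsilon)
  fix e :: real assume "e > 0"
  then obtain B where B: "B \<in> sets N" "A \<subseteq> B" "measure N B < outer_prob N A + e"
    using outer_prob_lessE[of N A "outer_prob N A + e"] A by auto
  have "outer_prob M {\<omega> \<in> space M. T \<omega> \<in> A} \<le> measure M (T -` B \<inter> space M)"
    using B T by (intro outer_prob_le) (auto intro: measurable_sets)
  also have "\<dots> = measure (distr M N T) B" using B T by (subst measure_distr) auto
  finally show "outer_prob M {\<omega> \<in> space M. T \<omega> \<in> A} \<le> outer_prob N A + e"
    using T(2) B(3) by simp
qed

text \<open>Markov's inequality for each integrable majorant of \<open>T\<close>. It turns weak
  convergence, which speaks of outer expectations, into tail bounds.\<close>

lemma outer_prob_le_outer_expectation:
  assumes "prob_space M" and T: "\<And>\<omega>. \<omega> \<in> space M \<Longrightarrow> 0 \<le> T \<omega> \<and> T \<omega> \<le> 1"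
    and A: "A \<subseteq> {\<omega> \<in> space M. T \<omega> = 1}"
  shows "outer_prob M A \<le> outer_expectation M T"
  unfolding outer_expectation_def
proof (rule cInf_greatest)
  interpret prob_space M by fact
  have "integrable M (\<lambda>_. 1 :: real) \<and> (\<forall>\<omega>\<in>space M. T \<omega> \<le> (1 :: real))" using T by auto
  then show "{integral\<^sup>L M U |U. integrable M U \<and> (\<forall>\<omega>\<in>space M. T \<omega> \<le> U \<omega>)} \<noteq> {}" by blast
  fix v assume "v \<in> {integral\<^sup>L M U |U. integrable M U \<and> (\<forall>\<omega>\<in>space M. T \<omega> \<le> U \<omega>)}"
  then obtain U where v: "v = integral\<^sup>L M U" and U: "integrable M U" "\<And>\<omega>. \<omega> \<in> space M \<Longrightarrow> T \<omega> \<le> U \<omega>"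
    by blast
  have U0: "\<And>\<omega>. \<omega> \<in> space M \<Longrightarrow> 0 \<le> U \<omega>" using U(2) T by (meson order_trans)
  have [measurable]: "U \<in> borel_measurable M" using U(1) by simp
  have "outer_prob M A \<le> measure M {\<omega> \<in> space M. 1 \<le> U \<omega>}"
    using A U(2) by (intro outer_prob_le) (measurable, fastforce)
  also have "\<dots> \<le> integral\<^sup>L M U / 1"
    using U U0 by (intro integral_Markov_inequality_measure[where A = "{}"]) (auto intro!: AE_I2)
  finally show "outer_prob M A \<le> v" by (simp add: v)
qed

section \<open>Symmetrization of tail probabilities\<close>

context
  fixes Q :: "'z measure" and K :: "('z \<Rightarrow> real) set" and N :: nat and u \<eta> :: real
  assumes Q: "prob_space Q" and u: "u \<ge> 0"
    and tail: "\<And>m. m \<ge> N \<Longrightarrow> outer_prob (\<Pi>\<^sub>M i\<in>UNIV. Q)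
        {z \<in> space (\<Pi>\<^sub>M i\<in>(UNIV :: nat set). Q). \<exists>k\<in>K. \<bar>\<Sum>i<m. k (z i)\<bar> > u * sqrt (real m)} < \<eta>"
begin

interpretation Q: prob_space Q by (rule Q)
interpretation QS: product_prob_space "\<lambda>_. Q" "UNIV :: nat set" by unfold_locales

text \<open>An injection of the indices that sends an initial segment onto \<open>C\<close>
  preserves the i.i.d. law, so \<open>tail\<close> applies with m = card C. The level (3/2) u sqrt N
  absorbs sqrt (card C), since 2 \<le> (3/2)^2, and is half of the level 3 u sqrt N used for signed
  sums.\<close>

lemma subset_sum_tail:
  assumes C: "finite C" "N \<le> card C" "card C \<le> 2 * N"
  shows "outer_prob (\<Pi>\<^sub>M i\<in>UNIV. Q)
    {z \<in> space (\<Pi>\<^sub>M i\<in>(UNIV :: nat set). Q). \<exists>k\<in>K. 2 * \<bar>\<Sum>i\<in>C. k (z i)\<bar> > 3 * u * sqrt (real N)} < \<eta>"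
proof -
  let ?P = "\<Pi>\<^sub>M i\<in>(UNIV :: nat set). Q"
  let ?m = "card C"
  obtain f0 where f0: "bij_betw f0 {..<?m} C"
    using ex_bij_betw_nat_finite[OF C(1)] atLeast0LessThan by metis
  define D where "D = Max (insert 0 C) + 1"
  have D: "\<And>i. i \<in> C \<Longrightarrow> i < D" unfolding D_def using C(1) by (auto simp: less_Suc_eq_le)
  \<comment> \<open>The reindexing must be injective on all of the naturals. Beyond
    \<open>?m\<close> the values start at \<open>D\<close>, above every element of
    \<open>C\<close>.\<close>
  define f where "f i = (if i < ?m then f0 i else D + i)" for i
  have inj: "inj f"
    using f0 D unfolding f_def inj_on_def bij_betw_def
    by (auto simp: inj_on_def) (metis imageI lessThan_iff not_add_less1)+
  let ?T = "\<lambda>z :: nat \<Rightarrow> 'z. \<lambda>i\<in>UNIV. z (f i)"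
  have T: "?T \<in> measurable ?P ?P"
    by (intro measurable_restrict measurable_component_singleton) auto
  have dT: "distr ?P ?P ?T = ?P"
    using distr_PiM_reindex[of UNIV "\<lambda>_. Q" f UNIV] Q inj by simp
  have "sqrt (real ?m) \<le> sqrt (9 / 4 * real N)"
    using C(3) by (intro real_sqrt_le_mono) linarith
  also have "sqrt (9 / 4 * real N) = 3 / 2 * sqrt (real N)"
    by (simp add: real_sqrt_mult real_sqrt_divide)
  finally have sq: "u * sqrt (real ?m) \<le> u * (3 / 2 * sqrt (real N))" using u by (rule mult_left_mono)
  let ?A = "{z \<in> space ?P. \<exists>k\<in>K. \<bar>\<Sum>i<?m. k (z i)\<bar> > u * sqrt (real ?m)}"
  have sumT: "(\<Sum>i<?m. k (z (f i))) = (\<Sum>i\<in>C. k (z i))" for k :: "'z \<Rightarrow> real" and z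
    using sum.reindex_bij_betw[OF f0, of "\<lambda>i. k (z i)"] by (simp add: f_def)
  have "outer_prob ?P {z \<in> space ?P. \<exists>k\<in>K. 2 * \<bar>\<Sum>i\<in>C. k (z i)\<bar> > 3 * u * sqrt (real N)} \<le>
      outer_prob ?P {z \<in> space ?P. ?T z \<in> ?A}"
  proof (rule outer_prob_mono)
    show "{z \<in> space ?P. \<exists>k\<in>K. 2 * \<bar>\<Sum>i\<in>C. k (z i)\<bar> > 3 * u * sqrt (real N)} \<subseteq> {z \<in> space ?P. ?T z \<in> ?A}"
    proof
      fix z assume "z \<in> {z \<in> space ?P. \<exists>k\<in>K. 2 * \<bar>\<Sum>i\<in>C. k (z i)\<bar> > 3 * u * sqrt (real N)}"
      then obtain k where k: "k \<in> K" "z \<in> space ?P" "2 * \<bar>\<Sum>i\<in>C. k (z i)\<bar> > 3 * u * sqrt (real N)"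
        by blast
      have "\<bar>\<Sum>i<?m. k (?T z i)\<bar> > u * sqrt (real ?m)" using k(3) sq by (simp add: sumT)
      then show "z \<in> {z \<in> space ?P. ?T z \<in> ?A}" using measurable_space[OF T k(2)] k(1,2) by blast
    qed
  qed blast
  also have "\<dots> \<le> outer_prob ?P ?A" by (rule outer_prob_preimage_le[OF T dT]) auto
  also have "\<dots> < \<eta>" using tail C(2) by blast
  finally show ?thesis .
qed

text \<open>With \<open>A = {i. \<epsilon>\<^sub>i = 1}\<close> and \<open>T = {N..<2N}\<close>, a signed sum is the difference of the unsigned sums
  over \<open>A \<union> T\<close> and \<open>({..<N} - A) \<union> T\<close>, both of which have at least \<open>N\<close> terms.  No moment of the
  supremum is needed this way.\<close>

lemma signed_sum_tail:
  assumes e: "e \<in> {..<N} \<rightarrow>\<^sub>E {-1, 1}"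
  shows "\<exists>B\<in>sets (\<Pi>\<^sub>M i\<in>(UNIV :: nat set). Q). measure (\<Pi>\<^sub>M i\<in>(UNIV :: nat set). Q) B < 2 * \<eta> \<and>
    {z \<in> space (\<Pi>\<^sub>M i\<in>UNIV. Q). \<exists>k\<in>K. \<bar>\<Sum>i<N. e i * k (z i)\<bar> > 3 * u * sqrt (real N)} \<subseteq> B"
proof -
  let ?P = "\<Pi>\<^sub>M i\<in>(UNIV :: nat set). Q"
  define A A' T where "A = {i. i < N \<and> e i = 1}" and "A' = {i. i < N \<and> e i \<noteq> 1}" and "T = {N..<2 * N}"
  have fin: "finite A" "finite A'" "finite T" by (auto simp: A_def A'_def T_def)
  have dis: "A \<inter> T = {}" "A' \<inter> T = {}" "A \<inter> A' = {}" "A \<union> A' = {..<N}"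
    by (auto simp: A_def A'_def T_def)
  have "card A \<le> card {..<N}" "card A' \<le> card {..<N}" by (intro card_mono; auto simp: A_def A'_def)+
  then have cards: "N \<le> card (A \<union> T)" "card (A \<union> T) \<le> 2 * N" "N \<le> card (A' \<union> T)" "card (A' \<union> T) \<le> 2 * N"
    using dis fin by (simp_all add: card_Un_disjoint) (simp_all add: T_def)
  let ?E = "\<lambda>C. {z \<in> space ?P. \<exists>k\<in>K. 2 * \<bar>\<Sum>i\<in>C. k (z i)\<bar> > 3 * u * sqrt (real N)}"
  obtain B1 where B1: "B1 \<in> sets ?P" "?E (A \<union> T) \<subseteq> B1" "measure ?P B1 < \<eta>"
    by (rule outer_prob_lessE[OF subset_sum_tail[of "A \<union> T"]]) (use cards fin in auto)
  obtain B2 where B2: "B2 \<in> sets ?P" "?E (A' \<union> T) \<subseteq> B2" "measure ?P B2 < \<eta>"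
    by (rule outer_prob_lessE[OF subset_sum_tail[of "A' \<union> T"]]) (use cards fin in auto)
  have signed: "(\<Sum>i<N. e i * k (z i)) = (\<Sum>i\<in>A \<union> T. k (z i)) - (\<Sum>i\<in>A' \<union> T. k (z i))" for k z
  proof -
    have "(\<Sum>i<N. e i * k (z i)) = (\<Sum>i\<in>A. e i * k (z i)) + (\<Sum>i\<in>A'. e i * k (z i))"
      using dis fin by (metis sum.union_disjoint)
    also have "(\<Sum>i\<in>A. e i * k (z i)) = (\<Sum>i\<in>A. k (z i))" by (auto simp: A_def intro!: sum.cong)
    also have "(\<Sum>i\<in>A'. e i * k (z i)) = (\<Sum>i\<in>A'. - k (z i))"
    proof (intro sum.cong refl)
      fix i assume i: "i \<in> A'"
      then have "e i \<in> {-1, 1}" using e by (intro PiE_mem[of e]) (auto simp: A'_def)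
      then show "e i * k (z i) = - k (z i)" using i by (auto simp: A'_def)
    qed
    finally show ?thesis using dis fin by (simp add: sum.union_disjoint sum_negf)
  qed
  have "{z \<in> space ?P. \<exists>k\<in>K. \<bar>\<Sum>i<N. e i * k (z i)\<bar> > 3 * u * sqrt (real N)} \<subseteq> B1 \<union> B2"
  proof (rule subset_trans)
    show "{z \<in> space ?P. \<exists>k\<in>K. \<bar>\<Sum>i<N. e i * k (z i)\<bar> > 3 * u * sqrt (real N)} \<subseteq> ?E (A \<union> T) \<union> ?E (A' \<union> T)"
    proof
      fix z assume "z \<in> {z \<in> space ?P. \<exists>k\<in>K. \<bar>\<Sum>i<N. e i * k (z i)\<bar> > 3 * u * sqrt (real N)}"
      then obtain k where k: "k \<in> K" "z \<in> space ?P" "\<bar>\<Sum>i<N. e i * k (z i)\<bar> > 3 * u * sqrt (real N)" by blast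
      have "2 * \<bar>\<Sum>i\<in>A \<union> T. k (z i)\<bar> > 3 * u * sqrt (real N) \<or> 2 * \<bar>\<Sum>i\<in>A' \<union> T. k (z i)\<bar> > 3 * u * sqrt (real N)"
        using k(3) unfolding signed by linarith
      then show "z \<in> ?E (A \<union> T) \<union> ?E (A' \<union> T)" using k by blast
    qed
  qed (use B1 B2 in blast)
  moreover have "measure ?P (B1 \<union> B2) < 2 * \<eta>"
    using measure_Un_le[OF B1(1) B2(1)] B1(3) B2(3) by simp
  ultimately show ?thesis using B1 B2 by blast
qed

text \<open>Each of the finitely many sign vectors e has a measurable cover \<open>B e\<close> of
  measure below 2\<eta>. The average of their indicators is a measurable majorant of the conditional
  tail with integral at most 2\<eta>, to which Markov's inequality applies.\<close>

lemma rademacher_tail_outer: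
  assumes \<delta>: "\<delta> > 0"
  shows "outer_prob (\<Pi>\<^sub>M i\<in>(UNIV :: nat set). Q) {z \<in> space (\<Pi>\<^sub>M i\<in>UNIV. Q).
      rademacher_exp N (\<lambda>e. of_bool (\<exists>k\<in>K. \<bar>\<Sum>i<N. e i * k (z i)\<bar> > 3 * u * sqrt (real N))) \<ge> \<delta>}
    \<le> 2 * \<eta> / \<delta>"
proof -
  let ?P = "\<Pi>\<^sub>M i\<in>(UNIV :: nat set). Q"
  let ?S = "{..<N} \<rightarrow>\<^sub>E {-1, 1 :: real}"
  let ?E = "\<lambda>e. {z \<in> space ?P. \<exists>k\<in>K. \<bar>\<Sum>i<N. e i * k (z i)\<bar> > 3 * u * sqrt (real N)}"
  interpret R: product_weights N "{-1, 1 :: real}" "\<lambda>_ _. 1 / 2" by (rule rademacher_weights)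
  have "\<forall>e\<in>?S. \<exists>B. B \<in> sets ?P \<and> measure ?P B < 2 * \<eta> \<and> ?E e \<subseteq> B"
    using signed_sum_tail by (simp add: Bex_def)
  from bchoice[OF this] obtain B where "\<forall>e\<in>?S. B e \<in> sets ?P \<and> measure ?P (B e) < 2 * \<eta> \<and> ?E e \<subseteq> B e" ..
  then have B: "\<And>e. e \<in> ?S \<Longrightarrow> B e \<in> sets ?P" "\<And>e. e \<in> ?S \<Longrightarrow> measure ?P (B e) < 2 * \<eta>"
      "\<And>e. e \<in> ?S \<Longrightarrow> ?E e \<subseteq> B e"
    by blast+
  define V where "V z = rademacher_exp N (\<lambda>e. indicator (B e) z)" for z
  have int: "integrable ?P (\<lambda>z. (\<Prod>i<N. 1 / 2 :: real) * indicator (B e) z)" if "e \<in> ?S" for e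
    using B(1)[OF that] by (intro integrable_mult_right) (simp add: QS.emeasure_eq_measure)
  have Vint: "integrable ?P V" unfolding V_def prod_exp_def using int by (rule Bochner_Integration.integrable_sum)
  have V0: "0 \<le> V z" for z
    unfolding V_def using R.prod_exp_mono[of "\<lambda>_. 0" "\<lambda>e. indicator (B e) z"] R.prod_exp_const[of 0] by simp
  have "integral\<^sup>L ?P V = rademacher_exp N (\<lambda>e. measure ?P (B e))"
    unfolding V_def prod_exp_def using int B(1)
    by (subst Bochner_Integration.integral_sum) (auto intro!: sum.cong)
  also have "\<dots> \<le> rademacher_exp N (\<lambda>e. 2 * \<eta>)"
    using B(2) by (intro R.prod_exp_mono) (simp add: less_imp_le)
  finally have EV: "integral\<^sup>L ?P V \<le> 2 * \<eta>" by (simp add: R.prod_exp_const)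
  have [measurable]: "V \<in> borel_measurable ?P" using Vint by simp
  have "outer_prob ?P {z \<in> space ?P.
      rademacher_exp N (\<lambda>e. of_bool (\<exists>k\<in>K. \<bar>\<Sum>i<N. e i * k (z i)\<bar> > 3 * u * sqrt (real N))) \<ge> \<delta>}
    \<le> measure ?P {z \<in> space ?P. \<delta> \<le> V z}"
  proof (rule outer_prob_le)
    show "{z \<in> space ?P. rademacher_exp N (\<lambda>e. of_bool (\<exists>k\<in>K. \<bar>\<Sum>i<N. e i * k (z i)\<bar> > 3 * u * sqrt (real N))) \<ge> \<delta>}
        \<subseteq> {z \<in> space ?P. \<delta> \<le> V z}"
    proof safe
      fix z assume z: "z \<in> space ?P"
        and le: "\<delta> \<le> rademacher_exp N (\<lambda>e. of_bool (\<exists>k\<in>K. \<bar>\<Sum>i<N. e i * k (z i)\<bar> > 3 * u * sqrt (real N)))"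
      have "rademacher_exp N (\<lambda>e. of_bool (\<exists>k\<in>K. \<bar>\<Sum>i<N. e i * k (z i)\<bar> > 3 * u * sqrt (real N))) \<le> V z"
        unfolding V_def
      proof (rule R.prod_exp_mono)
        fix e :: "nat \<Rightarrow> real" assume "e \<in> ?S"
        then show "of_bool (\<exists>k\<in>K. \<bar>\<Sum>i<N. e i * k (z i)\<bar> > 3 * u * sqrt (real N)) \<le> (indicator (B e) z :: real)"
          using B(3)[of e] z by (auto simp: indicator_def)
      qed
      then show "\<delta> \<le> V z" using le by linarith
    qed
  qed simp
  also have "\<dots> \<le> integral\<^sup>L ?P V / \<delta>"
    using Vint V0 \<delta> by (intro integral_Markov_inequality_measure[where A = "{}"]) auto
  also have "\<dots> \<le> 2 * \<eta> / \<delta>" using EV \<delta> by (simp add: divide_right_mono)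
  finally show ?thesis .
qed

end

section \<open>Uniform convergence from characteristic functions\<close>

definition tent :: "real \<Rightarrow> real" where "tent x = max 0 (1 - \<bar>x\<bar>)"

lemma tent_bounds: "0 \<le> tent x" "tent x \<le> 1"
  by (auto simp: tent_def)

lemma tent_measurable [measurable]: "tent \<in> borel_measurable borel"
  unfolding tent_def[abs_def] by measurable

text \<open>Since 1 - cos t = 2 sin^2 (t/2), this is half the square of sin (t/2) / (t/2): up to a
  constant the Fourier transform of \<open>tent\<close>. At t = 0 the convention x / 0 = 0 replaces
  the limit 1/2, on a null set.\<close>

definition fejer :: "real \<Rightarrow> real" where "fejer t = (1 - cos t) / t\<^sup>2"

lemma fejer_nonneg: "0 \<le> fejer t"
  by (simp add: fejer_def)

lemma fejer_measurable [measurable]: "fejer \<in> borel_measurable borel"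
  unfolding fejer_def[abs_def] by measurable

text \<open>Comparison with the Cauchy density. The constant is 5/2 = 1/2 + 2, from 1 - cos t \<le>
  t^2 / 2 and from (1 - cos t) t^2 \<le> 2 t^2.\<close>

lemma integrable_fejer: "integrable lborel fejer"
proof (rule Bochner_Integration.integrable_bound)
  show "integrable lborel (\<lambda>t :: real. 5 / 2 * inverse (1 + t\<^sup>2))"
    using integrable_inverse_1_plus_square by (simp add: set_integrable_def)
  show "AE t in lborel. norm (fejer t) \<le> norm (5 / 2 * inverse (1 + t\<^sup>2))"
  proof (rule AE_I2)
    fix t :: real
    have "1 - cos t \<le> t\<^sup>2 / 2"
    proof -
      have "1 - cos t = 2 * (sin (t / 2))\<^sup>2" using cos_double_sin[of "t / 2"] by simp
      also have "\<dots> \<le> 2 * (t / 2)\<^sup>2"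
        using abs_sin_x_le_abs_x[of "t / 2"] by (simp add: abs_le_square_iff del: abs_divide)
      finally show ?thesis by (simp add: power2_eq_square)
    qed
    moreover have "1 - cos t \<le> 2" using cos_ge_minus_one[of t] by linarith
    moreover have "(1 - cos t) * (1 + t\<^sup>2) = (1 - cos t) + (1 - cos t) * t\<^sup>2" by algebra
    moreover have "(1 - cos t) * t\<^sup>2 \<le> 2 * t\<^sup>2" using calculation(2) by (intro mult_right_mono) auto
    ultimately have "(1 - cos t) * (1 + t\<^sup>2) \<le> 5 / 2 * t\<^sup>2" by linarith
    moreover have "0 < 1 + t\<^sup>2" using zero_le_power2[of t] by linarith
    ultimately have "fejer t \<le> 5 / 2 * inverse (1 + t\<^sup>2)"
      by (cases "t = 0") (simp_all add: fejer_def field_simps)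
    then show "norm (fejer t) \<le> norm (5 / 2 * inverse (1 + t\<^sup>2))"
      using fejer_nonneg[of t] by simp
  qed
qed simp

definition fejer_mass :: real where "fejer_mass = integral\<^sup>L lborel fejer"

lemma fejer_mass_pos: "0 < fejer_mass"
proof -
  have "integral\<^sup>L lborel (\<lambda>t. (1 - cos 1) / 4 * indicator {1..2::real} t) \<le> fejer_mass"
    unfolding fejer_mass_def
  proof (rule integral_mono)
    fix t :: real
    show "(1 - cos 1) / 4 * indicator {1..2} t \<le> fejer t"
    proof (cases "t \<in> {1..2}")
      case True
      then have "cos t \<le> cos 1" using pi_gt3 by (intro cos_monotone_0_pi_le) auto
      moreover have "t\<^sup>2 \<le> 4" using True power_mono[of t 2 2] by simp
      ultimately have "(1 - cos 1) / 4 \<le> (1 - cos t) / t\<^sup>2"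
        using True by (intro frac_le) auto
      then show ?thesis using True by (simp add: fejer_def)
    qed (simp add: fejer_nonneg)
  qed (auto simp: integrable_fejer)
  moreover have "cos 1 < (1 :: real)" using cos_monotone_0_pi[of 0 1] pi_gt3 by simp
  ultimately show ?thesis by simp
qed

text \<open>Replacing t by a t yields a^2 from the denominator and 1 / \<bar>a\<bar> from the
  substitution. The result is linear in \<bar>a\<bar>, and a second difference of the absolute value
  is a tent.\<close>

lemma integral_one_minus_cos:
  "integrable lborel (\<lambda>t. (1 - cos (a * t)) / t\<^sup>2)"
  "(\<integral>t. (1 - cos (a * t)) / t\<^sup>2 \<partial>lborel) = \<bar>a\<bar> * fejer_mass"
proof -
  have "integrable lborel (\<lambda>t. (1 - cos (a * t)) / t\<^sup>2) \<and>
      (\<integral>t. (1 - cos (a * t)) / t\<^sup>2 \<partial>lborel) = \<bar>a\<bar> * fejer_mass"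
  proof (cases "a = 0")
    case False
    have eq: "(\<lambda>t. (1 - cos (a * t)) / t\<^sup>2) = (\<lambda>t. a\<^sup>2 * fejer (0 + a * t))"
      using False by (auto simp: fejer_def power_mult_distrib fun_eq_iff)
    have "fejer_mass = \<bar>a\<bar> * (\<integral>t. fejer (0 + a * t) \<partial>lborel)"
      unfolding fejer_mass_def using lborel_integral_real_affine[OF False, of fejer 0] by simp
    moreover have "(\<integral>t. a\<^sup>2 * fejer (0 + a * t) \<partial>lborel) = a\<^sup>2 * (\<integral>t. fejer (0 + a * t) \<partial>lborel)"
      by (rule integral_mult_right_zero)
    moreover have "a\<^sup>2 = \<bar>a\<bar> * \<bar>a\<bar>" by (simp add: power2_eq_square)
    ultimately have "(\<integral>t. a\<^sup>2 * fejer (0 + a * t) \<partial>lborel) = \<bar>a\<bar> * fejer_mass"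
      by (simp only: mult.assoc)
    moreover have "integrable lborel (\<lambda>t. fejer (0 + a * t))"
      using lborel_integrable_real_affine[OF integrable_fejer False] .
    ultimately show ?thesis unfolding eq by simp
  qed simp
  then show "integrable lborel (\<lambda>t. (1 - cos (a * t)) / t\<^sup>2)"
    "(\<integral>t. (1 - cos (a * t)) / t\<^sup>2 \<partial>lborel) = \<bar>a\<bar> * fejer_mass" by auto
qed

text \<open>The identity \<open>tent x = (\<bar>x - 1\<bar> + \<bar>x + 1\<bar> - 2\<bar>x\<bar>) / 2\<close> reduces this to the scaling rule above,
  so that the value of \<^const>\<open>fejer_mass\<close> (which is \<open>\<pi>\<close>) is irrelevant.\<close>

lemma tent_fourier: "(\<integral>t. fejer t * cos (t * x) \<partial>lborel) = fejer_mass * tent x"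
proof -
  let ?c = "\<lambda>a t. (1 - cos (a * t)) / t\<^sup>2"
  have eq: "fejer t * cos (t * x) = (?c (x - 1) t + ?c (x + 1) t - 2 * ?c x t) / 2" for t
  proof -
    have "cos ((x - 1) * t) + cos ((x + 1) * t) = 2 * cos (x * t) * cos t"
      by (simp add: algebra_simps cos_add cos_diff)
    then have "2 * ((1 - cos t) * cos (t * x)) =
        (1 - cos ((x - 1) * t)) + (1 - cos ((x + 1) * t)) - 2 * (1 - cos (x * t))"
      by (simp add: algebra_simps)
    moreover have "fejer t * cos (t * x) = (2 * ((1 - cos t) * cos (t * x))) / (2 * t\<^sup>2)"
      by (simp add: fejer_def)
    ultimately show ?thesis by (simp add: add_divide_distrib diff_divide_distrib)
  qed
  have lin: "(\<integral>t. (A t + B t - 2 * C t) / 2 \<partial>lborel) = (integral\<^sup>L lborel A + integral\<^sup>L lborel B - 2 * integral\<^sup>L lborel C) / 2"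
    if "integrable lborel A" "integrable lborel B" "integrable lborel C" for A B C :: "real \<Rightarrow> real"
    using that by simp
  have "(\<integral>t. fejer t * cos (t * x) \<partial>lborel) =
      (\<bar>x - 1\<bar> * fejer_mass + \<bar>x + 1\<bar> * fejer_mass - 2 * (\<bar>x\<bar> * fejer_mass)) / 2"
    unfolding eq by (subst lin[OF integral_one_minus_cos(1) integral_one_minus_cos(1) integral_one_minus_cos(1)])
      (simp only: integral_one_minus_cos(2))
  also have "\<dots> = fejer_mass * ((\<bar>x - 1\<bar> + \<bar>x + 1\<bar> - 2 * \<bar>x\<bar>) / 2)" by (simp add: algebra_simps)
  also have "(\<bar>x - 1\<bar> + \<bar>x + 1\<bar> - 2 * \<bar>x\<bar>) / 2 = tent x" by (simp add: tent_def abs_if max_def)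
  finally show ?thesis .
qed

text \<open>Only the two integers next to x carry a nonzero tent, and their values add up to 1. The
  upper bound for arbitrary \<open>I\<close> allows the partition of unity to be cut down to a
  finite box.\<close>

lemma sum_tent:
  fixes I :: "int set"
  assumes "finite I"
  shows "(\<Sum>m\<in>I. tent (x - of_int m)) \<le> 1"
    and "{\<lfloor>x\<rfloor>, \<lfloor>x\<rfloor> + 1} \<subseteq> I \<Longrightarrow> (\<Sum>m\<in>I. tent (x - of_int m)) = 1"
proof -
  let ?A = "{\<lfloor>x\<rfloor>, \<lfloor>x\<rfloor> + 1}"
  have zero: "tent (x - of_int m) = 0" if "m \<notin> ?A" for m
  proof -
    have "m \<le> \<lfloor>x\<rfloor> - 1 \<or> \<lfloor>x\<rfloor> + 2 \<le> m" using that by auto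
    then have "of_int m \<le> (of_int \<lfloor>x\<rfloor> - 1 :: real) \<or> (of_int \<lfloor>x\<rfloor> + 2 :: real) \<le> of_int m" by linarith
    then show ?thesis unfolding tent_def using floor_correct[of x] by linarith
  qed
  have A: "(\<Sum>m\<in>?A. tent (x - of_int m)) = 1"
  proof -
    have "tent (x - of_int \<lfloor>x\<rfloor>) = 1 - (x - of_int \<lfloor>x\<rfloor>)" "tent (x - of_int (\<lfloor>x\<rfloor> + 1)) = x - of_int \<lfloor>x\<rfloor>"
      using floor_correct[of x] unfolding tent_def by (simp_all only: of_int_add of_int_1, linarith+)
    then show ?thesis by simp
  qed
  have "(\<Sum>m\<in>I. tent (x - of_int m)) = (\<Sum>m\<in>I \<inter> ?A. tent (x - of_int m))"
    using assms zero by (intro sum.mono_neutral_right) auto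
  also have "\<dots> \<le> (\<Sum>m\<in>?A. tent (x - of_int m))"
    by (intro sum_mono2) (auto simp: tent_bounds)
  finally show "(\<Sum>m\<in>I. tent (x - of_int m)) \<le> 1" using A by simp
  show "(\<Sum>m\<in>I. tent (x - of_int m)) = 1" if "?A \<subseteq> I"
    using A sum.mono_neutral_right[OF assms that, of "\<lambda>m. tent (x - of_int m)"] zero by auto
qed

section \<open>From exponentials to tent weights\<close>

lemma complex_cos_cis: "complex_of_real (cos x) = (cis x + cis (- x)) / 2"
  by (simp add: complex_eq_iff)

text \<open>A cosine factor moves the frequency of the exponential by plus and minus Y. The
  integrand of the Fourier representation of a tent is thereby again made of characteristic
  functions.\<close>

lemma cis_times_cos:
  "W * cis X * of_real (F * cos (Y - Z)) =
    of_real (F / 2) * (cis (- Z) * (W * cis (X + Y)) + cis Z * (W * cis (X - Y)))"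
proof -
  have *: "A * B * (F' * ((C * D' + D * C') / 2)) = F' / 2 * (D' * (A * (B * C)) + D * (A * (B * C')))"
    for A B C C' D D' F' :: complex
    by (simp add: algebra_simps)
  have eqs: "cis (X + Y) = cis X * cis Y" "cis (X - Y) = cis X * cis (- Y)"
    "cis (Y - Z) = cis Y * cis (- Z)" "cis (- (Y - Z)) = cis Z * cis (- Y)"
    by (simp_all add: cis_mult)
  show ?thesis
    unfolding of_real_mult of_real_divide of_real_numeral complex_cos_cis eqs by (rule *)
qed

lemma cis_sum: "cis (\<Sum>f\<in>A. g f) = (\<Prod>f\<in>A. cis (g f))"
  by (induction A rule: infinite_finite_induct) (auto simp: cis_mult[symmetric])

text \<open>The approximating laws have finite support, as a Poisson design given the population
  has. Their tightness is not assumed: it follows from the mass that the limit gives to a large box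
  of tents.\<close>

locale charfun_convergence = prob_space M
  for M :: "'g measure" and G :: "'g \<Rightarrow> 'i \<Rightarrow> real" and J :: "'i set"
    and S :: "nat \<Rightarrow> 's set" and p :: "nat \<Rightarrow> 's \<Rightarrow> real" and V :: "nat \<Rightarrow> 's \<Rightarrow> 'i \<Rightarrow> real" +
  assumes finJ: "finite J" and finS: "\<And>n. finite (S n)"
    and p_nonneg: "\<And>n s. s \<in> S n \<Longrightarrow> 0 \<le> p n s" and p_total: "\<And>n. (\<Sum>s\<in>S n. p n s) = 1"
    and G_meas: "\<And>f. f \<in> J \<Longrightarrow> (\<lambda>\<omega>. G \<omega> f) \<in> borel_measurable M"
    and charfun_lim: "\<And>a. (\<lambda>n. \<Sum>s\<in>S n. of_real (p n s) * cis (\<Sum>f\<in>J. a f * V n s f))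
        \<longlonglongrightarrow> (\<integral>\<omega>. cis (\<Sum>f\<in>J. a f * G \<omega> f) \<partial>M)"
begin

definition tent_weight :: "real \<Rightarrow> ('i \<Rightarrow> real) \<Rightarrow> 'i set \<Rightarrow> ('i \<Rightarrow> real) \<Rightarrow> real" where
  "tent_weight \<delta> m A v = (\<Prod>f\<in>A. tent (v f / \<delta> - m f))"

lemma tent_weight_bounds: "0 \<le> tent_weight \<delta> m A v" "tent_weight \<delta> m A v \<le> 1"
  unfolding tent_weight_def by (auto intro!: prod_nonneg prod_le_1 simp: tent_bounds)

lemma tent_weight_measurable [measurable]:
  assumes "A \<subseteq> J"
  shows "(\<lambda>\<omega>. tent_weight \<delta> m A (G \<omega>)) \<in> borel_measurable M"
  unfolding tent_weight_def using G_meas assms by (intro borel_measurable_prod) (measurable, auto)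

lemma cis_measurable [measurable]:
  "(\<lambda>\<omega>. cis (\<Sum>f\<in>J. a f * G \<omega> f)) \<in> borel_measurable M"
proof -
  have "(\<lambda>\<omega>. \<Sum>f\<in>J. a f * G \<omega> f) \<in> borel_measurable M"
    using G_meas by (intro borel_measurable_sum borel_measurable_times) auto
  moreover have "cis \<in> borel_measurable borel"
    by (intro borel_measurable_continuous_onI continuous_intros)
  ultimately show ?thesis by measurable
qed

text \<open>Turning one exponential factor after the other into a tent, by Fourier inversion in one variable.\<close>

lemma tent_cis_lim:
  assumes "finite A" "A \<subseteq> J"
  shows "(\<lambda>n. \<Sum>s\<in>S n. of_real (p n s) * (of_real (tent_weight \<delta> m A (V n s)) * cis (\<Sum>f\<in>J. a f * V n s f)))
    \<longlonglongrightarrow> (\<integral>\<omega>. of_real (tent_weight \<delta> m A (G \<omega>)) * cis (\<Sum>f\<in>J. a f * G \<omega> f) \<partial>M)"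
  using assms
proof (induction A arbitrary: a rule: finite_induct)
  case empty
  then show ?case using charfun_lim[of a] by (simp add: tent_weight_def)
next
  case (insert g A)
  have g: "g \<in> J" and A: "A \<subseteq> J" using insert.prems by auto
  let ?w = "\<lambda>v. of_real (tent_weight \<delta> m A v) * cis (\<Sum>f\<in>J. a f * v f) :: complex"
  let ?x = "\<lambda>v. v g / \<delta> - m g"
  have w_norm: "norm (?w v) \<le> 1" for v
    using tent_weight_bounds[of \<delta> m A v] by (simp add: norm_mult)
  have tw: "of_real (tent_weight \<delta> m (insert g A) v) * cis (\<Sum>f\<in>J. a f * v f) =
      (1 / of_real fejer_mass) * (\<integral>t. ?w v * of_real (fejer t * cos (t * ?x v)) \<partial>lborel)" for v
  proof -
    have "(\<integral>t. ?w v * of_real (fejer t * cos (t * ?x v)) \<partial>lborel) =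
        ?w v * of_real (fejer_mass * tent (?x v))"
      by (simp only: integral_mult_right_zero integral_complex_of_real tent_fourier)
    moreover have "tent_weight \<delta> m (insert g A) v = tent (?x v) * tent_weight \<delta> m A v"
      using insert.hyps by (simp add: tent_weight_def)
    moreover have "complex_of_real fejer_mass \<noteq> 0" using fejer_mass_pos by simp
    ultimately show ?thesis by (simp only:) simp
  qed
  define \<phi> where "\<phi> n t = (\<Sum>s\<in>S n. of_real (p n s) * (?w (V n s) * of_real (fejer t * cos (t * ?x (V n s)))))" for n t
  define \<psi> where "\<psi> t = (\<integral>\<omega>. ?w (G \<omega>) * of_real (fejer t * cos (t * ?x (G \<omega>))) \<partial>M)" for t
  have int1: "integrable lborel (\<lambda>t. ?w v * of_real (fejer t * cos (t * ?x v)))" for v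
  proof (rule Bochner_Integration.integrable_bound[OF integrable_fejer])
    show "AE t in lborel. norm (?w v * of_real (fejer t * cos (t * ?x v))) \<le> norm (fejer t)"
    proof (rule AE_I2)
      fix t
      have "norm (?w v * of_real (fejer t * cos (t * ?x v))) \<le> 1 * (\<bar>fejer t\<bar> * 1)"
        unfolding norm_mult[of "?w v"] using w_norm[of v] fejer_nonneg[of t]
        by (intro mult_mono) (auto simp: norm_mult abs_mult intro!: mult_left_le)
      then show "norm (?w v * of_real (fejer t * cos (t * ?x v))) \<le> norm (fejer t)" by simp
    qed
  qed simp
  have E_n: "(\<Sum>s\<in>S n. of_real (p n s) * (of_real (tent_weight \<delta> m (insert g A) (V n s)) * cis (\<Sum>f\<in>J. a f * V n s f)))
      = (1 / of_real fejer_mass) * (\<integral>t. \<phi> n t \<partial>lborel)" for n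
    unfolding tw \<phi>_def
    by (subst Bochner_Integration.integral_sum, intro integrable_mult_right int1)
      (simp only: integral_mult_right_zero sum_distrib_left mult.left_commute)
  have int2: "integrable (M \<Otimes>\<^sub>M lborel) (\<lambda>(\<omega>, t). ?w (G \<omega>) * of_real (fejer t * cos (t * ?x (G \<omega>))))"
  proof (rule Bochner_Integration.integrable_bound)
    interpret pair_sigma_finite M "lborel :: real measure" by unfold_locales
    show "integrable (M \<Otimes>\<^sub>M lborel) (\<lambda>(\<omega>, t). fejer t)"
      by (rule Fubini_integrable) (auto simp: integrable_fejer)
    have [measurable]: "(\<lambda>\<omega>. G \<omega> g) \<in> borel_measurable M" using G_meas g by simp
    note [measurable] = tent_weight_measurable[OF A]
    show "(\<lambda>(\<omega>, t). ?w (G \<omega>) * of_real (fejer t * cos (t * ?x (G \<omega>)))) \<in> borel_measurable (M \<Otimes>\<^sub>M lborel)"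
      by measurable
    show "AE z in M \<Otimes>\<^sub>M lborel. norm (case z of (\<omega>, t) \<Rightarrow> ?w (G \<omega>) * of_real (fejer t * cos (t * ?x (G \<omega>))))
        \<le> norm (case z of (\<omega>, t) \<Rightarrow> fejer t)"
    proof (rule AE_I2, clarify)
      fix \<omega> t
      have "norm (?w (G \<omega>) * of_real (fejer t * cos (t * ?x (G \<omega>)))) \<le> 1 * (\<bar>fejer t\<bar> * 1)"
        unfolding norm_mult[of "?w (G \<omega>)"] using w_norm[of "G \<omega>"] fejer_nonneg[of t]
        by (intro mult_mono) (auto simp: norm_mult abs_mult intro!: mult_left_le)
      then show "norm (?w (G \<omega>) * of_real (fejer t * cos (t * ?x (G \<omega>)))) \<le> norm (fejer t)" by simp
    qed
  qed
  have E: "(\<integral>\<omega>. of_real (tent_weight \<delta> m (insert g A) (G \<omega>)) * cis (\<Sum>f\<in>J. a f * G \<omega> f) \<partial>M)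
      = (1 / of_real fejer_mass) * (\<integral>t. \<psi> t \<partial>lborel)"
  proof -
    interpret pair_sigma_finite M "lborel :: real measure" by unfold_locales
    show ?thesis
      unfolding tw \<psi>_def using Fubini_integral[OF int2] by simp
  qed
  \<comment> \<open>The cosine shifts the coefficient of coordinate g by t / \<delta> in either
    direction. The induction hypothesis is used at these shifted coefficients, hence
    \<open>a\<close> is arbitrary in the induction.\<close>
  let ?pm = "\<lambda>\<sigma> t f. a f + (if f = g then \<sigma> * t / \<delta> else 0)"
  have shift: "?w v * of_real (fejer t * cos (t * ?x v)) =
      of_real (fejer t / 2) * (cis (- t * m g) * (of_real (tent_weight \<delta> m A v) * cis (\<Sum>f\<in>J. ?pm 1 t f * v f)) +
        cis (t * m g) * (of_real (tent_weight \<delta> m A v) * cis (\<Sum>f\<in>J. ?pm (-1) t f * v f)))" for v t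
  proof -
    have "(\<Sum>f\<in>J. ?pm \<sigma> t f * v f) = (\<Sum>f\<in>J. a f * v f) + \<sigma> * t / \<delta> * v g" for \<sigma>
    proof -
      have "(\<Sum>f\<in>J. ?pm \<sigma> t f * v f) = (\<Sum>f\<in>J. a f * v f + (if f = g then \<sigma> * t / \<delta> * v g else 0))"
        by (intro sum.cong) (auto simp: algebra_simps)
      then show ?thesis using finJ g by (simp add: sum.distrib)
    qed
    then have sums: "(\<Sum>f\<in>J. ?pm 1 t f * v f) = (\<Sum>f\<in>J. a f * v f) + t / \<delta> * v g"
      "(\<Sum>f\<in>J. ?pm (-1) t f * v f) = (\<Sum>f\<in>J. a f * v f) - t / \<delta> * v g" by simp_all
    have arg: "t * ?x v = t / \<delta> * v g - t * m g" "- t * m g = - (t * m g)" by (simp_all add: algebra_simps)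
    show ?thesis unfolding sums arg by (rule cis_times_cos)
  qed
  have lim: "(\<lambda>n. \<phi> n t) \<longlonglongrightarrow> \<psi> t" for t
  proof -
    let ?L = "\<lambda>\<sigma>. (\<integral>\<omega>. of_real (tent_weight \<delta> m A (G \<omega>)) * cis (\<Sum>f\<in>J. ?pm \<sigma> t f * G \<omega> f) \<partial>M)"
    have int: "integrable M (\<lambda>\<omega>. of_real (tent_weight \<delta> m A (G \<omega>)) * cis (\<Sum>f\<in>J. b f * G \<omega> f))" for b
    proof (rule integrable_const_bound[where B = 1])
      show "AE \<omega> in M. norm (of_real (tent_weight \<delta> m A (G \<omega>)) * cis (\<Sum>f\<in>J. b f * G \<omega> f)) \<le> 1"
        using tent_weight_bounds[of \<delta> m A] by (simp add: norm_mult)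
    qed (use tent_weight_measurable[OF A] in measurable)
    have "(\<lambda>n. of_real (fejer t / 2) *
        (cis (- t * m g) * (\<Sum>s\<in>S n. of_real (p n s) * (of_real (tent_weight \<delta> m A (V n s)) * cis (\<Sum>f\<in>J. ?pm 1 t f * V n s f))) +
         cis (t * m g) * (\<Sum>s\<in>S n. of_real (p n s) * (of_real (tent_weight \<delta> m A (V n s)) * cis (\<Sum>f\<in>J. ?pm (-1) t f * V n s f)))))
      \<longlonglongrightarrow> of_real (fejer t / 2) * (cis (- t * m g) * ?L 1 + cis (t * m g) * ?L (-1))"
      by (intro tendsto_mult tendsto_add tendsto_const insert.IH A)
    moreover have "of_real (fejer t / 2) * (cis (- t * m g) * ?L 1 + cis (t * m g) * ?L (-1)) = \<psi> t"
      unfolding \<psi>_def shift using int by simp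
    moreover have "of_real (fejer t / 2) *
        (cis (- t * m g) * (\<Sum>s\<in>S n. of_real (p n s) * (of_real (tent_weight \<delta> m A (V n s)) * cis (\<Sum>f\<in>J. ?pm 1 t f * V n s f))) +
         cis (t * m g) * (\<Sum>s\<in>S n. of_real (p n s) * (of_real (tent_weight \<delta> m A (V n s)) * cis (\<Sum>f\<in>J. ?pm (-1) t f * V n s f)))) = \<phi> n t" for n
      unfolding \<phi>_def shift sum_distrib_left sum.distrib[symmetric]
      by (intro sum.cong refl) (simp only: algebra_simps)
    ultimately show ?thesis by simp
  qed
  \<comment> \<open>All factors other than the kernel have modulus at most 1 and the weights
    \<open>p n\<close> sum to 1, so the kernel itself dominates.\<close>
  have "(\<lambda>n. \<integral>t. \<phi> n t \<partial>lborel) \<longlonglongrightarrow> (\<integral>t. \<psi> t \<partial>lborel)"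
  proof (rule integral_dominated_convergence[OF _ _ integrable_fejer])
    show \<phi>m: "\<phi> n \<in> borel_measurable lborel" for n
      unfolding \<phi>_def by measurable
    show "\<psi> \<in> borel_measurable lborel"
      by (rule borel_measurable_LIMSEQ_metric[OF \<phi>m]) (rule lim)
    show "AE t in lborel. (\<lambda>n. \<phi> n t) \<longlonglongrightarrow> \<psi> t" using lim by simp
    show "AE t in lborel. norm (\<phi> n t) \<le> fejer t" for n
    proof (rule AE_I2)
      fix t
      have "norm (\<phi> n t) \<le> (\<Sum>s\<in>S n. p n s * fejer t)"
        unfolding \<phi>_def
      proof (rule sum_norm_le)
        fix s assume s: "s \<in> S n"
        have "norm (?w (V n s) * of_real (fejer t * cos (t * ?x (V n s)))) \<le> 1 * (\<bar>fejer t\<bar> * 1)"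
          unfolding norm_mult[of "?w (V n s)"] using w_norm[of "V n s"] fejer_nonneg[of t]
          by (intro mult_mono) (auto simp: norm_mult abs_mult intro!: mult_left_le)
        then show "norm (of_real (p n s) * (?w (V n s) * of_real (fejer t * cos (t * ?x (V n s))))) \<le> p n s * fejer t"
          unfolding norm_mult[of "of_real (p n s)"] using p_nonneg[OF s] fejer_nonneg[of t]
          by (simp add: mult_left_mono)
      qed
      then show "norm (\<phi> n t) \<le> fejer t" by (simp add: sum_distrib_right[symmetric] p_total)
    qed
  qed
  then show ?case unfolding E_n E by (intro tendsto_mult tendsto_const)
qed

lemma tent_weight_lim:
  "(\<lambda>n. \<Sum>s\<in>S n. p n s * tent_weight \<delta> m J (V n s)) \<longlonglongrightarrow> (\<integral>\<omega>. tent_weight \<delta> m J (G \<omega>) \<partial>M)"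
proof -
  have "(\<lambda>n. complex_of_real (\<Sum>s\<in>S n. p n s * tent_weight \<delta> m J (V n s)))
      \<longlonglongrightarrow> complex_of_real (\<integral>\<omega>. tent_weight \<delta> m J (G \<omega>) \<partial>M)"
    using tent_cis_lim[OF finJ order_refl, of \<delta> m "\<lambda>_. 0"] by (simp add: integral_complex_of_real)
  then show ?thesis by (simp only: tendsto_of_real_iff)
qed

end

text \<open>The Lipschitz condition is taken for the maximum distance over \<open>J\<close>; its
  case d = 0 says that h depends on these coordinates alone. The clause 0 \<le> d matters for empty
  \<open>J\<close>, where the condition on the coordinates is vacuous.\<close>

definition coord_BL1 :: "'i set \<Rightarrow> (('i \<Rightarrow> real) \<Rightarrow> real) set" where
  "coord_BL1 J = {h. (\<forall>v. h v \<in> {0..1}) \<and>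
     (\<forall>v v' d. (\<forall>f\<in>J. \<bar>v f - v' f\<bar> \<le> d) \<and> 0 \<le> d \<longrightarrow> \<bar>h v - h v'\<bar> \<le> d)}"

context charfun_convergence
begin

definition grid :: "nat \<Rightarrow> ('i \<Rightarrow> int) set" where
  "grid K = J \<rightarrow>\<^sub>E {- int K..int K}"

definition node :: "('i \<Rightarrow> int) \<Rightarrow> 'i \<Rightarrow> real" where
  "node m f = of_int (m f)"

text \<open>The part of the partition of unity that sits on the finite grid. Its defect from 1
  measures how far v lies outside the box.\<close>

definition covered :: "real \<Rightarrow> nat \<Rightarrow> ('i \<Rightarrow> real) \<Rightarrow> real" where
  "covered \<delta> K v = (\<Sum>m\<in>grid K. tent_weight \<delta> (node m) J v)"

lemma covered_eq: "covered \<delta> K v = (\<Prod>f\<in>J. \<Sum>b\<in>{- int K..int K}. tent (v f / \<delta> - of_int b))"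
  unfolding covered_def grid_def tent_weight_def node_def using finJ by (intro prod_sum_PiE[symmetric]) auto

lemma covered_bounds: "0 \<le> covered \<delta> K v" "covered \<delta> K v \<le> 1"
  unfolding covered_eq using sum_tent(1)
  by (auto intro!: prod_nonneg prod_le_1 sum_nonneg simp: tent_bounds)

lemma covered_eventually: "eventually (\<lambda>K. covered \<delta> K v = 1) sequentially"
proof -
  \<comment> \<open>The sum bounds every coordinate and needs no separate treatment of empty
    \<open>J\<close>, unlike a maximum.\<close>
  define B where "B = (\<Sum>f\<in>J. \<bar>v f / \<delta>\<bar>)"
  show ?thesis
  proof (rule eventually_sequentiallyI)
    fix K :: nat assume K: "nat \<lceil>B\<rceil> + 1 \<le> K"
    show "covered \<delta> K v = 1"
      unfolding covered_eq
    proof (intro prod.neutral ballI sum_tent(2))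
      fix f assume f: "f \<in> J"
      have "\<bar>v f / \<delta>\<bar> \<le> B" unfolding B_def using finJ f by (intro member_le_sum) auto
      moreover have "B \<le> real K - 1" using K real_nat_ceiling_ge[of B] by linarith
      ultimately have x: "- real K \<le> v f / \<delta>" "v f / \<delta> \<le> real K - 1" by linarith+
      then have "- int K \<le> \<lfloor>v f / \<delta>\<rfloor>" by (simp add: le_floor_iff)
      moreover have "\<lfloor>v f / \<delta>\<rfloor> + 1 \<le> int K" using x(2) of_int_floor_le[of "v f / \<delta>"] by linarith
      ultimately show "{\<lfloor>v f / \<delta>\<rfloor>, \<lfloor>v f / \<delta>\<rfloor> + 1} \<subseteq> {- int K..int K}" by auto
    qed auto
  qed
qed

lemma covered_measurable [measurable]: "(\<lambda>\<omega>. covered \<delta> K (G \<omega>)) \<in> borel_measurable M"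
  unfolding covered_def by (intro borel_measurable_sum tent_weight_measurable order_refl)

lemma covered_lim: "(\<lambda>K. \<integral>\<omega>. covered \<delta> K (G \<omega>) \<partial>M) \<longlonglongrightarrow> 1"
proof -
  have "(\<lambda>K. \<integral>\<omega>. covered \<delta> K (G \<omega>) \<partial>M) \<longlonglongrightarrow> (\<integral>\<omega>. 1 \<partial>M)"
    using covered_eventually covered_bounds
    by (intro integral_dominated_convergence[where w = "\<lambda>_. 1"]) (auto intro: tendsto_eventually)
  then show ?thesis by (simp add: prob_space)
qed

text \<open>Interpolation on a grid of mesh \<open>\<delta>\<close>: the tents form a partition of unity, and those not
  vanishing at \<open>v\<close> sit at nodes closer than \<open>\<delta>\<close> to \<open>v\<close>.\<close>

lemma grid_interpolation:
  assumes h: "h \<in> coord_BL1 J" and \<delta>: "\<delta> > 0"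
  shows "\<bar>h v - (\<Sum>m\<in>grid K. h (\<lambda>f. \<delta> * node m f) * tent_weight \<delta> (node m) J v)\<bar>
    \<le> \<delta> + (1 - covered \<delta> K v)"
proof -
  have h01: "0 \<le> h v" "h v \<le> 1" for v using h by (auto simp: coord_BL1_def)
  let ?t = "\<lambda>m. tent_weight \<delta> (node m) J v"
  have "\<bar>(h v - h (\<lambda>f. \<delta> * node m f)) * ?t m\<bar> \<le> \<delta> * ?t m" for m
  proof (cases "?t m = 0")
    case False
    have "\<bar>v f - \<delta> * node m f\<bar> \<le> \<delta>" if "f \<in> J" for f
    proof -
      have "tent (v f / \<delta> - node m f) \<noteq> 0"
        using False finJ that unfolding tent_weight_def by auto
      then have "\<bar>v f / \<delta> - node m f\<bar> \<le> 1" unfolding tent_def by (simp split: if_splits add: max_def)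
      moreover have "v f - \<delta> * node m f = \<delta> * (v f / \<delta> - node m f)" using \<delta> by (simp add: field_simps)
      ultimately show ?thesis using \<delta> by (simp add: abs_mult mult_left_le)
    qed
    then have "\<bar>h v - h (\<lambda>f. \<delta> * node m f)\<bar> \<le> \<delta>" using h \<delta> unfolding coord_BL1_def by simp
    then show ?thesis using tent_weight_bounds(1)[of \<delta> "node m" J v] by (simp add: abs_mult mult_right_mono)
  qed simp
  then have "\<bar>\<Sum>m\<in>grid K. (h v - h (\<lambda>f. \<delta> * node m f)) * ?t m\<bar> \<le> (\<Sum>m\<in>grid K. \<delta> * ?t m)"
    by (rule order_trans[OF sum_abs sum_mono])
  also have "\<dots> = \<delta> * covered \<delta> K v" by (simp add: covered_def sum_distrib_left)
  also have "\<dots> \<le> \<delta>" using covered_bounds(2) \<delta> by (simp add: mult_left_le)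
  finally have 1: "\<bar>\<Sum>m\<in>grid K. (h v - h (\<lambda>f. \<delta> * node m f)) * ?t m\<bar> \<le> \<delta>" .
  have "(\<Sum>m\<in>grid K. (h v - h (\<lambda>f. \<delta> * node m f)) * ?t m) =
      h v * covered \<delta> K v - (\<Sum>m\<in>grid K. h (\<lambda>f. \<delta> * node m f) * ?t m)"
    by (simp add: left_diff_distrib sum_subtractf covered_def sum_distrib_left)
  moreover have "0 \<le> h v * (1 - covered \<delta> K v)" "h v * (1 - covered \<delta> K v) \<le> 1 - covered \<delta> K v"
    using h01 covered_bounds by (auto intro: mult_left_le_one_le)
  moreover have "h v * (1 - covered \<delta> K v) = h v - h v * covered \<delta> K v" by (simp add: algebra_simps)
  ultimately show ?thesis using 1 by linarith
qed

text \<open>After interpolation h enters only through finitely many coefficients in [0, 1], while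
  the tent expectations that they multiply do not depend on h. Convergence of those finitely many
  numbers is therefore uniform in h.\<close>

lemma uniform_weak_convergence:
  assumes \<epsilon>: "\<epsilon> > 0"
  shows "\<exists>n0. \<forall>n\<ge>n0. \<forall>h\<in>coord_BL1 J. (\<lambda>\<omega>. h (G \<omega>)) \<in> borel_measurable M \<longrightarrow>
    \<bar>(\<Sum>s\<in>S n. p n s * h (V n s)) - (\<integral>\<omega>. h (G \<omega>) \<partial>M)\<bar> \<le> \<epsilon>"
proof -
  \<comment> \<open>The errors below add up to 6\<delta>: 3\<delta> for interpolation under the
    approximating law, 2\<delta> under the limit and \<delta> for the tent expectations.\<close>
  define \<delta> where "\<delta> = \<epsilon> / 8"
  have \<delta>: "\<delta> > 0" using \<epsilon> by (simp add: \<delta>_def)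
  have "eventually (\<lambda>K. (\<integral>\<omega>. covered \<delta> K (G \<omega>) \<partial>M) > 1 - \<delta>) sequentially"
    using covered_lim by (rule order_tendstoD) (use \<delta> in simp)
  then obtain K where K: "(\<integral>\<omega>. covered \<delta> K (G \<omega>) \<partial>M) > 1 - \<delta>"
    using eventually_happens by fastforce
  define T where "T n m = (\<Sum>s\<in>S n. p n s * tent_weight \<delta> (node m) J (V n s))" for n m
  define T' where "T' m = (\<integral>\<omega>. tent_weight \<delta> (node m) J (G \<omega>) \<partial>M)" for m
  have "(\<lambda>n. \<Sum>m\<in>grid K. \<bar>T n m - T' m\<bar>) \<longlonglongrightarrow> (\<Sum>m\<in>grid K. \<bar>T' m - T' m\<bar>)"
    unfolding T_def T'_def by (intro tendsto_sum tendsto_rabs tendsto_diff tendsto_const tent_weight_lim)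
  then have "(\<lambda>n. \<Sum>m\<in>grid K. \<bar>T n m - T' m\<bar>) \<longlonglongrightarrow> 0" by simp
  then have "eventually (\<lambda>n. (\<Sum>m\<in>grid K. \<bar>T n m - T' m\<bar>) < \<delta>) sequentially"
    using \<delta> by (rule order_tendstoD)
  then obtain n0 where n0: "\<And>n. n \<ge> n0 \<Longrightarrow> (\<Sum>m\<in>grid K. \<bar>T n m - T' m\<bar>) < \<delta>"
    unfolding eventually_sequentially by blast
  have bounded_int: "integrable M g" if "g \<in> borel_measurable M" "\<And>\<omega>. 0 \<le> g \<omega>" "\<And>\<omega>. g \<omega> \<le> 1" for g :: "'g \<Rightarrow> real"
    using that by (intro integrable_const_bound[where B = 1]) auto
  have tw_int: "integrable M (\<lambda>\<omega>. tent_weight \<delta> (node m) J (G \<omega>))" for m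
    using tent_weight_bounds by (intro bounded_int tent_weight_measurable) auto
  have cov_int: "integrable M (\<lambda>\<omega>. covered \<delta> K (G \<omega>))"
    using covered_bounds by (intro bounded_int) auto
  have E_cov: "(\<integral>\<omega>. covered \<delta> K (G \<omega>) \<partial>M) = (\<Sum>m\<in>grid K. T' m)"
    unfolding covered_def T'_def using tw_int by (rule Bochner_Integration.integral_sum)
  show ?thesis
  proof (intro exI[of _ n0] allI impI ballI)
    fix n h assume n: "n \<ge> n0" and h: "h \<in> coord_BL1 J" and hm: "(\<lambda>\<omega>. h (G \<omega>)) \<in> borel_measurable M"
    have h01: "0 \<le> h v" "h v \<le> 1" for v using h by (auto simp: coord_BL1_def)
    define c where "c m = h (\<lambda>f. \<delta> * node m f)" for m
    define I where "I v = (\<Sum>m\<in>grid K. c m * tent_weight \<delta> (node m) J v)" for v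
    have I: "\<bar>h v - I v\<bar> \<le> \<delta> + (1 - covered \<delta> K v)" for v
      unfolding I_def c_def by (rule grid_interpolation[OF h \<delta>])
    have cov_n: "(\<Sum>s\<in>S n. p n s * covered \<delta> K (V n s)) = (\<Sum>m\<in>grid K. T n m)"
      unfolding covered_def T_def sum_distrib_left by (rule sum.swap)
    have "\<bar>(\<Sum>s\<in>S n. p n s * h (V n s)) - (\<Sum>m\<in>grid K. c m * T n m)\<bar>
        = \<bar>\<Sum>s\<in>S n. p n s * (h (V n s) - I (V n s))\<bar>"
    proof -
      have "(\<Sum>m\<in>grid K. c m * T n m) = (\<Sum>s\<in>S n. p n s * I (V n s))"
        unfolding T_def I_def sum_distrib_left by (subst sum.swap) (simp only: mult.left_commute)
      then show ?thesis by (simp add: right_diff_distrib sum_subtractf)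
    qed
    also have "\<dots> \<le> (\<Sum>s\<in>S n. p n s * (\<delta> + (1 - covered \<delta> K (V n s))))"
      using I p_nonneg by (intro order_trans[OF sum_abs] sum_mono) (simp add: abs_mult mult_left_mono)
    also have "\<dots> = (\<delta> + 1) * (\<Sum>s\<in>S n. p n s) - (\<Sum>s\<in>S n. p n s * covered \<delta> K (V n s))"
      by (simp add: algebra_simps sum.distrib sum_subtractf sum_distrib_left)
    also have "\<dots> = \<delta> + 1 - (\<Sum>m\<in>grid K. T n m)" by (simp add: p_total cov_n)
    finally have 1: "\<bar>(\<Sum>s\<in>S n. p n s * h (V n s)) - (\<Sum>m\<in>grid K. c m * T n m)\<bar>
        \<le> \<delta> + 1 - (\<Sum>m\<in>grid K. T n m)" .
    have h_int: "integrable M (\<lambda>\<omega>. h (G \<omega>))" using hm h01 by (intro bounded_int) auto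
    have I_int: "integrable M (\<lambda>\<omega>. I (G \<omega>))"
      unfolding I_def by (intro Bochner_Integration.integrable_sum integrable_mult_right tw_int)
    have "(\<integral>\<omega>. I (G \<omega>) \<partial>M) = (\<Sum>m\<in>grid K. c m * T' m)"
      unfolding I_def T'_def using tw_int by (subst Bochner_Integration.integral_sum) auto
    then have "\<bar>(\<integral>\<omega>. h (G \<omega>) \<partial>M) - (\<Sum>m\<in>grid K. c m * T' m)\<bar> = \<bar>\<integral>\<omega>. h (G \<omega>) - I (G \<omega>) \<partial>M\<bar>"
      using h_int I_int by simp
    also have "\<dots> \<le> (\<integral>\<omega>. \<bar>h (G \<omega>) - I (G \<omega>)\<bar> \<partial>M)" by (rule integral_abs_bound)
    also have "\<dots> \<le> (\<integral>\<omega>. \<delta> + (1 - covered \<delta> K (G \<omega>)) \<partial>M)"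
      using h_int I_int cov_int I by (intro integral_mono) auto
    also have "\<dots> = \<delta> + 1 - (\<integral>\<omega>. covered \<delta> K (G \<omega>) \<partial>M)" using cov_int by (simp add: prob_space)
    finally have 2: "\<bar>(\<integral>\<omega>. h (G \<omega>) \<partial>M) - (\<Sum>m\<in>grid K. c m * T' m)\<bar> \<le> 2 * \<delta>" using K by linarith
    have "\<bar>(\<Sum>m\<in>grid K. c m * T n m) - (\<Sum>m\<in>grid K. c m * T' m)\<bar> \<le> (\<Sum>m\<in>grid K. \<bar>T n m - T' m\<bar>)"
      unfolding sum_subtractf[symmetric] right_diff_distrib[symmetric]
      using h01 by (intro order_trans[OF sum_abs] sum_mono) (simp add: abs_mult c_def mult_left_le_one_le)
    then have 3: "\<bar>(\<Sum>m\<in>grid K. c m * T n m) - (\<Sum>m\<in>grid K. c m * T' m)\<bar> \<le> \<delta>" using n0[OF n] by linarith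
    \<comment> \<open>Tightness of the approximating laws: the mass that they place on the box is
      close to the mass placed there by the limit, which exceeds 1 - \<delta>.\<close>
    have "\<bar>(\<Sum>m\<in>grid K. T n m) - (\<Sum>m\<in>grid K. T' m)\<bar> \<le> (\<Sum>m\<in>grid K. \<bar>T n m - T' m\<bar>)"
      unfolding sum_subtractf[symmetric] by (rule sum_abs)
    then have 4: "1 - (\<Sum>m\<in>grid K. T n m) \<le> 2 * \<delta>" using n0[OF n] K E_cov by linarith
    have "8 * \<delta> = \<epsilon>" by (simp add: \<delta>_def)
    then show "\<bar>(\<Sum>s\<in>S n. p n s * h (V n s)) - (\<integral>\<omega>. h (G \<omega>) \<partial>M)\<bar> \<le> \<epsilon>"
      using 1 2 3 4 \<delta> by linarith
  qed
qed

end

section \<open>A central limit theorem with bounded multipliers\<close>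

text \<open>Both bounds come from 1 - y \<le> exp (-y) \<le> 1 / (1 + y).\<close>

lemma exp_minus_taylor:
  fixes y :: real
  assumes "0 \<le> y"
  shows "\<bar>1 - y - exp (- y)\<bar> \<le> min y (y\<^sup>2)"
proof -
  have 1: "1 - y \<le> exp (- y)" using exp_ge_add_one_self[of "- y"] by simp
  have "exp (- y) \<le> 1 / (1 + y)"
    using exp_ge_add_one_self[of y] assms by (simp add: exp_minus field_simps)
  moreover have "1 / (1 + y) = 1 - y + y\<^sup>2 / (1 + y)"
    using assms by (simp add: field_simps power2_eq_square)
  ultimately have 2: "exp (- y) \<le> 1 - y + y\<^sup>2 / (1 + y)" by simp
  have "y\<^sup>2 / (1 + y) \<le> y\<^sup>2 / 1" using assms by (intro divide_left_mono) auto
  moreover have "y\<^sup>2 / (1 + y) \<le> y" using assms by (simp add: field_simps power2_eq_square)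
  ultimately show ?thesis using 1 2 by simp
qed

text \<open>Second-order Taylor expansion, with the cubic remainder for \<bar>b\<bar> \<le> 1 and
  the quadratic one otherwise; the factor \<open>min 1 \<bar>b\<bar>\<close> lets second moments
  suffice later. The two halves of the factor 2 come from the exponentials and from the Gaussian
  factor, and C \<ge> 1 allows \<open>C ^ 4\<close> to cover the lower powers.\<close>

lemma centered_charfun_approx:
  fixes q :: "'b \<Rightarrow> real"
  assumes B: "finite B" "\<And>\<beta>. \<beta> \<in> B \<Longrightarrow> 0 \<le> q \<beta>" "(\<Sum>\<beta>\<in>B. q \<beta>) = 1" "(\<Sum>\<beta>\<in>B. q \<beta> * \<xi> \<beta>) = 0"
    and C: "1 \<le> C" "\<And>\<beta>. \<beta> \<in> B \<Longrightarrow> \<bar>\<xi> \<beta>\<bar> \<le> C"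
  shows "norm ((\<Sum>\<beta>\<in>B. of_real (q \<beta>) * cis (\<xi> \<beta> * b)) - of_real (exp (- ((\<Sum>\<beta>\<in>B. q \<beta> * (\<xi> \<beta>)\<^sup>2) * b\<^sup>2 / 2))))
    \<le> 2 * C ^ 4 * (b\<^sup>2 * min 1 \<bar>b\<bar>)"
proof -
  define \<tau> where "\<tau> = (\<Sum>\<beta>\<in>B. q \<beta> * (\<xi> \<beta>)\<^sup>2)"
  define L where "L = b\<^sup>2 * min 1 \<bar>b\<bar>"
  have L0: "0 \<le> L" by (simp add: L_def)
  have \<tau>: "0 \<le> \<tau>" unfolding \<tau>_def using B(2) by (intro sum_nonneg) auto
  have "\<tau> \<le> (\<Sum>\<beta>\<in>B. q \<beta> * C\<^sup>2)"
    unfolding \<tau>_def using B(2) C by (intro sum_mono mult_left_mono) (auto simp: abs_le_square_iff[symmetric])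
  then have \<tau>C: "\<tau> \<le> C\<^sup>2" by (simp add: sum_distrib_right[symmetric] B(3))
  have CC: "C ^ 3 \<le> C ^ 4" "C\<^sup>2 \<le> C ^ 4" "C\<^sup>2 \<le> C ^ 3" using C(1) by (auto intro: power_increasing)
  have term_bound: "norm (cis x - (1 + \<i> * of_real x - of_real (x\<^sup>2 / 2))) \<le> C ^ 4 * L" if x: "\<bar>x\<bar> \<le> C * \<bar>b\<bar>" for x
  proof -
    have exp: "(\<Sum>k\<le>2. (\<i> * complex_of_real x) ^ k / fact k) = 1 + \<i> * of_real x - of_real (x\<^sup>2 / 2)"
      by (simp add: complex_eq_iff numeral_2_eq_2 power2_eq_square)
    have cis: "cis x = iexp x" by (simp add: cis_conv_exp)
    have "norm (cis x - (1 + \<i> * of_real x - of_real (x\<^sup>2 / 2))) \<le> \<bar>x\<bar> ^ 3 / 6"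
      using iexp_approx1[of x 2] unfolding exp cis by (simp add: eval_nat_numeral)
    also have "\<dots> \<le> \<bar>x\<bar> ^ 3" by simp
    also have "\<dots> \<le> (C * \<bar>b\<bar>) ^ 3" using x by (intro power_mono) auto
    finally have 1: "norm (cis x - (1 + \<i> * of_real x - of_real (x\<^sup>2 / 2))) \<le> C ^ 3 * \<bar>b\<bar> ^ 3"
      by (simp add: power_mult_distrib)
    have "norm (cis x - (1 + \<i> * of_real x - of_real (x\<^sup>2 / 2))) \<le> \<bar>x\<bar>\<^sup>2"
      using iexp_approx2[of x 2] unfolding exp cis by simp
    also have "\<dots> \<le> (C * \<bar>b\<bar>)\<^sup>2" using x by (intro power_mono) auto
    finally have 2: "norm (cis x - (1 + \<i> * of_real x - of_real (x\<^sup>2 / 2))) \<le> C\<^sup>2 * b\<^sup>2"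
      by (simp add: power_mult_distrib)
    show ?thesis
    proof (cases "\<bar>b\<bar> \<le> 1")
      case True
      then have "L = \<bar>b\<bar> ^ 3" by (simp add: L_def power3_eq_cube power2_eq_square)
      then show ?thesis using 1 mult_right_mono[OF CC(1) L0] by (metis order_trans)
    next
      case False
      then have "L = b\<^sup>2" by (simp add: L_def)
      then show ?thesis using 2 mult_right_mono[OF CC(2) L0] by (metis order_trans)
    qed
  qed
  have "(\<Sum>\<beta>\<in>B. of_real (q \<beta>) * (1 + \<i> * of_real (\<xi> \<beta> * b) - of_real ((\<xi> \<beta> * b)\<^sup>2 / 2)))
      = of_real (\<Sum>\<beta>\<in>B. q \<beta>) + \<i> * of_real b * of_real (\<Sum>\<beta>\<in>B. q \<beta> * \<xi> \<beta>) - of_real (b\<^sup>2 / 2) * of_real \<tau>"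
    unfolding \<tau>_def by (simp add: algebra_simps sum.distrib sum_subtractf sum_distrib_left sum_divide_distrib power_mult_distrib)
  then have quad: "(\<Sum>\<beta>\<in>B. of_real (q \<beta>) * (1 + \<i> * of_real (\<xi> \<beta> * b) - of_real ((\<xi> \<beta> * b)\<^sup>2 / 2)))
      = complex_of_real (1 - \<tau> * b\<^sup>2 / 2)"
    by (simp only: B(3,4)) (simp add: mult.commute)
  have "norm ((\<Sum>\<beta>\<in>B. of_real (q \<beta>) * cis (\<xi> \<beta> * b)) - of_real (1 - \<tau> * b\<^sup>2 / 2)) \<le>
      (\<Sum>\<beta>\<in>B. q \<beta> * (C ^ 4 * L))"
    unfolding quad[symmetric] sum_subtractf[symmetric] right_diff_distrib[symmetric]
  proof (rule sum_norm_le)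
    fix \<beta> assume \<beta>: "\<beta> \<in> B"
    have "\<bar>\<xi> \<beta> * b\<bar> \<le> C * \<bar>b\<bar>" using C(2)[OF \<beta>] by (simp add: abs_mult mult_right_mono)
    from term_bound[OF this] show "norm (of_real (q \<beta>) * (cis (\<xi> \<beta> * b) - (1 + \<i> * of_real (\<xi> \<beta> * b) - of_real ((\<xi> \<beta> * b)\<^sup>2 / 2))))
        \<le> q \<beta> * (C ^ 4 * L)"
      unfolding norm_mult[of "of_real (q \<beta>)"] using B(2)[OF \<beta>] by (simp add: mult_left_mono)
  qed
  then have 1: "norm ((\<Sum>\<beta>\<in>B. of_real (q \<beta>) * cis (\<xi> \<beta> * b)) - of_real (1 - \<tau> * b\<^sup>2 / 2)) \<le> C ^ 4 * L"
    by (simp add: sum_distrib_right[symmetric] B(3))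
  define y where "y = \<tau> * b\<^sup>2 / 2"
  have y: "0 \<le> y" "y \<le> C\<^sup>2 * b\<^sup>2"
    using \<tau> mult_right_mono[OF \<tau>C, of "b\<^sup>2"] by (auto simp: y_def) (smt (verit) mult_nonneg_nonneg zero_le_power2)
  have "\<bar>1 - y - exp (- y)\<bar> \<le> C ^ 4 * L"
  proof (cases "\<bar>b\<bar> \<le> 1")
    case True
    have "\<bar>1 - y - exp (- y)\<bar> \<le> y\<^sup>2" using exp_minus_taylor[OF y(1)] by simp
    also have "\<dots> \<le> (C\<^sup>2 * b\<^sup>2)\<^sup>2" using y by (intro power_mono)
    also have "\<dots> = C ^ 4 * (b\<^sup>2 * b\<^sup>2)" by (simp add: power_mult_distrib power2_eq_square power4_eq_xxxx)
    also have "\<dots> \<le> C ^ 4 * (b\<^sup>2 * \<bar>b\<bar>)"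
    proof (intro mult_left_mono)
      show "b\<^sup>2 \<le> \<bar>b\<bar>" using True mult_left_le[of "\<bar>b\<bar>" "\<bar>b\<bar>"] by (simp add: power2_eq_square)
    qed (use C(1) in auto)
    also have "\<dots> = C ^ 4 * L" using True by (simp add: L_def)
    finally show ?thesis .
  next
    case False
    have "\<bar>1 - y - exp (- y)\<bar> \<le> y" using exp_minus_taylor[OF y(1)] by simp
    also have "\<dots> \<le> C ^ 4 * b\<^sup>2" using y(2) mult_right_mono[OF CC(2), of "b\<^sup>2"] by simp
    also have "\<dots> = C ^ 4 * L" using False by (simp add: L_def)
    finally show ?thesis .
  qed
  then have 2: "norm (complex_of_real (1 - y) - of_real (exp (- y))) \<le> C ^ 4 * L"
    by (simp only: of_real_diff[symmetric] norm_of_real)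
  have "norm ((\<Sum>\<beta>\<in>B. of_real (q \<beta>) * cis (\<xi> \<beta> * b)) - of_real (exp (- y))) \<le> C ^ 4 * L + C ^ 4 * L"
    using norm_triangle_le_diff[OF add_mono[OF 1 2[unfolded y_def norm_minus_commute[of "of_real (1 - \<tau> * b\<^sup>2 / 2)"]]]]
    by (simp add: y_def)
  then show ?thesis unfolding y_def \<tau>_def L_def by (simp add: mult_ac)
qed

text \<open>By independence both sides are products of N factors of modulus at most 1, so their
  distance is at most the sum of the distances of the factors. The cube arises because A = 1 +
  \<Sum>\<bar>a f\<bar> \<ge> 1 enters twice through the square and once through the
  minimum.\<close>

lemma weighted_sum_charfun_approx:
  fixes q \<xi> :: "nat \<Rightarrow> 'b \<Rightarrow> real" and v :: "nat \<Rightarrow> 'i \<Rightarrow> real" and a :: "'i \<Rightarrow> real"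
  assumes pw: "product_weights N B q" and J: "finite J"
    and centered: "\<And>i. i < N \<Longrightarrow> (\<Sum>b\<in>B. q i b * \<xi> i b) = 0"
    and C: "1 \<le> C" "\<And>i b. i < N \<Longrightarrow> b \<in> B \<Longrightarrow> \<bar>\<xi> i b\<bar> \<le> C"
  defines "cov \<equiv> \<lambda>f g. \<Sum>i<N. (\<Sum>b\<in>B. q i b * (\<xi> i b)\<^sup>2) * (v i f * v i g)"
  shows "norm ((\<Sum>s\<in>{..<N} \<rightarrow>\<^sub>E B. of_real (\<Prod>i<N. q i (s i)) * cis (\<Sum>f\<in>J. a f * (\<Sum>i<N. \<xi> i (s i) * v i f)))
      - of_real (exp (- (\<Sum>f\<in>J. \<Sum>g\<in>J. a f * a g * cov f g) / 2)))
    \<le> 2 * C ^ 4 * (1 + (\<Sum>f\<in>J. \<bar>a f\<bar>)) ^ 3 * (\<Sum>i<N. (\<Sum>f\<in>J. \<bar>v i f\<bar>)\<^sup>2 * min 1 (\<Sum>f\<in>J. \<bar>v i f\<bar>))"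
proof -
  interpret product_weights N B q by (rule pw)
  define A where "A = 1 + (\<Sum>f\<in>J. \<bar>a f\<bar>)"
  have A: "1 \<le> A" unfolding A_def by (simp add: sum_nonneg)
  define b where "b i = (\<Sum>f\<in>J. a f * v i f)" for i
  define W where "W i = (\<Sum>f\<in>J. \<bar>v i f\<bar>)" for i
  define \<tau> where "\<tau> i = (\<Sum>\<beta>\<in>B. q i \<beta> * (\<xi> i \<beta>)\<^sup>2)" for i
  define z where "z i = (\<Sum>\<beta>\<in>B. of_real (q i \<beta>) * cis (\<xi> i \<beta> * b i))" for i
  define w where "w i = complex_of_real (exp (- (\<tau> i * (b i)\<^sup>2 / 2)))" for i
  have "(\<Sum>s\<in>{..<N} \<rightarrow>\<^sub>E B. of_real (\<Prod>i<N. q i (s i)) * cis (\<Sum>f\<in>J. a f * (\<Sum>i<N. \<xi> i (s i) * v i f)))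
      = (\<Sum>s\<in>{..<N} \<rightarrow>\<^sub>E B. \<Prod>i<N. of_real (q i (s i)) * cis (\<xi> i (s i) * b i))"
  proof (intro sum.cong refl)
    fix s
    have "(\<Sum>f\<in>J. a f * (\<Sum>i<N. \<xi> i (s i) * v i f)) = (\<Sum>i<N. \<xi> i (s i) * b i)"
      unfolding b_def sum_distrib_left by (subst sum.swap) (simp only: mult.left_commute)
    then show "of_real (\<Prod>i<N. q i (s i)) * cis (\<Sum>f\<in>J. a f * (\<Sum>i<N. \<xi> i (s i) * v i f))
        = (\<Prod>i<N. of_real (q i (s i)) * cis (\<xi> i (s i) * b i))"
      by (simp only: cis_sum prod.distrib of_real_prod)
  qed
  also have "\<dots> = (\<Prod>i<N. z i)"
    unfolding z_def using fin by (intro prod_sum_PiE[symmetric]) auto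
  finally have lhs: "(\<Sum>s\<in>{..<N} \<rightarrow>\<^sub>E B. of_real (\<Prod>i<N. q i (s i)) * cis (\<Sum>f\<in>J. a f * (\<Sum>i<N. \<xi> i (s i) * v i f)))
      = (\<Prod>i<N. z i)" .
  have "(\<Sum>f\<in>J. \<Sum>g\<in>J. a f * a g * cov f g) = (\<Sum>f\<in>J. \<Sum>g\<in>J. \<Sum>i<N. \<tau> i * ((a f * v i f) * (a g * v i g)))"
    unfolding cov_def \<tau>_def sum_distrib_left[of _ _ "{..<N}"]
    by (intro sum.cong refl) (simp only: mult_ac)
  also have "\<dots> = (\<Sum>f\<in>J. \<Sum>i<N. \<Sum>g\<in>J. \<tau> i * ((a f * v i f) * (a g * v i g)))"
    by (intro sum.cong refl) (rule sum.swap)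
  also have "\<dots> = (\<Sum>i<N. \<Sum>f\<in>J. \<Sum>g\<in>J. \<tau> i * ((a f * v i f) * (a g * v i g)))"
    by (rule sum.swap)
  also have "\<dots> = (\<Sum>i<N. \<tau> i * (\<Sum>f\<in>J. \<Sum>g\<in>J. (a f * v i f) * (a g * v i g)))"
    by (simp only: sum_distrib_left)
  also have "\<dots> = (\<Sum>i<N. \<tau> i * (b i)\<^sup>2)"
    unfolding b_def power2_eq_square sum_product ..
  finally have cov: "(\<Sum>f\<in>J. \<Sum>g\<in>J. a f * a g * cov f g) = (\<Sum>i<N. \<tau> i * (b i)\<^sup>2)" .
  have "of_real (exp (- (\<Sum>f\<in>J. \<Sum>g\<in>J. a f * a g * cov f g) / 2)) = (\<Prod>i<N. w i)"
    unfolding cov w_def of_real_prod[symmetric] exp_sum[OF finite_lessThan, symmetric]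
    by (simp add: sum_negf sum_divide_distrib)
  then have rhs: "complex_of_real (exp (- (\<Sum>f\<in>J. \<Sum>g\<in>J. a f * a g * cov f g) / 2)) = (\<Prod>i<N. w i)" .
  have \<tau>0: "0 \<le> \<tau> i" if "i < N" for i unfolding \<tau>_def using nonneg that by (intro sum_nonneg) auto
  have "norm (z i) \<le> 1" if "i < N" for i
  proof -
    have "norm (z i) \<le> (\<Sum>\<beta>\<in>B. q i \<beta>)"
      unfolding z_def using nonneg[OF that] by (intro sum_norm_le) (simp add: norm_mult)
    then show ?thesis using total[OF that] by simp
  qed
  moreover have "norm (w i) \<le> 1" if "i < N" for i unfolding w_def using \<tau>0[OF that] by simp
  ultimately have "norm ((\<Prod>i<N. z i) - (\<Prod>i<N. w i)) \<le> (\<Sum>i<N. norm (z i - w i))"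
    by (intro norm_prod_diff) auto
  also have "\<dots> \<le> (\<Sum>i<N. 2 * C ^ 4 * A ^ 3 * ((W i)\<^sup>2 * min 1 (W i)))"
  proof (rule sum_mono)
    fix i assume "i \<in> {..<N}"
    then have i: "i < N" by simp
    have W0: "0 \<le> W i" by (simp add: W_def sum_nonneg)
    have "\<bar>b i\<bar> \<le> (\<Sum>f\<in>J. A * \<bar>v i f\<bar>)"
      unfolding b_def
    proof (intro order_trans[OF sum_abs] sum_mono)
      fix f assume f: "f \<in> J"
      have "\<bar>a f\<bar> \<le> (\<Sum>f\<in>J. \<bar>a f\<bar>)" using J f by (intro member_le_sum) auto
      then show "\<bar>a f * v i f\<bar> \<le> A * \<bar>v i f\<bar>" unfolding A_def abs_mult by (intro mult_right_mono) auto
    qed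
    then have b: "\<bar>b i\<bar> \<le> A * W i" by (simp add: W_def sum_distrib_left)
    have "min 1 \<bar>b i\<bar> \<le> A * min 1 (W i)" using A b by (auto simp: min_def)
    moreover have "(b i)\<^sup>2 \<le> (A * W i)\<^sup>2" using b power_mono[OF b, of 2] by simp
    ultimately have "(b i)\<^sup>2 * min 1 \<bar>b i\<bar> \<le> (A * W i)\<^sup>2 * (A * min 1 (W i))"
      by (intro mult_mono) auto
    also have "\<dots> = A ^ 3 * ((W i)\<^sup>2 * min 1 (W i))"
      by (simp add: power_mult_distrib power2_eq_square power3_eq_cube)
    finally have bw: "(b i)\<^sup>2 * min 1 \<bar>b i\<bar> \<le> A ^ 3 * ((W i)\<^sup>2 * min 1 (W i))" .
    have "norm (z i - w i) \<le> 2 * C ^ 4 * ((b i)\<^sup>2 * min 1 \<bar>b i\<bar>)"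
      unfolding z_def w_def \<tau>_def using i nonneg total centered C fin
      by (intro centered_charfun_approx) auto
    also have "\<dots> \<le> 2 * C ^ 4 * (A ^ 3 * ((W i)\<^sup>2 * min 1 (W i)))"
      using bw C(1) by (intro mult_left_mono) auto
    finally show "norm (z i - w i) \<le> 2 * C ^ 4 * A ^ 3 * ((W i)\<^sup>2 * min 1 (W i))" by (simp only: mult.assoc)
  qed
  finally show ?thesis unfolding lhs rhs A_def[symmetric] W_def sum_distrib_left[symmetric] .
qed

text \<open>A single \<delta> serves all arrays, which makes the result usable at a fixed
  population. If no \<delta> worked, counterexamples for \<delta> = 1 / (n + 1) would form a
  sequence whose covariances converge and whose Lindeberg sums vanish, contradicting
  \<open>uniform_weak_convergence\<close>.\<close>

lemma bounded_multiplier_clt: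
  fixes M :: "'g measure" and G :: "'g \<Rightarrow> 'i \<Rightarrow> real" and B :: "'b set"
  assumes M: "prob_space M" and J: "finite J"
    and G: "\<And>f. f \<in> J \<Longrightarrow> (\<lambda>\<omega>. G \<omega> f) \<in> borel_measurable M"
    and gauss: "\<And>a. (\<integral>\<omega>. cis (\<Sum>f\<in>J. a f * G \<omega> f) \<partial>M) =
        of_real (exp (- (\<Sum>f\<in>J. \<Sum>g\<in>J. a f * a g * Cov f g) / 2))"
    and C: "1 \<le> C" and \<epsilon>: "\<epsilon> > 0"
  shows "\<exists>\<delta>>0. \<forall>N q \<xi> v. product_weights N B q \<longrightarrow>
      (\<forall>i<N. (\<Sum>b\<in>B. q i b * \<xi> i b) = 0) \<longrightarrow> (\<forall>i<N. \<forall>b\<in>B. \<bar>\<xi> i b\<bar> \<le> C) \<longrightarrow>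
      (\<forall>f\<in>J. \<forall>g\<in>J. \<bar>(\<Sum>i<N. (\<Sum>b\<in>B. q i b * (\<xi> i b)\<^sup>2) * (v i f * v i g)) - Cov f g\<bar> \<le> \<delta>) \<longrightarrow>
      (\<Sum>i<N. (\<Sum>f\<in>J. \<bar>v i f\<bar>)\<^sup>2 * min 1 (\<Sum>f\<in>J. \<bar>v i f\<bar>)) \<le> \<delta> \<longrightarrow>
      (\<forall>h\<in>coord_BL1 J. (\<lambda>\<omega>. h (G \<omega>)) \<in> borel_measurable M \<longrightarrow>
        \<bar>prod_exp N B q (\<lambda>s. h (\<lambda>f. \<Sum>i<N. \<xi> i (s i) * v i f)) - (\<integral>\<omega>. h (G \<omega>) \<partial>M)\<bar> \<le> \<epsilon>)"
    (is "\<exists>\<delta>>0. \<forall>N q \<xi> v. ?pw N q \<longrightarrow> ?cen N q \<xi> \<longrightarrow> ?bd N \<xi> \<longrightarrow> ?cov \<delta> N q \<xi> v \<longrightarrow> ?lind \<delta> N v \<longrightarrow> ?concl N q \<xi> v")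
proof (rule ccontr)
  assume not: "\<not> ?thesis"
  define good where "good \<delta> x \<longleftrightarrow> (case x of (N, q, \<xi>, v) \<Rightarrow> ?pw N q \<and> ?cen N q \<xi> \<and> ?bd N \<xi> \<and> ?cov \<delta> N q \<xi> v \<and> ?lind \<delta> N v \<and> \<not> ?concl N q \<xi> v)"
    for \<delta> and x :: "nat \<times> (nat \<Rightarrow> 'b \<Rightarrow> real) \<times> (nat \<Rightarrow> 'b \<Rightarrow> real) \<times> (nat \<Rightarrow> 'i \<Rightarrow> real)"
  have "\<forall>n. \<exists>x. good (inverse (real (Suc n))) x"
  proof
    fix n
    have "inverse (real (Suc n)) > 0" by simp
    with not obtain N q \<xi> v where "?pw N q" "?cen N q \<xi>" "?bd N \<xi>" "?cov (inverse (real (Suc n))) N q \<xi> v"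
      "?lind (inverse (real (Suc n))) N v" "\<not> ?concl N q \<xi> v" by blast
    then have "good (inverse (real (Suc n))) (N, q, \<xi>, v)" unfolding good_def prod.case by blast
    then show "\<exists>x. good (inverse (real (Suc n))) x" ..
  qed
  from choice[OF this] obtain X where X: "\<And>n. good (inverse (real (Suc n))) (X n)" by blast
  define N q \<xi> v where "N n = fst (X n)" and "q n = fst (snd (X n))" and "\<xi> n = fst (snd (snd (X n)))"
    and "v n = snd (snd (snd (X n)))" for n
  have X': "X n = (N n, q n, \<xi> n, v n)" for n by (simp add: N_def q_def \<xi>_def v_def)
  have pw: "?pw (N n) (q n)" and cen: "?cen (N n) (q n) (\<xi> n)" and bd: "?bd (N n) (\<xi> n)"
    and cov: "?cov (inverse (real (Suc n))) (N n) (q n) (\<xi> n) (v n)"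
    and lind: "?lind (inverse (real (Suc n))) (N n) (v n)" and bad: "\<not> ?concl (N n) (q n) (\<xi> n) (v n)" for n
    using X[of n] unfolding good_def X' prod.case by blast+
  define Cn where "Cn n f g = (\<Sum>i<N n. (\<Sum>b\<in>B. q n i b * (\<xi> n i b)\<^sup>2) * (v n i f * v n i g))" for n f g
  define Ln where "Ln n = (\<Sum>i<N n. (\<Sum>f\<in>J. \<bar>v n i f\<bar>)\<^sup>2 * min 1 (\<Sum>f\<in>J. \<bar>v n i f\<bar>))" for n
  have inv0: "(\<lambda>n. inverse (real (Suc n))) \<longlonglongrightarrow> 0" by (rule LIMSEQ_inverse_real_of_nat)
  have Cn: "(\<lambda>n. Cn n f g) \<longlonglongrightarrow> Cov f g" if "f \<in> J" "g \<in> J" for f g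
  proof (rule LIM_zero_cancel, rule Lim_null_comparison[OF _ inv0])
    show "eventually (\<lambda>n. norm (Cn n f g - Cov f g) \<le> inverse (real (Suc n))) sequentially"
      using cov that unfolding Cn_def by (intro always_eventually) auto
  qed
  have Ln: "Ln \<longlonglongrightarrow> 0"
  proof (rule Lim_null_comparison[OF _ inv0])
    have "0 \<le> Ln n" for n unfolding Ln_def by (intro sum_nonneg mult_nonneg_nonneg) (auto intro: sum_nonneg)
    then show "eventually (\<lambda>n. norm (Ln n) \<le> inverse (real (Suc n))) sequentially"
      using lind unfolding Ln_def[symmetric] by (intro always_eventually) auto
  qed
  define S where "S n = {..<N n} \<rightarrow>\<^sub>E B" for n
  define p where "p n s = (\<Prod>i<N n. q n i (s i))" for n s
  define V where "V n s f = (\<Sum>i<N n. \<xi> n i (s i) * v n i f)" for n s f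
  interpret M: prob_space M by (rule M)
  interpret charfun_convergence M G J S p V
  proof
    show "finite J" by (rule J)
    show "finite (S n)" for n
      unfolding S_def using product_weights.fin[OF pw[of n]] by (intro finite_PiE) auto
    show "0 \<le> p n s" if "s \<in> S n" for n s
      using product_weights.weight_nonneg[OF pw[of n]] that unfolding S_def p_def by blast
    show "(\<Sum>s\<in>S n. p n s) = 1" for n
      using product_weights.prod_exp_const[OF pw[of n], of 1] unfolding S_def p_def prod_exp_def by simp
    show "(\<lambda>\<omega>. G \<omega> f) \<in> borel_measurable M" if "f \<in> J" for f using G that .
    fix a :: "'i \<Rightarrow> real"
    define \<phi> where "\<phi> n = (\<Sum>s\<in>S n. of_real (p n s) * cis (\<Sum>f\<in>J. a f * V n s f))" for n
    define \<psi> where "\<psi> n = complex_of_real (exp (- (\<Sum>f\<in>J. \<Sum>g\<in>J. a f * a g * Cn n f g) / 2))" for n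
    have "\<psi> \<longlonglongrightarrow> of_real (exp (- (\<Sum>f\<in>J. \<Sum>g\<in>J. a f * a g * Cov f g) / 2))"
      unfolding \<psi>_def by (intro tendsto_intros Cn) auto
    moreover have "(\<lambda>n. \<phi> n - \<psi> n) \<longlonglongrightarrow> 0"
    proof (rule Lim_null_comparison)
      have "norm (\<phi> n - \<psi> n) \<le> 2 * C ^ 4 * (1 + (\<Sum>f\<in>J. \<bar>a f\<bar>)) ^ 3 * Ln n" for n
        unfolding \<phi>_def \<psi>_def Ln_def Cn_def S_def p_def V_def using pw[of n] J cen[of n] bd[of n] C
        by (intro weighted_sum_charfun_approx) auto
      then show "eventually (\<lambda>n. norm (\<phi> n - \<psi> n) \<le> 2 * C ^ 4 * (1 + (\<Sum>f\<in>J. \<bar>a f\<bar>)) ^ 3 * Ln n) sequentially"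
        by simp
      show "(\<lambda>n. 2 * C ^ 4 * (1 + (\<Sum>f\<in>J. \<bar>a f\<bar>)) ^ 3 * Ln n) \<longlonglongrightarrow> 0"
        using tendsto_mult_right_zero[OF Ln] .
    qed
    ultimately have "(\<lambda>n. (\<phi> n - \<psi> n) + \<psi> n) \<longlonglongrightarrow> 0 + of_real (exp (- (\<Sum>f\<in>J. \<Sum>g\<in>J. a f * a g * Cov f g) / 2))"
      by (intro tendsto_add)
    then show "(\<lambda>n. \<Sum>s\<in>S n. of_real (p n s) * cis (\<Sum>f\<in>J. a f * V n s f)) \<longlonglongrightarrow> (\<integral>\<omega>. cis (\<Sum>f\<in>J. a f * G \<omega> f) \<partial>M)"
      unfolding gauss \<phi>_def by simp
  qed
  obtain n0 where n0: "\<forall>n\<ge>n0. \<forall>h\<in>coord_BL1 J. (\<lambda>\<omega>. h (G \<omega>)) \<in> borel_measurable M \<longrightarrow>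
      \<bar>(\<Sum>s\<in>S n. p n s * h (V n s)) - (\<integral>\<omega>. h (G \<omega>) \<partial>M)\<bar> \<le> \<epsilon>"
    using uniform_weak_convergence[OF \<epsilon>] by blast
  have "?concl (N n0) (q n0) (\<xi> n0) (v n0)"
    using n0 unfolding prod_exp_def S_def p_def V_def by blast
  with bad[of n0] show False by blast
qed

section \<open>Tight laws on the space of bounded functions\<close>

lemma continuous_map_linf_measurable:
  assumes "continuous_map (linf_topology F) euclideanreal h"
  shows "h \<in> borel_measurable (linf_borel F)"
proof (rule borel_measurableI)
  fix S :: "real set" assume "open S"
  then have "openin (linf_topology F) {z \<in> topspace (linf_topology F). h z \<in> S}"
    using assms by (intro openin_continuous_map_preimage) auto
  moreover have "h -` S \<inter> space (linf_borel F) = {z \<in> topspace (linf_topology F). h z \<in> S}" by auto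
  ultimately show "h -` S \<inter> space (linf_borel F) \<in> sets (linf_borel F)"
    unfolding sets_linf_borel by (auto intro: sigma_sets.Basic)
qed

lemma lipschitz_linf_continuous_map:
  assumes "\<And>z z'. z \<in> linf F \<Longrightarrow> z' \<in> linf F \<Longrightarrow> \<bar>h z - h z'\<bar> \<le> c * linf_dist F z z'" and "c > 0"
  shows "continuous_map (linf_topology F) euclideanreal h"
proof -
  interpret L: Metric_space "linf F" "linf_dist F" by (rule Metric_space_linf)
  have "openin (linf_topology F) {z \<in> linf F. h z \<in> U}" if U: "open U" for U
    unfolding linf_topology_def L.openin_mtopology
  proof (intro conjI allI impI)
    fix z assume z: "z \<in> {z \<in> linf F. h z \<in> U}"
    then obtain e where e: "e > 0" "\<And>y. \<bar>y - h z\<bar> < e \<Longrightarrow> y \<in> U"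
      using U unfolding open_dist by (auto simp: dist_real_def)
    show "\<exists>r>0. L.mball z r \<subseteq> {z \<in> linf F. h z \<in> U}"
    proof (intro exI conjI subsetI)
      show "e / c > 0" using e(1) assms(2) by simp
      fix z' assume z': "z' \<in> L.mball z (e / c)"
      then have "c * linf_dist F z z' < e" using assms(2) by (simp add: field_simps)
      then have "\<bar>h z' - h z\<bar> < e" using assms(1)[of z z'] z z' by (auto simp: abs_minus_commute)
      then show "z' \<in> {z \<in> linf F. h z \<in> U}" using e(2) z' by auto
    qed
  qed auto
  then show ?thesis unfolding continuous_map_def by auto
qed

text \<open>It vanishes within distance r of the finite net \<open>Z\<close>, equals 1 at distance
  2r or more and is linear in the distance to the net in between.\<close>

definition net_bump :: "'i set \<Rightarrow> ('i \<Rightarrow> real) set \<Rightarrow> real \<Rightarrow> ('i \<Rightarrow> real) \<Rightarrow> real" where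
  "net_bump F Z r z = min 1 (max 0 (Min (linf_dist F z ` Z) / r - 1))"

lemma net_bump_bounds: "0 \<le> net_bump F Z r z" "net_bump F Z r z \<le> 1"
  by (auto simp: net_bump_def)

lemma net_bump_continuous_map:
  assumes Z: "finite Z" "Z \<noteq> {}" "Z \<subseteq> linf F" and r: "r > 0"
  shows "continuous_map (linf_topology F) euclideanreal (net_bump F Z r)"
proof (rule lipschitz_linf_continuous_map[where c = "1 / r"])
  have half: "Min (linf_dist F z ` Z) \<le> Min (linf_dist F z' ` Z) + linf_dist F z z'"
    if "z \<in> linf F" "z' \<in> linf F" for z z'
  proof -
    interpret L: Metric_space "linf F" "linf_dist F" by (rule Metric_space_linf)
    have "Min (linf_dist F z' ` Z) \<in> linf_dist F z' ` Z" using Z by (intro Min_in) auto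
    then obtain x where x: "x \<in> Z" "Min (linf_dist F z' ` Z) = linf_dist F z' x" by auto
    have "Min (linf_dist F z ` Z) \<le> linf_dist F z x" using Z x by (intro Min_le) auto
    also have "\<dots> \<le> linf_dist F z z' + linf_dist F z' x" using that x Z by (intro L.triangle) auto
    finally show ?thesis using x by simp
  qed
  fix z z' assume z: "z \<in> linf F" "z' \<in> linf F"
  have "linf_dist F z' z = linf_dist F z z'" using Metric_space.commute[OF Metric_space_linf] by metis
  then have "\<bar>Min (linf_dist F z ` Z) - Min (linf_dist F z' ` Z)\<bar> \<le> linf_dist F z z'"
    using half[OF z] half[OF z(2,1)] by linarith
  then have "\<bar>Min (linf_dist F z ` Z) / r - Min (linf_dist F z' ` Z) / r\<bar> \<le> linf_dist F z z' / r"
    using r by (simp add: diff_divide_distrib[symmetric] abs_divide divide_right_mono)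
  moreover have "\<bar>min 1 (max 0 (x - 1)) - min 1 (max 0 (y - 1))\<bar> \<le> \<bar>x - y\<bar>" for x y :: real
    by (auto simp: min_def max_def)
  then have "\<bar>net_bump F Z r z - net_bump F Z r z'\<bar>
      \<le> \<bar>Min (linf_dist F z ` Z) / r - Min (linf_dist F z' ` Z) / r\<bar>"
    unfolding net_bump_def .
  ultimately show "\<bar>net_bump F Z r z - net_bump F Z r z'\<bar> \<le> 1 / r * linf_dist F z z'" by simp
qed (use r in simp)

text \<open>The labelling \<open>c\<close> encodes a finite partition of the index set.  The function \<open>b\<close> is a continuous
  majorant of the indicator of those \<open>z\<close> that oscillate by more than \<open>r\<close> over some cell, which makes weak
  convergence applicable to it.\<close>

lemma tight_finite_partition:
  fixes L :: "('i \<Rightarrow> real) measure"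
  assumes L: "prob_space L" "sets L = sets (linf_borel F)" "tight_measure_on (linf_topology F) L"
    and r: "r > 0" and e: "e > 0"
  obtains b :: "('i \<Rightarrow> real) \<Rightarrow> real" and c :: "'i \<Rightarrow> ('i \<Rightarrow> real) \<Rightarrow> int"
  where "finite (c ` F)" "continuous_map (linf_topology F) euclideanreal b" "integral\<^sup>L L b \<le> e"
    "\<And>z. 0 \<le> b z" "\<And>z. b z \<le> 1"
    "\<And>z f g. z \<in> linf F \<Longrightarrow> b z < 1 \<Longrightarrow> f \<in> F \<Longrightarrow> g \<in> F \<Longrightarrow> c f = c g \<Longrightarrow> \<bar>z f - z g\<bar> \<le> r"
    "\<And>f. f \<in> F \<Longrightarrow> \<exists>t>0. \<forall>z\<in>linf F. b z < 1 \<longrightarrow> \<bar>z f\<bar> \<le> t"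
proof -
  interpret L: prob_space L by fact
  interpret Met: Metric_space "linf F" "linf_dist F" by (rule Metric_space_linf)
  \<comment> \<open>If b z < 1, some net point lies within 2d of z, and it varies by at most d over
    a cell: 2d + d + 2d = r.\<close>
  define d where "d = r / 5"
  have d: "d > 0" using r by (simp add: d_def)
  obtain K where K: "compactin (linf_topology F) K" "K \<in> sets L" "measure L K \<ge> 1 - e"
    using L(3) e unfolding tight_measure_on_def by blast
  have "Met.mtotally_bounded K"
    using K(1) Met.compactin_imp_mtotally_bounded unfolding linf_topology_def by blast
  then have "\<exists>K'. finite K' \<and> K' \<subseteq> K \<and> K \<subseteq> (\<Union>x\<in>K'. Met.mball x d)"
    using d unfolding Met.mtotally_bounded_def by simp
  then obtain Z0 where Z0: "finite Z0" "Z0 \<subseteq> K" "K \<subseteq> (\<Union>x\<in>Z0. Met.mball x d)"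
    by (elim exE conjE)
  \<comment> \<open>The zero function keeps the net nonempty, so that \<open>Min\<close> is
    meaningful even if \<open>K\<close> is empty.\<close>
  define Z where "Z = insert (\<lambda>f\<in>F. 0) Z0"
  have KF: "K \<subseteq> linf F" using compactin_subset_topspace[OF K(1)] by simp
  have "bounded ((\<lambda>f\<in>F. 0 :: real) ` F)" by (rule bounded_subset[of "{0}"]) auto
  then have "(\<lambda>f\<in>F. 0) \<in> linf F" by (simp add: linf_def)
  then have Z: "finite Z" "Z \<noteq> {}" "Z \<subseteq> linf F" using Z0 KF by (auto simp: Z_def)
  define b where "b = net_bump F Z d"
  \<comment> \<open>The label of f records the values at f of all net points, rounded to multiples
    of d. The net points are bounded functions, so only finitely many labels occur.\<close>
  define c where "c f = (\<lambda>z\<in>Z. \<lfloor>z f / d\<rfloor>)" for f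
  have close: "\<exists>x\<in>Z. linf_dist F z x < 2 * d" if "b z < 1" for z
  proof -
    have "Min (linf_dist F z ` Z) \<in> linf_dist F z ` Z" using Z by (intro Min_in) auto
    then obtain x where x: "x \<in> Z" "Min (linf_dist F z ` Z) = linf_dist F z x" by auto
    have "linf_dist F z x / d - 1 < 1" using that x unfolding b_def net_bump_def by auto
    then show ?thesis using x d by (intro bexI[of _ x]) (simp_all add: field_simps)
  qed
  show ?thesis
  proof (rule that[of c b])
    have "c ` F \<subseteq> Z \<rightarrow>\<^sub>E (\<Union>z\<in>Z. (\<lambda>f. \<lfloor>z f / d\<rfloor>) ` F)" by (auto simp: c_def)
    moreover have "finite ((\<lambda>f. \<lfloor>z f / d\<rfloor>) ` F)" if z: "z \<in> Z" for z
    proof -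
      have "z \<in> linf F" using z Z(3) by blast
      then obtain t where t: "\<And>f. f \<in> F \<Longrightarrow> \<bar>z f\<bar> \<le> t"
        unfolding linf_def bounded_iff by auto
      have "(\<lambda>f. \<lfloor>z f / d\<rfloor>) ` F \<subseteq> {\<lfloor>- t / d\<rfloor>..\<lfloor>t / d\<rfloor>}"
      proof clarify
        fix f assume "f \<in> F"
        then have "- t \<le> z f" "z f \<le> t" using t[of f] by linarith+
        then have "- t / d \<le> z f / d" "z f / d \<le> t / d"
          using d by (meson divide_right_mono less_imp_le)+
        then show "\<lfloor>z f / d\<rfloor> \<in> {\<lfloor>- t / d\<rfloor>..\<lfloor>t / d\<rfloor>}" by (auto intro: floor_mono)
      qed
      then show ?thesis using finite_subset by blast
    qed
    ultimately show "finite (c ` F)"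
      using Z(1) by (meson finite_PiE finite_UN finite_subset)
    show "continuous_map (linf_topology F) euclideanreal b"
      unfolding b_def using Z d by (rule net_bump_continuous_map)
    then have bm: "b \<in> borel_measurable L"
      using continuous_map_linf_measurable[of F b] measurable_cong_sets[OF L(2) refl] by blast
    show b01: "0 \<le> b z" "b z \<le> 1" for z unfolding b_def by (rule net_bump_bounds)+
    have bK: "b z = 0" if zK: "z \<in> K" for z
    proof -
      obtain x where x: "x \<in> Z0" "z \<in> Met.mball x d" using Z0(3) zK by blast
      then have "linf_dist F z x < d" using Met.commute by auto
      moreover have "Min (linf_dist F z ` Z) \<le> linf_dist F z x" using Z x by (intro Min_le) (auto simp: Z_def)
      ultimately have "Min (linf_dist F z ` Z) / d - 1 \<le> 0" using d by simp
      then show ?thesis by (simp add: b_def net_bump_def)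
    qed
    have "integral\<^sup>L L b \<le> (\<integral>z. 1 - indicator K z \<partial>L)"
    proof (rule integral_mono)
      show "integrable L b" using bm b01 by (intro L.integrable_const_bound[where B = 1]) auto
      show "integrable L (\<lambda>z. 1 - indicator K z :: real)" using K(2) by (simp add: L.emeasure_eq_measure)
      show "b z \<le> 1 - indicator K z" for z using bK b01 by (cases "z \<in> K") auto
    qed
    also have "\<dots> = 1 - measure L K" using K(2) by (simp add: L.emeasure_eq_measure L.prob_space)
    finally show "integral\<^sup>L L b \<le> e" using K(3) by simp
    show "\<bar>z f - z g\<bar> \<le> r" if z: "z \<in> linf F" "b z < 1" and fg: "f \<in> F" "g \<in> F" "c f = c g" for z f g
    proof -
      obtain x where x: "x \<in> Z" "linf_dist F z x < 2 * d" using close z(2) by blast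
      have xl: "x \<in> linf F" using x Z by blast
      have "\<lfloor>x f / d\<rfloor> = \<lfloor>x g / d\<rfloor>" using fun_cong[OF fg(3), of x] x(1) by (simp add: c_def)
      then have "\<bar>x f / d - x g / d\<bar> \<le> 1" by linarith
      then have "\<bar>(x f - x g) / d\<bar> \<le> 1" by (simp add: diff_divide_distrib)
      then have "\<bar>x f - x g\<bar> \<le> d" using d by (simp add: abs_divide)
      then show ?thesis
        using linf_dist_upper[OF z(1) xl fg(1)] linf_dist_upper[OF z(1) xl fg(2)] x(2) unfolding d_def by linarith
    qed
    show "\<exists>t>0. \<forall>z\<in>linf F. b z < 1 \<longrightarrow> \<bar>z f\<bar> \<le> t" if f: "f \<in> F" for f
    proof (intro exI conjI ballI impI)
      have nn: "0 \<le> (\<Sum>x\<in>Z. \<bar>x f\<bar>)" by (rule sum_nonneg) simp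
      then show "(\<Sum>x\<in>Z. \<bar>x f\<bar>) + 2 * d > 0" using d by linarith
      fix z assume z: "z \<in> linf F" "b z < 1"
      obtain x where x: "x \<in> Z" "linf_dist F z x < 2 * d" using close z(2) by blast
      have "\<bar>x f\<bar> \<le> (\<Sum>x\<in>Z. \<bar>x f\<bar>)" using Z x(1) by (intro member_le_sum) auto
      then show "\<bar>z f\<bar> \<le> (\<Sum>x\<in>Z. \<bar>x f\<bar>) + 2 * d"
        using linf_dist_upper[OF z(1) _ f, of x] x Z by force
    qed
  qed
qed

text \<open>Sums over this class are the increments of the unnormalized empirical process within the
  cells of the labelling c.\<close>

definition osc_class :: "'z measure \<Rightarrow> ('z \<Rightarrow> real) set \<Rightarrow> (('z \<Rightarrow> real) \<Rightarrow> 'l) \<Rightarrow> ('z \<Rightarrow> real) set" where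
  "osc_class Q H c = {\<lambda>z. (g z - integral\<^sup>L Q g) - (g' z - integral\<^sup>L Q g') |g g'. g \<in> H \<and> g' \<in> H \<and> c g = c g'}"

text \<open>The continuous bump has integral at most e / 2 under the tight limit, so its outer
  expectation along the empirical process is eventually below e. Wherever the bump is less than 1,
  the path oscillates little within cells and each coordinate is bounded. The second conclusion
  serves to derive second moments.\<close>

lemma Donsker_class_tails:
  fixes Q :: "'z measure"
  assumes Q: "prob_space Q" and D: "Donsker_class Q H" and r: "r > 0" and e: "e > 0"
  shows "\<exists>c :: ('z \<Rightarrow> real) \<Rightarrow> (('z \<Rightarrow> real) \<Rightarrow> real) \<Rightarrow> int. finite (c ` H) \<and> (\<exists>N0. \<forall>m\<ge>N0.
      outer_prob (\<Pi>\<^sub>M i\<in>UNIV. Q) {z \<in> space (\<Pi>\<^sub>M i\<in>(UNIV :: nat set). Q).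
        \<exists>k\<in>osc_class Q H c. \<bar>\<Sum>i<m. k (z i)\<bar> > r * sqrt (real m)} < e)" (is ?th1)
    and "g \<in> H \<Longrightarrow> \<exists>t>0. \<exists>N0. \<forall>m\<ge>N0.
      outer_prob (\<Pi>\<^sub>M i\<in>UNIV. Q) {z \<in> space (\<Pi>\<^sub>M i\<in>(UNIV :: nat set). Q).
        \<bar>\<Sum>i<m. g (z i) - integral\<^sup>L Q g\<bar> > t * sqrt (real m)} < e" (is "_ \<Longrightarrow> ?th2")
proof -
  let ?P = "\<Pi>\<^sub>M i\<in>(UNIV :: nat set). Q"
  interpret Q: prob_space Q by fact
  interpret P: prob_space ?P by (intro prob_space_PiM) (rule Q)
  obtain L where L: "prob_space L" "sets L = sets (linf_borel H)" "tight_measure_on (linf_topology H) L"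
      "weakly_converges_linf ?P H (empirical_process Q H) L"
    and bd: "\<And>z. z \<in> space Q \<Longrightarrow> bounded ((\<lambda>f. f z - integral\<^sup>L Q f) ` H)"
    using D unfolding Donsker_class_def by blast
  have half: "e / 2 > 0" using e by simp
  obtain b :: "(('z \<Rightarrow> real) \<Rightarrow> real) \<Rightarrow> real" and c :: "('z \<Rightarrow> real) \<Rightarrow> (('z \<Rightarrow> real) \<Rightarrow> real) \<Rightarrow> int"
    where bc: "finite (c ` H)" "continuous_map (linf_topology H) euclideanreal b" "integral\<^sup>L L b \<le> e / 2"
      "\<And>z. 0 \<le> b z" "\<And>z. b z \<le> 1"
      "\<And>z f g. z \<in> linf H \<Longrightarrow> b z < 1 \<Longrightarrow> f \<in> H \<Longrightarrow> g \<in> H \<Longrightarrow> c f = c g \<Longrightarrow> \<bar>z f - z g\<bar> \<le> r"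
      "\<And>f. f \<in> H \<Longrightarrow> \<exists>t>0. \<forall>z\<in>linf H. b z < 1 \<longrightarrow> \<bar>z f\<bar> \<le> t"
    by (rule tight_finite_partition[OF L(1,2,3) r half]) (rule that; assumption)
  have "bounded (b ` linf H)" using bc(4,5) unfolding bounded_iff by (intro exI[of _ 1]) auto
  then have "(\<lambda>N. outer_expectation ?P (\<lambda>z. b (empirical_process Q H N z))) \<longlonglongrightarrow> integral\<^sup>L L b"
    using L(4) bc(2) unfolding weakly_converges_linf_def by blast
  then have "eventually (\<lambda>N. outer_expectation ?P (\<lambda>z. b (empirical_process Q H N z)) < e) sequentially"
    by (rule order_tendstoD) (use bc(3) e in simp)
  then obtain N1 where N1: "\<And>m. m \<ge> N1 \<Longrightarrow> outer_expectation ?P (\<lambda>z. b (empirical_process Q H m z)) < e"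
    unfolding eventually_sequentially by blast
  have small: "outer_prob ?P A < e" if "m \<ge> N1" "A \<subseteq> {z \<in> space ?P. b (empirical_process Q H m z) = 1}" for A m
  proof -
    have "outer_prob ?P A \<le> outer_expectation ?P (\<lambda>z. b (empirical_process Q H m z))"
      using that(2) bc(4,5) by (intro outer_prob_le_outer_expectation P.prob_space_axioms) auto
    then show ?thesis using N1[OF that(1)] by linarith
  qed
  have emp: "empirical_process Q H m z \<in> linf H" if z: "z \<in> space ?P" for m z
  proof -
    have "bounded ((\<lambda>f. \<Sum>i<n. f (z i) - integral\<^sup>L Q f) ` H)" for n
    proof (induction n)
      case (Suc n)
      have "z n \<in> space Q" using z by (auto simp: space_PiM)
      then show ?case using bounded_plus_comp[OF Suc bd] by simp
    qed (auto simp: bounded_iff)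
    then have "bounded ((\<lambda>f. (1 / sqrt (real m)) * (\<Sum>i<m. f (z i) - integral\<^sup>L Q f)) ` H)"
      using bounded_scaling[of "(\<lambda>f. \<Sum>i<m. f (z i) - integral\<^sup>L Q f) ` H" "1 / sqrt (real m)"]
      by (simp add: image_image)
    then show ?thesis unfolding linf_def empirical_process_def by (simp add: restrict_extensional)
  qed
  have scale: "t < \<bar>(1 / sqrt (real m)) * x\<bar>" if "m \<ge> 1" "\<bar>x\<bar> > t * sqrt (real m)" for t x :: real and m :: nat
  proof -
    have "sqrt (real m) > 0" using that(1) by simp
    then show ?thesis using that(2) by (simp add: abs_mult field_simps)
  qed
  show ?th1
  proof (intro exI[of _ c] conjI exI[of _ "Suc N1"] allI impI bc(1))
    fix m assume m: "m \<ge> Suc N1"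
    show "outer_prob ?P {z \<in> space ?P. \<exists>k\<in>osc_class Q H c. \<bar>\<Sum>i<m. k (z i)\<bar> > r * sqrt (real m)} < e"
    proof (rule small)
      show "{z \<in> space ?P. \<exists>k\<in>osc_class Q H c. \<bar>\<Sum>i<m. k (z i)\<bar> > r * sqrt (real m)}
        \<subseteq> {z \<in> space ?P. b (empirical_process Q H m z) = 1}"
      proof safe
        fix z k assume z: "z \<in> space ?P" and "k \<in> osc_class Q H c" and big: "\<bar>\<Sum>i<m. k (z i)\<bar> > r * sqrt (real m)"
        then obtain g g' where g: "g \<in> H" "g' \<in> H" "c g = c g'"
          and k: "k = (\<lambda>z. (g z - integral\<^sup>L Q g) - (g' z - integral\<^sup>L Q g'))" unfolding osc_class_def by blast
        have "empirical_process Q H m z g - empirical_process Q H m z g' = (1 / sqrt (real m)) * (\<Sum>i<m. k (z i))"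
          using g by (simp add: empirical_process_def k sum_subtractf right_diff_distrib diff_divide_distrib)
        then have "r < \<bar>empirical_process Q H m z g - empirical_process Q H m z g'\<bar>"
          using scale[OF _ big] m by simp
        then have "\<not> b (empirical_process Q H m z) < 1" using bc(6)[OF emp[OF z] _ g] by fastforce
        then show "b (empirical_process Q H m z) = 1" using bc(5) by (simp add: order_antisym)
      qed
    qed (use m in simp)
  qed
  show ?th2 if g: "g \<in> H"
  proof -
    obtain t where t: "t > 0" "\<forall>z\<in>linf H. b z < 1 \<longrightarrow> \<bar>z g\<bar> \<le> t" using bc(7)[OF g] by blast
    show ?thesis
    proof (intro exI[of _ t] conjI exI[of _ "Suc N1"] allI impI t(1))
      fix m assume m: "m \<ge> Suc N1"
      show "outer_prob ?P {z \<in> space ?P. \<bar>\<Sum>i<m. g (z i) - integral\<^sup>L Q g\<bar> > t * sqrt (real m)} < e"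
      proof (rule small)
        show "{z \<in> space ?P. \<bar>\<Sum>i<m. g (z i) - integral\<^sup>L Q g\<bar> > t * sqrt (real m)}
          \<subseteq> {z \<in> space ?P. b (empirical_process Q H m z) = 1}"
        proof safe
          fix z assume z: "z \<in> space ?P" and big: "\<bar>\<Sum>i<m. g (z i) - integral\<^sup>L Q g\<bar> > t * sqrt (real m)"
          have "t < \<bar>empirical_process Q H m z g\<bar>"
            using scale[OF _ big] m g by (simp add: empirical_process_def)
          then have "\<not> b (empirical_process Q H m z) < 1" using t(2) emp[OF z] by fastforce
          then show "b (empirical_process Q H m z) = 1" using bc(5) by (simp add: order_antisym)
        qed
      qed (use m in simp)
    qed
  qed
qed

section \<open>Weak law of large numbers and square integrability\<close>

context prob_space
begin

abbreviation sequence_space :: "(nat \<Rightarrow> 'a) measure" where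
  "sequence_space \<equiv> \<Pi>\<^sub>M i\<in>(UNIV :: nat set). M"

lemma prob_space_sequence_space: "prob_space sequence_space"
  by (intro prob_space_PiM prob_space_axioms)

lemma sequence_component_measurable [measurable]: "(\<lambda>z. z i) \<in> measurable sequence_space M"
  by (rule measurable_component_singleton) simp

lemma distr_sequence_component: "distr sequence_space M (\<lambda>z. z i) = M"
  by (intro distr_PiM_component prob_space_axioms) simp

lemma integral_sequence_component:
  fixes \<phi> :: "'a \<Rightarrow> real"
  assumes "\<phi> \<in> borel_measurable M"
  shows "(\<integral>z. \<phi> (z i) \<partial>sequence_space) = integral\<^sup>L M \<phi>"
  using integral_distr[OF sequence_component_measurable assms, of i] distr_sequence_component by simp

lemma integrable_sequence_component:
  fixes \<phi> :: "'a \<Rightarrow> real"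
  assumes "integrable M \<phi>"
  shows "integrable sequence_space (\<lambda>z. \<phi> (z i))"
  using integrable_distr[OF sequence_component_measurable, of i \<phi>] distr_sequence_component assms by simp

lemma indep_vars_sequence:
  assumes "\<phi> \<in> borel_measurable M"
  shows "prob_space.indep_vars sequence_space (\<lambda>_. borel) (\<lambda>i z. \<phi> (z i)) {..<N}"
proof (cases "N = 0")
  case False
  interpret S: prob_space sequence_space by (rule prob_space_sequence_space)
  have "distr sequence_space (\<Pi>\<^sub>M i\<in>{..<N}. M) (\<lambda>z. \<lambda>i\<in>{..<N}. z i) = (\<Pi>\<^sub>M i\<in>{..<N}. distr sequence_space M (\<lambda>z. z i))"
    using distr_PiM_reindex[of UNIV "\<lambda>_. M" "\<lambda>i. i" "{..<N}"] prob_space_axioms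
    by (simp add: distr_sequence_component)
  then have "S.indep_vars (\<lambda>_. M) (\<lambda>i z. z i) {..<N}"
    using False by (subst S.indep_vars_iff_distr_eq_PiM') auto
  then show ?thesis by (rule S.indep_vars_compose2) (use assms in simp)
next
  case True
  interpret S: prob_space sequence_space by (rule prob_space_sequence_space)
  show ?thesis using True by (simp add: S.indep_vars_def S.indep_sets_def)
qed

lemma weak_law_bounded:
  fixes \<phi> :: "'a \<Rightarrow> real"
  assumes \<phi>: "\<phi> \<in> borel_measurable M" and B: "\<And>x. \<bar>\<phi> x\<bar> \<le> B" and \<epsilon>: "\<epsilon> > 0"
  shows "(\<lambda>N. measure sequence_space {z \<in> space sequence_space. \<bar>(\<Sum>i<N. \<phi> (z i)) / real N - integral\<^sup>L M \<phi>\<bar> > \<epsilon>})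
    \<longlonglongrightarrow> 0"
proof (rule Lim_null_comparison)
  interpret S: prob_space sequence_space by (rule prob_space_sequence_space)
  \<comment> \<open>The added 1 keeps the interval nondegenerate when B = 0, so that the exponent
    below has a positive rate.\<close>
  let ?B = "\<bar>B\<bar> + 1"
  note [measurable] = \<phi>
  have bound: "measure sequence_space {z \<in> space sequence_space. \<bar>(\<Sum>i<N. \<phi> (z i)) / real N - integral\<^sup>L M \<phi>\<bar> > \<epsilon>}
      \<le> 2 * exp (- 2 * real N * \<epsilon>\<^sup>2 / (?B - (- ?B))\<^sup>2)" if N: "N \<ge> 1" for N
  proof -
    interpret H: Hoeffding_ineq_iid sequence_space "{..<N}" "\<lambda>i z. \<phi> (z i)" "\<lambda>z. \<phi> (z 0)" "- ?B" ?B "integral\<^sup>L M \<phi>"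
    proof unfold_locales
      show "S.indep_vars (\<lambda>_. borel) (\<lambda>i z. \<phi> (z i)) {..<N}" using \<phi> by (rule indep_vars_sequence)
      have "distr sequence_space borel (\<lambda>z. \<phi> (z i)) = distr M borel \<phi>" for i
        using distr_distr[OF \<phi> sequence_component_measurable, of i] distr_sequence_component
        by (simp add: comp_def)
      then show "distr sequence_space borel (\<lambda>z. \<phi> (z i)) = distr sequence_space borel (\<lambda>z. \<phi> (z 0))" for i
        by simp
      have "\<phi> x \<in> {- ?B..?B}" for x using B[of x] by (auto simp: abs_le_iff)
      then show "AE z in sequence_space. \<phi> (z 0) \<in> {- ?B..?B}" by simp
      show "integral\<^sup>L M \<phi> \<equiv> S.expectation (\<lambda>z. \<phi> (z 0))"
        using integral_sequence_component[OF \<phi>, of 0] by (intro eq_reflection) simp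
    qed auto
    have "measure sequence_space {z \<in> space sequence_space. \<bar>(\<Sum>i<N. \<phi> (z i)) / real N - integral\<^sup>L M \<phi>\<bar> > \<epsilon>}
      \<le> measure sequence_space {z \<in> space sequence_space. \<bar>(\<Sum>i<N. \<phi> (z i)) / real N - integral\<^sup>L M \<phi>\<bar> \<ge> \<epsilon>}"
      by (intro S.finite_measure_mono) auto
    also have "\<dots> \<le> 2 * exp (- 2 * real N * \<epsilon>\<^sup>2 / (?B - (- ?B))\<^sup>2)"
      using H.Hoeffding_ineq_abs_ge'[of \<epsilon>] \<epsilon> N by (simp add: lessThan_empty_iff)
    finally show ?thesis .
  qed
  then show "eventually (\<lambda>N. norm (measure sequence_space {z \<in> space sequence_space.
      \<bar>(\<Sum>i<N. \<phi> (z i)) / real N - integral\<^sup>L M \<phi>\<bar> > \<epsilon>}) \<le> 2 * exp (- 2 * real N * \<epsilon>\<^sup>2 / (?B - (- ?B))\<^sup>2)) sequentially"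
    by (intro eventually_sequentiallyI[of 1]) simp
  define c where "c = 2 * \<epsilon>\<^sup>2 / (?B - (- ?B))\<^sup>2"
  have "c > 0" using \<epsilon> unfolding c_def by (intro divide_pos_pos) (auto simp: zero_less_power2)
  then have "filterlim (\<lambda>N. c * real N) at_top sequentially"
    by (intro filterlim_tendsto_pos_mult_at_top[OF tendsto_const] filterlim_real_sequentially)
  then have "(\<lambda>N. exp (- (c * real N))) \<longlonglongrightarrow> 0"
    by (intro filterlim_compose[OF exp_at_bot]) (simp add: filterlim_uminus_at_bot)
  then have "(\<lambda>N. 2 * exp (- (c * real N))) \<longlonglongrightarrow> 0" by (rule tendsto_mult_right_zero)
  then show "(\<lambda>N. 2 * exp (- 2 * real N * \<epsilon>\<^sup>2 / (?B - (- ?B))\<^sup>2)) \<longlonglongrightarrow> 0"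
    by (simp add: c_def mult_ac)
qed

lemma average_markov:
  fixes \<psi> :: "'a \<Rightarrow> real"
  assumes \<psi>: "integrable M \<psi>" "\<And>x. 0 \<le> \<psi> x" and a: "a > 0"
  shows "measure sequence_space {z \<in> space sequence_space. (\<Sum>i<N. \<psi> (z i)) / real N \<ge> a} \<le> integral\<^sup>L M \<psi> / a"
proof -
  interpret S: prob_space sequence_space by (rule prob_space_sequence_space)
  have int: "integrable sequence_space (\<lambda>z. (\<Sum>i<N. \<psi> (z i)) / real N)"
    using \<psi> integrable_sequence_component by simp
  have "measure sequence_space {z \<in> space sequence_space. a \<le> (\<Sum>i<N. \<psi> (z i)) / real N}
      \<le> (\<integral>z. (\<Sum>i<N. \<psi> (z i)) / real N \<partial>sequence_space) / a"
    using int \<psi>(2) a by (intro integral_Markov_inequality_measure[where A = "{}"]) (auto intro!: divide_nonneg_nonneg sum_nonneg)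
  also have "(\<integral>z. (\<Sum>i<N. \<psi> (z i)) / real N \<partial>sequence_space) = real N * integral\<^sup>L M \<psi> / real N"
    using \<psi> integrable_sequence_component[OF \<psi>(1)]
    by (simp add: Bochner_Integration.integral_sum integral_sequence_component)
  also have "\<dots> \<le> integral\<^sup>L M \<psi>" using \<psi>(2) by simp
  finally show ?thesis using a by (simp add: divide_right_mono)
qed

text \<open>Truncation at a level K: the bounded part obeys Hoeffding's inequality, and Markov's
  inequality handles the average of the remainder, which is small in mean. First moments are
  enough.\<close>

lemma weak_law:
  fixes \<phi> :: "'a \<Rightarrow> real"
  assumes \<phi>: "integrable M \<phi>" and \<epsilon>: "\<epsilon> > 0"
  shows "(\<lambda>N. measure sequence_space {z \<in> space sequence_space. \<bar>(\<Sum>i<N. \<phi> (z i)) / real N - integral\<^sup>L M \<phi>\<bar> > \<epsilon>})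
    \<longlonglongrightarrow> 0"
proof (rule LIMSEQ_I)
  fix e :: real assume e: "e > 0"
  interpret S: prob_space sequence_space by (rule prob_space_sequence_space)
  have \<phi>m [measurable]: "\<phi> \<in> borel_measurable M" using \<phi> by simp
  define tr where "tr K x = (if \<bar>\<phi> x\<bar> \<le> real K then \<phi> x else 0)" for K x
  have trm [measurable]: "tr K \<in> borel_measurable M" for K unfolding tr_def by measurable
  have tr_int: "integrable M (tr K)" for K
    by (rule Bochner_Integration.integrable_bound[OF \<phi>]) (auto simp: tr_def)
  have "(\<lambda>K. \<integral>x. \<bar>\<phi> x - tr K x\<bar> \<partial>M) \<longlonglongrightarrow> (\<integral>x. 0 \<partial>M)"
  proof (rule integral_dominated_convergence[where w = "\<lambda>x. \<bar>\<phi> x\<bar>"])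
    show "AE x in M. (\<lambda>K. \<bar>\<phi> x - tr K x\<bar>) \<longlonglongrightarrow> 0"
    proof (rule AE_I2, rule tendsto_eventually)
      fix x
      obtain K0 :: nat where "\<bar>\<phi> x\<bar> \<le> real K0" using real_arch_simple by blast
      then show "eventually (\<lambda>K. \<bar>\<phi> x - tr K x\<bar> = 0) sequentially"
        by (intro eventually_sequentiallyI[of K0]) (auto simp: tr_def)
    qed
  qed (use \<phi> in \<open>auto simp: tr_def\<close>)
  then have lim0: "(\<lambda>K. \<integral>x. \<bar>\<phi> x - tr K x\<bar> \<partial>M) \<longlonglongrightarrow> 0" by simp
  \<comment> \<open>The first term keeps the truncated mean within \<epsilon> / 3 of the true one;
    the second makes the Markov bound for the remainder at most e / 3.\<close>
  define d where "d = min (\<epsilon> / 3) (\<epsilon> / 3 * (e / 3))"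
  have "d > 0" using \<epsilon> e by (simp add: d_def)
  then have "eventually (\<lambda>K. (\<integral>x. \<bar>\<phi> x - tr K x\<bar> \<partial>M) < d) sequentially"
    using lim0 by (intro order_tendstoD)
  then obtain K where K: "(\<integral>x. \<bar>\<phi> x - tr K x\<bar> \<partial>M) < d" using eventually_happens by fastforce
  have "\<bar>tr K x\<bar> \<le> real K" for x by (simp add: tr_def)
  then have "(\<lambda>N. measure sequence_space {z \<in> space sequence_space. \<bar>(\<Sum>i<N. tr K (z i)) / real N - integral\<^sup>L M (tr K)\<bar> > \<epsilon> / 3})
      \<longlonglongrightarrow> 0" using \<epsilon> by (intro weak_law_bounded) auto
  then have "eventually (\<lambda>N. measure sequence_space {z \<in> space sequence_space.
      \<bar>(\<Sum>i<N. tr K (z i)) / real N - integral\<^sup>L M (tr K)\<bar> > \<epsilon> / 3} < e / 3) sequentially"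
    using e by (intro order_tendstoD) auto
  then obtain N0 where N0: "\<And>N. N \<ge> N0 \<Longrightarrow> measure sequence_space {z \<in> space sequence_space.
      \<bar>(\<Sum>i<N. tr K (z i)) / real N - integral\<^sup>L M (tr K)\<bar> > \<epsilon> / 3} < e / 3"
    unfolding eventually_sequentially by blast
  have mean: "\<bar>integral\<^sup>L M (tr K) - integral\<^sup>L M \<phi>\<bar> < \<epsilon> / 3"
  proof -
    have "\<bar>integral\<^sup>L M (tr K) - integral\<^sup>L M \<phi>\<bar> = \<bar>\<integral>x. \<phi> x - tr K x \<partial>M\<bar>"
      using \<phi> tr_int by (simp add: abs_minus_commute)
    also have "\<dots> \<le> (\<integral>x. \<bar>\<phi> x - tr K x\<bar> \<partial>M)" by (rule integral_abs_bound)
    finally show ?thesis using K by (simp add: d_def)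
  qed
  show "\<exists>no. \<forall>N\<ge>no. norm (measure sequence_space {z \<in> space sequence_space.
      \<bar>(\<Sum>i<N. \<phi> (z i)) / real N - integral\<^sup>L M \<phi>\<bar> > \<epsilon>} - 0) < e"
  proof (intro exI[of _ N0] allI impI)
    fix N assume N: "N \<ge> N0"
    let ?A = "{z \<in> space sequence_space. \<bar>(\<Sum>i<N. tr K (z i)) / real N - integral\<^sup>L M (tr K)\<bar> > \<epsilon> / 3}"
    let ?B = "{z \<in> space sequence_space. (\<Sum>i<N. \<bar>\<phi> (z i) - tr K (z i)\<bar>) / real N \<ge> \<epsilon> / 3}"
    have "measure sequence_space {z \<in> space sequence_space. \<bar>(\<Sum>i<N. \<phi> (z i)) / real N - integral\<^sup>L M \<phi>\<bar> > \<epsilon>}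
        \<le> measure sequence_space (?A \<union> ?B)"
    proof (rule S.finite_measure_mono)
      show "{z \<in> space sequence_space. \<bar>(\<Sum>i<N. \<phi> (z i)) / real N - integral\<^sup>L M \<phi>\<bar> > \<epsilon>} \<subseteq> ?A \<union> ?B"
      proof safe
        fix z
        assume z: "\<bar>(\<Sum>i<N. \<phi> (z i)) / real N - integral\<^sup>L M \<phi>\<bar> > \<epsilon>" "z \<in> space sequence_space"
          and nB: "\<not> (\<Sum>i<N. \<bar>\<phi> (z i) - tr K (z i)\<bar>) / real N \<ge> \<epsilon> / 3"
        have "\<bar>(\<Sum>i<N. \<phi> (z i)) / real N - (\<Sum>i<N. tr K (z i)) / real N\<bar> \<le> (\<Sum>i<N. \<bar>\<phi> (z i) - tr K (z i)\<bar>) / real N"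
          unfolding diff_divide_distrib[symmetric] sum_subtractf[symmetric] abs_divide
          by (simp add: divide_right_mono sum_abs)
        then show "\<bar>(\<Sum>i<N. tr K (z i)) / real N - integral\<^sup>L M (tr K)\<bar> > \<epsilon> / 3"
          using z nB mean by linarith
      qed
    qed measurable
    also have "\<dots> \<le> measure sequence_space ?A + measure sequence_space ?B"
      by (rule measure_Un_le) measurable
    also have "measure sequence_space ?B \<le> (\<integral>x. \<bar>\<phi> x - tr K x\<bar> \<partial>M) / (\<epsilon> / 3)"
      using \<phi> tr_int \<epsilon> by (intro average_markov) auto
    also have "\<dots> \<le> e / 3" using K \<epsilon> by (simp add: d_def field_simps)
    finally show "norm (measure sequence_space {z \<in> space sequence_space.
      \<bar>(\<Sum>i<N. \<phi> (z i)) / real N - integral\<^sup>L M \<phi>\<bar> > \<epsilon>} - 0) < e" using N0[OF N] e by simp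
  qed
qed

text \<open>Converse of the central limit theorem: a bounded-in-probability normalized sum gives, by
  symmetrization and the Paley--Zygmund bound, a bounded empirical second moment.\<close>

lemma square_integrable_if_tight_sums:
  fixes k :: "'a \<Rightarrow> real"
  assumes [measurable]: "k \<in> borel_measurable M" and t: "t > 0"
    and tight: "\<And>m. m \<ge> N0 \<Longrightarrow> outer_prob sequence_space
        {z \<in> space sequence_space. \<bar>\<Sum>i<m. k (z i)\<bar> > t * sqrt (real m)} < 1 / 96"
  shows "integrable M (\<lambda>x. (k x)\<^sup>2)"
proof -
  interpret S: prob_space sequence_space by (rule prob_space_sequence_space)
  \<comment> \<open>The variance bound at level 3t gives 2 (3t)^2 = 18 t^2, and 1 is the deviation
    permitted in the law of large numbers.\<close>
  define T where "T = 18 * t\<^sup>2 + 1"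
  have trunc: "(\<integral>x. min ((k x)\<^sup>2) (real K) \<partial>M) \<le> T" for K
  proof -
    let ?g = "\<lambda>x. min ((k x)\<^sup>2) (real K)"
    have "(\<lambda>N. measure sequence_space {z \<in> space sequence_space. \<bar>(\<Sum>i<N. ?g (z i)) / real N - integral\<^sup>L M ?g\<bar> > 1}) \<longlonglongrightarrow> 0"
      by (intro weak_law_bounded[of _ "real K"]) auto
    then have "eventually (\<lambda>N. measure sequence_space {z \<in> space sequence_space. \<bar>(\<Sum>i<N. ?g (z i)) / real N - integral\<^sup>L M ?g\<bar> > 1} < 1 / 4) sequentially"
      by (rule order_tendstoD) simp
    then obtain N1 where N1: "\<And>N. N \<ge> N1 \<Longrightarrow> measure sequence_space {z \<in> space sequence_space. \<bar>(\<Sum>i<N. ?g (z i)) / real N - integral\<^sup>L M ?g\<bar> > 1} < 1 / 4"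
      unfolding eventually_sequentially by blast
    define N where "N = max N0 N1 + 1"
    have N: "N \<ge> N0" "N \<ge> N1" "N > 0" by (auto simp: N_def)
    let ?A = "{z \<in> space sequence_space. \<bar>(\<Sum>i<N. ?g (z i)) / real N - integral\<^sup>L M ?g\<bar> > 1}"
    let ?R = "{z \<in> space sequence_space. rademacher_exp N
        (\<lambda>e. of_bool (\<exists>k'\<in>{k}. \<bar>\<Sum>i<N. e i * k' (z i)\<bar> > 3 * t * sqrt (real N))) \<ge> 1 / 12}"
    \<comment> \<open>The right-hand side equals 1/4. The two exceptional sets together have measure
      below 1, so some sample z avoids both, and this one sample already bounds the deterministic
      truncated moment.\<close>
    have "outer_prob sequence_space ?R \<le> 2 * (1 / 96) / (1 / 12)"
      using t tight N(1) by (intro rademacher_tail_outer prob_space_axioms) auto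
    then obtain B where B: "B \<in> sets sequence_space" "?R \<subseteq> B" "measure sequence_space B < 1 / 2"
      using outer_prob_lessE[of sequence_space ?R "1 / 2"] by auto
    have [measurable]: "?A \<in> sets sequence_space" by measurable
    have "measure sequence_space (?A \<union> B) \<le> measure sequence_space ?A + measure sequence_space B"
      using B(1) by (intro measure_Un_le) auto
    then have "measure sequence_space (?A \<union> B) < 1" using N1[OF N(2)] B(3) by linarith
    then have "?A \<union> B \<noteq> space sequence_space" using S.prob_space by auto
    moreover have "?A \<union> B \<subseteq> space sequence_space" using B(1) sets.sets_into_space by blast
    ultimately obtain z where z: "z \<in> space sequence_space" "z \<notin> ?A" "z \<notin> ?R" using B(2) by blast
    have "rademacher_exp N (\<lambda>e. of_bool (\<exists>b\<in>{\<lambda>i. k (z i)}. \<bar>\<Sum>i<N. e i * b i\<bar> > 3 * t * sqrt (real N))) < 1 / 12"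
      using z(1,3) by simp
    from rademacher_variance_bound[OF this, of "\<lambda>i. k (z i)"]
    have "(\<Sum>i<N. (k (z i))\<^sup>2) \<le> 2 * (3 * t * sqrt (real N))\<^sup>2" using t by simp
    also have "\<dots> = 18 * t\<^sup>2 * real N" by (simp add: power_mult_distrib)
    finally have "(\<Sum>i<N. ?g (z i)) \<le> 18 * t\<^sup>2 * real N"
      by (meson order_trans sum_mono min.cobounded1)
    then have "(\<Sum>i<N. ?g (z i)) / real N \<le> 18 * t\<^sup>2" using N(3) by (simp add: field_simps)
    moreover have "\<bar>(\<Sum>i<N. ?g (z i)) / real N - integral\<^sup>L M ?g\<bar> \<le> 1" using z(1,2) by simp
    ultimately show ?thesis unfolding T_def by linarith
  qed
  have T0: "T \<ge> 0" by (simp add: T_def)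
  have "(\<integral>\<^sup>+x. ennreal ((k x)\<^sup>2) \<partial>M) = (\<integral>\<^sup>+x. liminf (\<lambda>K. ennreal (min ((k x)\<^sup>2) (real K))) \<partial>M)"
  proof (rule nn_integral_cong)
    fix x
    obtain K0 :: nat where "(k x)\<^sup>2 \<le> real K0" using real_arch_simple by blast
    then have "eventually (\<lambda>K. ennreal (min ((k x)\<^sup>2) (real K)) = ennreal ((k x)\<^sup>2)) sequentially"
      by (intro eventually_sequentiallyI[of K0]) (simp add: min_def)
    then have "(\<lambda>K. ennreal (min ((k x)\<^sup>2) (real K))) \<longlonglongrightarrow> ennreal ((k x)\<^sup>2)" by (rule tendsto_eventually)
    from lim_imp_Liminf[OF sequentially_bot this]
    show "ennreal ((k x)\<^sup>2) = liminf (\<lambda>K. ennreal (min ((k x)\<^sup>2) (real K)))" ..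
  qed
  also have "\<dots> \<le> liminf (\<lambda>K. \<integral>\<^sup>+x. ennreal (min ((k x)\<^sup>2) (real K)) \<partial>M)"
    by (rule nn_integral_liminf) measurable
  also have "\<dots> \<le> liminf (\<lambda>K. ennreal T)"
  proof (intro Liminf_mono always_eventually allI)
    fix K
    have "integrable M (\<lambda>x. min ((k x)\<^sup>2) (real K))" by (rule integrable_const_bound[where B = "real K"]) auto
    then have "(\<integral>\<^sup>+x. ennreal (min ((k x)\<^sup>2) (real K)) \<partial>M) = ennreal (\<integral>x. min ((k x)\<^sup>2) (real K) \<partial>M)"
      by (intro nn_integral_eq_integral) auto
    then show "(\<integral>\<^sup>+x. ennreal (min ((k x)\<^sup>2) (real K)) \<partial>M) \<le> ennreal T" using trunc[of K] by (simp add: ennreal_leI)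
  qed
  also have "\<dots> = ennreal T" by (simp add: Liminf_const)
  finally have "(\<integral>\<^sup>+x. ennreal ((k x)\<^sup>2) \<partial>M) < \<infinity>" by (rule le_less_trans) simp
  then show ?thesis by (intro integrableI_nonneg) auto
qed

text \<open>The definition of a Donsker class provides first moments only. The covariances and the
  Lindeberg condition need second moments, which are recovered here from tightness of the centred
  sums of a single function.\<close>

lemma Donsker_class_square_integrable:
  assumes D: "Donsker_class M H" and g: "g \<in> H"
  shows "integrable M (\<lambda>x. (g x)\<^sup>2)"
proof -
  have gi: "integrable M g" using D g by (auto simp: Donsker_class_def)
  then have [measurable]: "g \<in> borel_measurable M" by simp
  obtain t N0 where t: "t > 0" and N0: "\<And>m. m \<ge> N0 \<Longrightarrow> outer_prob sequence_space
      {z \<in> space sequence_space. \<bar>\<Sum>i<m. g (z i) - integral\<^sup>L M g\<bar> > t * sqrt (real m)} < 1 / 96"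
    using Donsker_class_tails(2)[OF prob_space_axioms D, of 1 "1 / 96" g] g by auto
  have "integrable M (\<lambda>x. (g x - integral\<^sup>L M g)\<^sup>2)"
    by (rule square_integrable_if_tight_sums[OF _ t N0]) auto
  then have "integrable M (\<lambda>x. (g x - integral\<^sup>L M g)\<^sup>2 + 2 * integral\<^sup>L M g * g x - (integral\<^sup>L M g)\<^sup>2)"
    using gi by simp
  then show ?thesis by (simp add: power2_diff algebra_simps)
qed

end

section \<open>Gaussian processes and Horvitz--Thompson multipliers\<close>

text \<open>Linear combinations of a Gaussian process may be degenerate, which is a case of its own;
  the nondegenerate one is rescaled to the standard normal law.\<close>

lemma normal_law_moments:
  fixes X :: "'a \<Rightarrow> real"
  assumes M: "prob_space M" and X: "X \<in> borel_measurable M" and normal: "normal_law (distr M borel X)"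
  shows "integrable M X" and "integrable M (\<lambda>\<omega>. (X \<omega>)\<^sup>2)"
    and "(\<integral>\<omega>. X \<omega> \<partial>M) = 0 \<Longrightarrow> (\<integral>\<omega>. cis (X \<omega>) \<partial>M) = of_real (exp (- (\<integral>\<omega>. (X \<omega>)\<^sup>2 \<partial>M) / 2))"
proof -
  interpret prob_space M by (rule M)
  have cism: "cis \<in> borel_measurable borel" by (intro borel_measurable_continuous_onI continuous_intros)
  have "integrable M X \<and> integrable M (\<lambda>\<omega>. (X \<omega>)\<^sup>2) \<and>
    ((\<integral>\<omega>. X \<omega> \<partial>M) = 0 \<longrightarrow> (\<integral>\<omega>. cis (X \<omega>) \<partial>M) = of_real (exp (- (\<integral>\<omega>. (X \<omega>)\<^sup>2 \<partial>M) / 2)))"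
    using normal unfolding normal_law_def
  proof (elim disjE exE conjE)
    fix \<mu> \<sigma> :: real
    assume \<sigma>: "\<sigma> > 0" and law: "distr M borel X = density lborel (\<lambda>x. ennreal (normal_density \<mu> \<sigma> x))"
    have "distr M lborel X = distr M borel X" by (rule distr_cong) auto
    then have D: "distributed M lborel X (normal_density \<mu> \<sigma>)"
      using law X unfolding distributed_def by simp
    have int: "integrable M X"
      by (rule distributed_integrable_var[OF D]) (auto simp: integrable_normal_moment_nz_1[OF \<sigma>])
    have int2: "integrable M (\<lambda>\<omega>. (X \<omega> - \<mu>)\<^sup>2)"
      using distributed_integrable[OF D, of "\<lambda>x. (x - \<mu>)\<^sup>2"] integrable_normal_moment[OF \<sigma>, of \<mu> 2] by simp
    have "integrable M (\<lambda>\<omega>. (X \<omega> - \<mu>)\<^sup>2 + 2 * \<mu> * X \<omega> - \<mu>\<^sup>2)" using int int2 by simp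
    moreover have "(\<lambda>\<omega>. (X \<omega> - \<mu>)\<^sup>2 + 2 * \<mu> * X \<omega> - \<mu>\<^sup>2) = (\<lambda>\<omega>. (X \<omega>)\<^sup>2)"
      by (auto simp: power2_eq_square algebra_simps)
    ultimately have intsq: "integrable M (\<lambda>\<omega>. (X \<omega>)\<^sup>2)" by simp
    have "(\<integral>\<omega>. cis (X \<omega>) \<partial>M) = of_real (exp (- (\<integral>\<omega>. (X \<omega>)\<^sup>2 \<partial>M) / 2))" if mean: "(\<integral>\<omega>. X \<omega> \<partial>M) = 0"
    proof -
      have \<mu>: "\<mu> = 0" using normal_distributed_expectation[OF \<sigma> D] mean by simp
      have var: "(\<integral>\<omega>. (X \<omega>)\<^sup>2 \<partial>M) = \<sigma>\<^sup>2" using normal_distributed_variance[OF \<sigma> D] mean by simp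
      have "distributed M lborel (\<lambda>\<omega>. X \<omega> / \<sigma>) std_normal_density"
        using normal_standard_normal_convert[OF \<sigma>, of X \<mu>] D \<mu> by simp
      then have law1: "distr M lborel (\<lambda>\<omega>. X \<omega> / \<sigma>) = std_normal_distribution" by (simp add: distributed_def)
      have "(\<integral>\<omega>. cis (X \<omega>) \<partial>M) = (\<integral>\<omega>. (\<lambda>y. cis (\<sigma> * y)) (X \<omega> / \<sigma>) \<partial>M)" using \<sigma> by simp
      also have "\<dots> = (\<integral>y. cis (\<sigma> * y) \<partial>distr M lborel (\<lambda>\<omega>. X \<omega> / \<sigma>))"
        using X measurable_compose[OF _ cism, of "\<lambda>y. \<sigma> * y" lborel] by (intro integral_distr[symmetric]) auto
      also have "\<dots> = char std_normal_distribution \<sigma>"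
        unfolding law1 char_def by (simp add: cis_conv_exp)
      also have "\<dots> = of_real (exp (- (\<sigma>\<^sup>2) / 2))" by (simp add: char_std_normal_distribution)
      finally show ?thesis by (simp add: var)
    qed
    then show ?thesis using int intsq by blast
  next
    fix \<mu> :: real assume law: "distr M borel X = return borel \<mu>"
    have "AE x in distr M borel X. x = \<mu>" unfolding law by (subst AE_return) auto
    then have ae: "AE \<omega> in M. X \<omega> = \<mu>" using X by (subst (asm) AE_distr_iff) auto
    have "integrable M X" using X ae by (intro integrable_const_bound[where B = "\<bar>\<mu>\<bar>"]) auto
    moreover have "integrable M (\<lambda>\<omega>. (X \<omega>)\<^sup>2)" using X ae by (intro integrable_const_bound[where B = "\<mu>\<^sup>2"]) auto
    moreover have "(\<integral>\<omega>. X \<omega> \<partial>M) = (\<integral>\<omega>. \<mu> \<partial>M)" "(\<integral>\<omega>. (X \<omega>)\<^sup>2 \<partial>M) = (\<integral>\<omega>. \<mu>\<^sup>2 \<partial>M)"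
      using X ae by (intro integral_cong_AE; auto)+
    moreover have "(\<integral>\<omega>. cis (X \<omega>) \<partial>M) = (\<integral>\<omega>. cis \<mu> \<partial>M)"
      using X ae measurable_compose[OF X cism] by (intro integral_cong_AE) auto
    ultimately show ?thesis by (simp add: prob_space)
  qed
  then show "integrable M X" "integrable M (\<lambda>\<omega>. (X \<omega>)\<^sup>2)"
    "(\<integral>\<omega>. X \<omega> \<partial>M) = 0 \<Longrightarrow> (\<integral>\<omega>. cis (X \<omega>) \<partial>M) = of_real (exp (- (\<integral>\<omega>. (X \<omega>)\<^sup>2 \<partial>M) / 2))" by auto
qed

lemma centered_gaussian_charfun:
  assumes M: "prob_space M" and G: "centered_gaussian_process M F C G" and J: "finite J" "J \<subseteq> F"
  shows "(\<integral>\<omega>. cis (\<Sum>f\<in>J. a f * G \<omega> f) \<partial>M) = of_real (exp (- (\<Sum>f\<in>J. \<Sum>g\<in>J. a f * a g * C f g) / 2))"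
proof -
  interpret prob_space M by (rule M)
  have meas: "(\<lambda>\<omega>. G \<omega> f) \<in> borel_measurable M" if "f \<in> F" for f
    using G that by (auto simp: centered_gaussian_process_def gaussian_process_def)
  have lin: "normal_law (distr M borel (\<lambda>\<omega>. \<Sum>f\<in>J. a f * G \<omega> f))" if "finite J" "J \<subseteq> F" for J a
    using G that by (auto simp: centered_gaussian_process_def gaussian_process_def)
  have one: "integrable M (\<lambda>\<omega>. G \<omega> f)" "integrable M (\<lambda>\<omega>. (G \<omega> f)\<^sup>2)" if f: "f \<in> F" for f
    using normal_law_moments(1,2)[OF M meas[OF f]] lin[of "{f}" "\<lambda>_. 1"] f by auto
  have prod: "integrable M (\<lambda>\<omega>. G \<omega> f * G \<omega> g)" if f: "f \<in> F" "g \<in> F" for f g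
  proof (rule Bochner_Integration.integrable_bound)
    show "integrable M (\<lambda>\<omega>. (G \<omega> f)\<^sup>2 + (G \<omega> g)\<^sup>2)" using one f by simp
    show "AE \<omega> in M. norm (G \<omega> f * G \<omega> g) \<le> norm ((G \<omega> f)\<^sup>2 + (G \<omega> g)\<^sup>2)"
    proof (rule AE_I2)
      fix \<omega>
      have "2 * (\<bar>G \<omega> f\<bar> * \<bar>G \<omega> g\<bar>) \<le> (G \<omega> f)\<^sup>2 + (G \<omega> g)\<^sup>2"
        using sum_squares_bound[of "\<bar>G \<omega> f\<bar>" "\<bar>G \<omega> g\<bar>"] by simp
      moreover have "0 \<le> \<bar>G \<omega> f\<bar> * \<bar>G \<omega> g\<bar>" by simp
      ultimately have "\<bar>G \<omega> f\<bar> * \<bar>G \<omega> g\<bar> \<le> (G \<omega> f)\<^sup>2 + (G \<omega> g)\<^sup>2" by linarith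
      then show "norm (G \<omega> f * G \<omega> g) \<le> norm ((G \<omega> f)\<^sup>2 + (G \<omega> g)\<^sup>2)" by (simp add: abs_mult)
    qed
  qed (use meas f in measurable)
  let ?X = "\<lambda>\<omega>. \<Sum>f\<in>J. a f * G \<omega> f"
  have Xm: "?X \<in> borel_measurable M" using meas J by (intro borel_measurable_sum borel_measurable_times) auto
  have "(\<integral>\<omega>. ?X \<omega> \<partial>M) = (\<Sum>f\<in>J. a f * (\<integral>\<omega>. G \<omega> f \<partial>M))"
    using one J by (subst Bochner_Integration.integral_sum) auto
  also have "\<dots> = 0" using G J by (intro sum.neutral) (auto simp: centered_gaussian_process_def)
  finally have mean: "(\<integral>\<omega>. ?X \<omega> \<partial>M) = 0" .
  have "(\<integral>\<omega>. (?X \<omega>)\<^sup>2 \<partial>M) = (\<integral>\<omega>. (\<Sum>f\<in>J. \<Sum>g\<in>J. a f * a g * (G \<omega> f * G \<omega> g)) \<partial>M)"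
    by (simp add: power2_eq_square sum_product mult_ac)
  also have "\<dots> = (\<Sum>f\<in>J. \<integral>\<omega>. (\<Sum>g\<in>J. a f * a g * (G \<omega> f * G \<omega> g)) \<partial>M)"
    using prod J by (intro Bochner_Integration.integral_sum Bochner_Integration.integrable_sum integrable_mult_right) auto
  also have "\<dots> = (\<Sum>f\<in>J. \<Sum>g\<in>J. \<integral>\<omega>. a f * a g * (G \<omega> f * G \<omega> g) \<partial>M)"
    using prod J by (intro sum.cong refl Bochner_Integration.integral_sum integrable_mult_right) auto
  also have "\<dots> = (\<Sum>f\<in>J. \<Sum>g\<in>J. a f * a g * C f g)"
    using G J by (intro sum.cong refl) (auto simp: centered_gaussian_process_def)
  finally have var: "(\<integral>\<omega>. (?X \<omega>)\<^sup>2 \<partial>M) = (\<Sum>f\<in>J. \<Sum>g\<in>J. a f * a g * C f g)" .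
  show ?thesis using normal_law_moments(3)[OF M Xm lin[OF J] mean] by (simp add: var)
qed

section \<open>Horvitz-Thompson multipliers under Bernoulli inclusion\<close>

definition bernoulli_weight :: "(nat \<Rightarrow> real) \<Rightarrow> nat \<Rightarrow> nat \<Rightarrow> real" where
  "bernoulli_weight \<pi> i b = \<pi> i ^ b * (1 - \<pi> i) ^ (1 - b)"

lemma prod_exp_bernoulli:
  "prod_exp N {0, 1} (bernoulli_weight \<pi>) G = (\<Sum>s\<in>indicator_vectors N. G s * poisson_prob N \<pi> s)"
  unfolding prod_exp_def bernoulli_weight_def poisson_prob_def indicator_vectors_def by (simp add: mult.commute)

lemma bernoulli_product_weights:
  assumes "\<And>i. i < N \<Longrightarrow> \<pi> i \<in> {0..1}"
  shows "product_weights N {0, 1} (bernoulli_weight \<pi>)"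
  using assms by unfold_locales (auto simp: bernoulli_weight_def)

text \<open>With inclusion probability \<pi> = min w A / A this is (1 - \<pi>) / \<pi> times the
  squared truncated size, the conditional variance of a multiplier. The random normalization A and
  the limiting threshold a are kept apart; at A = a and w > 0 it becomes the weight (a - min w a)
  min w a of the limit covariance.\<close>

definition ht_variance :: "real \<Rightarrow> real \<Rightarrow> real \<Rightarrow> real" where
  "ht_variance a A w = (A - min w A) * (min w a)\<^sup>2 / min w A"

text \<open>The bound rests on A min w a / min w A: for w \<le> A this is at most A, since then the
  denominator is w, and for w > A it equals min w a \<le> a. The truncated size thus offsets small
  inclusion probabilities.\<close>

lemma ht_multiplier:
  fixes \<pi> :: real
  assumes w: "w > 0" and A: "A > 0" and a: "a > 0" and \<pi>: "\<pi> = min (w / A) 1"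
  defines "\<xi> \<equiv> \<lambda>b :: nat. (real b / \<pi> - 1) * min w a" and "q \<equiv> \<lambda>b :: nat. \<pi> ^ b * (1 - \<pi>) ^ (1 - b)"
  shows "\<pi> \<in> {0<..1}" "(\<Sum>b\<in>{0, 1}. q b * \<xi> b) = 0"
    and "b \<in> {0, 1} \<Longrightarrow> \<bar>\<xi> b\<bar> \<le> max A a"
    and "(\<Sum>b\<in>{0, 1}. q b * (\<xi> b)\<^sup>2) = ht_variance a A w"
proof -
  have \<pi>m: "\<pi> = min w A / A" using A by (simp add: \<pi> min_def)
  show \<pi>01: "\<pi> \<in> {0<..1}" using w A by (auto simp: \<pi>)
  show "(\<Sum>b\<in>{0, 1}. q b * \<xi> b) = 0" using \<pi>01 by (simp add: q_def \<xi>_def field_simps)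
  have m: "min w A > 0" using w A by simp
  show "\<bar>\<xi> b\<bar> \<le> max A a" if b: "b \<in> {0, 1}"
  proof -
    have "1 \<le> 1 / \<pi>" using \<pi>01 by simp
    then have "\<bar>real b / \<pi> - 1\<bar> \<le> 1 / \<pi>" using b by auto
    then have "\<bar>\<xi> b\<bar> \<le> 1 / \<pi> * min w a"
      unfolding \<xi>_def abs_mult using w a \<pi>01 by (intro mult_mono) auto
    also have "1 / \<pi> * min w a = A * min w a / min w A" using A m by (simp add: \<pi>m)
    also have "\<dots> \<le> max A a"
    proof (cases "w \<le> A")
      case True
      have "A * min w a \<le> A * w" using A by simp
      then show ?thesis using True w by (simp add: field_simps max_def)
    qed (use A in simp)
    finally show ?thesis .
  qed
  have "(\<Sum>b\<in>{0, 1}. q b * (\<xi> b)\<^sup>2) = (1 - \<pi>) / \<pi> * (min w a)\<^sup>2"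
  proof -
    have "(1 - \<pi>) + \<pi> * (1 / \<pi> - 1)\<^sup>2 = (1 - \<pi>) / \<pi>"
      using \<pi>01 by (simp add: power2_eq_square field_simps)
    then have "((1 - \<pi>) + \<pi> * (1 / \<pi> - 1)\<^sup>2) * (min w a)\<^sup>2 = (1 - \<pi>) / \<pi> * (min w a)\<^sup>2" by simp
    then show ?thesis by (simp add: q_def \<xi>_def power_mult_distrib distrib_right mult.assoc)
  qed
  also have "(1 - \<pi>) / \<pi> = (A - min w A) / min w A"
    using A m by (simp add: \<pi>m field_simps)
  finally show "(\<Sum>b\<in>{0, 1}. q b * (\<xi> b)\<^sup>2) = ht_variance a A w" by (simp add: ht_variance_def)
qed

text \<open>A term vanishes as soon as w exceeds its normalization, so when w lies between A and a
  only one term has to be estimated. The bound is uniform in w, which lets the random normalization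
  be replaced by its limit for all units at once.\<close>

lemma ht_variance_lipschitz:
  assumes w: "w > 0" and A: "A > 0" and a: "a > 0"
  shows "\<bar>ht_variance a A w - ht_variance a a w\<bar> \<le> a * \<bar>A - a\<bar>"
proof -
  have lim: "ht_variance a a w = (a - min w a) * min w a"
    using w a by (simp add: ht_variance_def power2_eq_square)
  show ?thesis
  proof (cases "w \<le> A")
    case True
    show ?thesis
    proof (cases "w \<le> a")
      case wa: True
      have "ht_variance a A w - ht_variance a a w = (A - a) * w"
        using True wa w by (simp add: lim ht_variance_def power2_eq_square) (simp add: algebra_simps)
      then have "\<bar>ht_variance a A w - ht_variance a a w\<bar> = w * \<bar>A - a\<bar>" using w by (simp add: abs_mult)
      also have "\<dots> \<le> a * \<bar>A - a\<bar>" using wa by (intro mult_right_mono) auto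
      finally show ?thesis .
    next
      case wa: False
      have "ht_variance a A w = (A - w) * (a\<^sup>2 / w)" using True wa by (simp add: ht_variance_def)
      moreover have "a\<^sup>2 / w \<le> a" "0 \<le> a\<^sup>2 / w" using wa w a by (simp_all add: power2_eq_square field_simps)
      moreover have "(A - w) * (a\<^sup>2 / w) \<le> (A - a) * a"
        using calculation True wa a by (intro mult_mono) auto
      moreover have "0 \<le> (A - w) * (a\<^sup>2 / w)" using calculation(3) True by (intro mult_nonneg_nonneg) auto
      moreover have "ht_variance a a w = 0" using wa by (simp add: lim)
      ultimately show ?thesis using True wa by (simp add: mult.commute)
    qed
  next
    case False
    then have 0: "ht_variance a A w = 0" using A by (simp add: ht_variance_def)
    show ?thesis
    proof (cases "w \<le> a")
      case wa: True
      have "(a - w) * w \<le> (a - A) * a" using False wa w a by (intro mult_mono) auto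
      moreover have "0 \<le> (a - w) * w" using wa w by simp
      ultimately show ?thesis using 0 wa False by (simp add: lim mult.commute)
    next
      case wa: False
      then show ?thesis using 0 a by (simp add: lim)
    qed
  qed
qed

section \<open>Finite-dimensional projections\<close>

text \<open>Since v is read at representatives only, the same map extends finite-dimensional vectors
  to step functions and projects elements of \<open>linf F\<close> onto them.\<close>

definition lift_linf :: "'i set \<Rightarrow> ('i \<Rightarrow> 'i) \<Rightarrow> ('i \<Rightarrow> real) \<Rightarrow> ('i \<Rightarrow> real)" where
  "lift_linf F rep v = (\<lambda>f\<in>F. v (rep f))"

lemma exists_representatives:
  assumes "finite (c ` F)"
  obtains rep where "finite (rep ` F)" "rep ` F \<subseteq> F" "\<And>f. f \<in> F \<Longrightarrow> c (rep f) = c f"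
proof (rule that[of "\<lambda>f. inv_into F c (c f)"])
  have "(\<lambda>f. inv_into F c (c f)) ` F = inv_into F c ` (c ` F)" by auto
  then show "finite ((\<lambda>f. inv_into F c (c f)) ` F)" using assms by simp
  show "(\<lambda>f. inv_into F c (c f)) ` F \<subseteq> F" by (auto intro: inv_into_into)
  show "c (inv_into F c (c f)) = c f" if "f \<in> F" for f using that by (auto intro: f_inv_into_f)
qed

lemma BL1_linf_bounds:
  assumes "h \<in> BL1_linf F" "z \<in> linf F"
  shows "0 \<le> h z" "h z \<le> 1"
  using assms by (auto simp: BL1_linf_def)

lemma BL1_linf_lipschitz:
  assumes "h \<in> BL1_linf F" "z \<in> linf F" "z' \<in> linf F"
  shows "\<bar>h z - h z'\<bar> \<le> linf_dist F z z'"
  using assms by (auto simp: BL1_linf_def)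

lemma BL1_linf_measurable:
  assumes "h \<in> BL1_linf F"
  shows "h \<in> borel_measurable (linf_borel F)"
  using BL1_linf_lipschitz[OF assms]
  by (intro continuous_map_linf_measurable lipschitz_linf_continuous_map[where c = 1]) auto

context
  fixes F :: "'i set" and rep :: "'i \<Rightarrow> 'i"
  assumes rep: "finite (rep ` F)" "rep ` F \<subseteq> F"
begin

lemma lift_in_linf: "lift_linf F rep v \<in> linf F"
proof -
  have "lift_linf F rep v ` F = v ` (rep ` F)" by (auto simp: lift_linf_def)
  then have "finite (lift_linf F rep v ` F)" using rep(1) by simp
  then show ?thesis unfolding linf_def lift_linf_def by (auto intro: finite_imp_bounded)
qed

lemma lift_coord_BL1:
  assumes h: "h \<in> BL1_linf F"
  shows "(\<lambda>v. h (lift_linf F rep v)) \<in> coord_BL1 (rep ` F)"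
  unfolding coord_BL1_def
proof (intro CollectI conjI allI impI)
  show "h (lift_linf F rep v) \<in> {0..1}" for v using BL1_linf_bounds[OF h lift_in_linf] by auto
  fix v v' and d :: real assume d: "(\<forall>f\<in>rep ` F. \<bar>v f - v' f\<bar> \<le> d) \<and> 0 \<le> d"
  have "linf_dist F (lift_linf F rep v) (lift_linf F rep v') \<le> d"
    using d by (intro linf_dist_least) (auto simp: lift_linf_def)
  then show "\<bar>h (lift_linf F rep v) - h (lift_linf F rep v')\<bar> \<le> d"
    using BL1_linf_lipschitz[OF h lift_in_linf lift_in_linf] by (rule order_trans[rotated])
qed

lemma lift_BL1_linf:
  assumes h: "h \<in> BL1_linf F"
  shows "(\<lambda>z. h (lift_linf F rep z)) \<in> BL1_linf F"
  unfolding BL1_linf_def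
proof (intro CollectI conjI ballI)
  show "h (lift_linf F rep z) \<in> {0..1}" for z using BL1_linf_bounds[OF h lift_in_linf] by auto
  fix z z' assume z: "z \<in> linf F" "z' \<in> linf F"
  have "linf_dist F (lift_linf F rep z) (lift_linf F rep z') \<le> linf_dist F z z'"
    using linf_dist_upper[OF z] rep(2) linf_dist_nonneg by (intro linf_dist_least) (auto simp: lift_linf_def)
  then show "\<bar>h (lift_linf F rep z) - h (lift_linf F rep z')\<bar> \<le> linf_dist F z z'"
    using BL1_linf_lipschitz[OF h lift_in_linf lift_in_linf] by (rule order_trans[rotated])
qed

text \<open>Where b < 1 the path moves by at most r under the projection; elsewhere b = 1 already
  dominates the difference of two values of h. Integrating r + b gives the bound.\<close>

lemma limit_projection:
  assumes M: "prob_space M" and G: "G \<in> M \<rightarrow>\<^sub>M linf_borel F" and h: "h \<in> BL1_linf F" and r: "r \<ge> 0"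
    and b: "continuous_map (linf_topology F) euclideanreal b" "integral\<^sup>L (distr M (linf_borel F) G) b \<le> e"
      "\<And>z. 0 \<le> b z" "\<And>z. b z \<le> 1"
    and osc: "\<And>z f. z \<in> linf F \<Longrightarrow> b z < 1 \<Longrightarrow> f \<in> F \<Longrightarrow> \<bar>z f - z (rep f)\<bar> \<le> r"
  shows "\<bar>(\<integral>\<omega>. h (G \<omega>) \<partial>M) - (\<integral>\<omega>. h (lift_linf F rep (G \<omega>)) \<partial>M)\<bar> \<le> r + e"
proof -
  interpret prob_space M by (rule M)
  have Gl: "G \<omega> \<in> linf F" if "\<omega> \<in> space M" for \<omega> using measurable_space[OF G that] by simp
  have int: "integrable M (\<lambda>\<omega>. h (G \<omega>))" if h: "h \<in> BL1_linf F" for h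
    using BL1_linf_bounds[OF h Gl] measurable_compose[OF G BL1_linf_measurable[OF h]]
    by (intro integrable_const_bound[where B = 1]) auto
  have bm: "b \<in> borel_measurable (linf_borel F)" using b(1) by (rule continuous_map_linf_measurable)
  have bint: "integrable M (\<lambda>\<omega>. b (G \<omega>))"
    using b(3,4) measurable_compose[OF G bm] by (intro integrable_const_bound[where B = 1]) auto
  have "\<bar>(\<integral>\<omega>. h (G \<omega>) \<partial>M) - (\<integral>\<omega>. h (lift_linf F rep (G \<omega>)) \<partial>M)\<bar>
      = \<bar>\<integral>\<omega>. h (G \<omega>) - h (lift_linf F rep (G \<omega>)) \<partial>M\<bar>"
    using int[OF h] int[OF lift_BL1_linf[OF h]] by simp
  also have "\<dots> \<le> (\<integral>\<omega>. \<bar>h (G \<omega>) - h (lift_linf F rep (G \<omega>))\<bar> \<partial>M)" by (rule integral_abs_bound)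
  also have "\<dots> \<le> (\<integral>\<omega>. r + b (G \<omega>) \<partial>M)"
  proof (rule integral_mono)
    fix \<omega> assume \<omega>: "\<omega> \<in> space M"
    show "\<bar>h (G \<omega>) - h (lift_linf F rep (G \<omega>))\<bar> \<le> r + b (G \<omega>)"
    proof (cases "b (G \<omega>) < 1")
      case True
      have "linf_dist F (G \<omega>) (lift_linf F rep (G \<omega>)) \<le> r"
        using osc[OF Gl[OF \<omega>] True] r by (intro linf_dist_least) (auto simp: lift_linf_def)
      then show ?thesis using BL1_linf_lipschitz[OF h Gl[OF \<omega>] lift_in_linf[of "G \<omega>"]] b(3)[of "G \<omega>"] by linarith
    next
      case False
      then show ?thesis
        using BL1_linf_bounds[OF h Gl[OF \<omega>]] BL1_linf_bounds[OF h lift_in_linf[of "G \<omega>"]] r by linarith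
    qed
  qed (use int[OF h] int[OF lift_BL1_linf[OF h]] bint in auto)
  also have "\<dots> = r + integral\<^sup>L (distr M (linf_borel F) G) b"
    using bint by (simp add: integral_distr[OF G bm] prob_space)
  finally show ?thesis using b(2) by linarith
qed

text \<open>The oscillation of the design process is split into the one of the centred functions, controlled
  by the Rademacher tail, and a multiple of the single variable \<open>\<Sum>\<^sub>i \<xi>\<^sub>i\<close>, controlled by its variance.\<close>

lemma design_projection:
  fixes \<gamma> :: "'i \<Rightarrow> 'z \<Rightarrow> real" and z :: "nat \<Rightarrow> 'z"
  assumes pw: "product_weights N B q" and N: "N \<ge> 1"
    and centered: "\<And>i. i < N \<Longrightarrow> (\<Sum>b\<in>B. q i b * \<xi> i b) = 0"
    and C: "C > 0" "\<And>i b. i < N \<Longrightarrow> b \<in> B \<Longrightarrow> \<bar>\<xi> i b\<bar> \<le> C"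
    and K: "\<And>f. f \<in> F \<Longrightarrow> (\<lambda>x. (\<gamma> f x - \<mu> f) - (\<gamma> (rep f) x - \<mu> (rep f))) \<in> K"
    and \<tau>: "\<tau> > 0" "\<And>f. f \<in> F \<Longrightarrow> \<bar>\<mu> f - \<mu> (rep f)\<bar> \<le> \<tau>"
    and rad: "rademacher_exp N (\<lambda>e. of_bool (\<exists>k\<in>K. \<bar>\<Sum>i<N. e i * k (z i)\<bar> > 3 * u * sqrt (real N))) < \<delta>"
    and \<delta>: "\<delta> \<le> 1 / 12" and u: "u > 0" and \<epsilon>: "12 * C * u \<le> \<epsilon>"
    and h: "h \<in> BL1_linf F"
  defines "V \<equiv> \<lambda>s f. \<Sum>i<N. \<xi> i (s i) * (\<gamma> f (z i) / sqrt (real N))"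
  assumes V: "\<And>s. (\<lambda>f\<in>F. V s f) \<in> linf F"
  shows "\<bar>prod_exp N B q (\<lambda>s. h (\<lambda>f\<in>F. V s f)) - prod_exp N B q (\<lambda>s. h (lift_linf F rep (V s)))\<bar>
    \<le> 2 * \<epsilon> + 9 / 7 * \<delta> + C\<^sup>2 * \<tau>\<^sup>2 / \<epsilon>\<^sup>2"
proof -
  interpret product_weights N B q by (rule pw)
  have \<epsilon>0: "\<epsilon> > 0" using \<epsilon> C(1) u by (smt (verit) mult_pos_pos)
  define t where "t = 3 * u * sqrt (real N)"
  have sN: "sqrt (real N) > 0" using N by simp
  have t: "t > 0" using u sN by (simp add: t_def)
  define K' where "K' = (\<lambda>k i. k (z i)) ` K"
  \<comment> \<open>Division by C puts the multipliers into [-1, 1], as the comparison with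
    Rademacher tails demands. Its factor 4, the level 3u and the rescaling by C account for 12 C u
    \<le> \<epsilon>.\<close>
  define E1 where "E1 s \<longleftrightarrow> (\<exists>k\<in>K'. \<bar>\<Sum>i<N. \<xi> i (s i) / C * k i\<bar> > 4 * t)" for s
  \<comment> \<open>Off this event, a difference of means of at most \<tau> times the sum of the
    multipliers contributes at most \<epsilon> sqrt N.\<close>
  define E2 where "E2 s \<longleftrightarrow> (\<Sum>i<N. \<xi> i (s i))\<^sup>2 > (\<epsilon> / \<tau>)\<^sup>2 * real N" for s
  have rad': "rademacher_exp N (\<lambda>e. of_bool (\<exists>k\<in>K'. \<bar>\<Sum>i<N. e i * k i\<bar> > t)) < \<delta>"
    using rad by (simp add: K'_def t_def)
  have P1: "prod_exp N B q (\<lambda>s. of_bool (E1 s)) \<le> 9 / 7 * \<delta>"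
  proof -
    have "prod_exp N B q (\<lambda>s. of_bool (E1 s))
        \<le> 9 / 7 * rademacher_exp N (\<lambda>e. of_bool (\<exists>k\<in>K'. \<bar>\<Sum>i<N. e i * k i\<bar> > t))"
      unfolding E1_def
    proof (rule tail_le_rademacher_tail[OF pw _ _ _ t, of "\<lambda>i b. \<xi> i b / C"])
      show "(\<Sum>b\<in>B. q i b * (\<xi> i b / C)) = 0" if "i < N" for i
        using centered[OF that] by (simp add: sum_divide_distrib[symmetric])
      show "\<bar>\<xi> i b / C\<bar> \<le> 1" if "i < N" "b \<in> B" for i b
        using C(2)[OF that] C(1) by (simp add: abs_divide)
      show "rademacher_exp N (\<lambda>e. of_bool (\<exists>k\<in>K'. \<bar>\<Sum>i<N. e i * k i\<bar> > t)) < 1 / 12"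
        using rad' \<delta> by linarith
    qed
    then show ?thesis using rad' by linarith
  qed
  have P2: "prod_exp N B q (\<lambda>s. of_bool (E2 s)) \<le> C\<^sup>2 * \<tau>\<^sup>2 / \<epsilon>\<^sup>2"
  proof -
    have pos: "(\<epsilon> / \<tau>)\<^sup>2 * real N > 0" using \<epsilon>0 \<tau>(1) N by simp
    have "prod_exp N B q (\<lambda>s. (\<Sum>i<N. \<xi> i (s i))\<^sup>2) = (\<Sum>i<N. \<Sum>b\<in>B. q i b * (\<xi> i b)\<^sup>2)"
      using centered by (rule prod_exp_square_centered[OF pw])
    also have "\<dots> \<le> (\<Sum>i<N. \<Sum>b\<in>B. q i b * C\<^sup>2)"
      using nonneg C by (intro sum_mono mult_left_mono) (auto simp: abs_le_square_iff[symmetric])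
    also have "\<dots> = real N * C\<^sup>2" using total by (simp add: sum_distrib_right[symmetric])
    finally have var: "prod_exp N B q (\<lambda>s. (\<Sum>i<N. \<xi> i (s i))\<^sup>2) \<le> real N * C\<^sup>2" .
    have "prod_exp N B q (\<lambda>s. of_bool (E2 s)) \<le> prod_exp N B q (\<lambda>s. (\<Sum>i<N. \<xi> i (s i))\<^sup>2) / ((\<epsilon> / \<tau>)\<^sup>2 * real N)"
      unfolding E2_def using pos by (intro prod_exp_markov) auto
    also have "\<dots> \<le> (real N * C\<^sup>2) / ((\<epsilon> / \<tau>)\<^sup>2 * real N)"
      using var pos by (intro divide_right_mono) auto
    also have "\<dots> = C\<^sup>2 * \<tau>\<^sup>2 / \<epsilon>\<^sup>2" using N by (simp add: power_divide)
    finally show ?thesis .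
  qed
  have pointwise: "\<bar>h (\<lambda>f\<in>F. V s f) - h (lift_linf F rep (V s))\<bar> \<le> 2 * \<epsilon> + (of_bool (E1 s) + of_bool (E2 s))" for s
  proof (cases "E1 s \<or> E2 s")
    case True
    then show ?thesis
      using BL1_linf_bounds[OF h V[of s]] BL1_linf_bounds[OF h lift_in_linf[of "V s"]] \<epsilon>0 by auto
  next
    case False
    have "\<bar>V s f - V s (rep f)\<bar> \<le> 2 * \<epsilon>" if f: "f \<in> F" for f
    proof -
      let ?k = "\<lambda>x. (\<gamma> f x - \<mu> f) - (\<gamma> (rep f) x - \<mu> (rep f))"
      have split: "V s f - V s (rep f) =
          ((\<Sum>i<N. \<xi> i (s i) * ?k (z i)) + (\<mu> f - \<mu> (rep f)) * (\<Sum>i<N. \<xi> i (s i))) / sqrt (real N)"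
        unfolding V_def sum_subtractf[symmetric] sum_distrib_left sum.distrib[symmetric] sum_divide_distrib
        by (intro sum.cong refl) (simp add: field_simps)
      have "(\<lambda>i. ?k (z i)) \<in> K'" using imageI[OF K[OF f], of "\<lambda>k i. k (z i)"] by (simp add: K'_def)
      then have "\<bar>\<Sum>i<N. \<xi> i (s i) / C * ?k (z i)\<bar> \<le> 4 * t" using False unfolding E1_def by force
      moreover have "(\<Sum>i<N. \<xi> i (s i) / C * ?k (z i)) = (\<Sum>i<N. \<xi> i (s i) * ?k (z i)) / C"
        by (simp add: sum_divide_distrib)
      ultimately have "\<bar>\<Sum>i<N. \<xi> i (s i) * ?k (z i)\<bar> / C \<le> 4 * t"
        using C(1) by (simp only: abs_divide abs_of_pos)
      then have "\<bar>\<Sum>i<N. \<xi> i (s i) * ?k (z i)\<bar> \<le> 4 * t * C"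
        using C(1) by (simp only: pos_divide_le_eq)
      also have "\<dots> = 12 * C * u * sqrt (real N)" by (simp add: t_def)
      also have "\<dots> \<le> \<epsilon> * sqrt (real N)" using \<epsilon> by (intro mult_right_mono) auto
      finally have 1: "\<bar>\<Sum>i<N. \<xi> i (s i) * ?k (z i)\<bar> \<le> \<epsilon> * sqrt (real N)" .
      have "(\<Sum>i<N. \<xi> i (s i))\<^sup>2 \<le> (\<epsilon> / \<tau> * sqrt (real N))\<^sup>2"
        using False unfolding E2_def by (simp only: power_mult_distrib real_sqrt_pow2 of_nat_0_le_iff) linarith
      then have "\<bar>\<Sum>i<N. \<xi> i (s i)\<bar> \<le> \<epsilon> / \<tau> * sqrt (real N)"
        by (rule power2_le_imp_le[of "\<bar>\<Sum>i<N. \<xi> i (s i)\<bar>", unfolded power2_abs]) (use \<epsilon>0 \<tau>(1) in simp)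
      then have "\<bar>(\<mu> f - \<mu> (rep f)) * (\<Sum>i<N. \<xi> i (s i))\<bar> \<le> \<tau> * (\<epsilon> / \<tau> * sqrt (real N))"
        unfolding abs_mult using \<tau>(2)[OF f] by (intro mult_mono) (use \<tau>(1) in auto)
      also have "\<dots> = \<epsilon> * sqrt (real N)" using \<tau>(1) by simp
      finally have "\<bar>(\<Sum>i<N. \<xi> i (s i) * ?k (z i)) + (\<mu> f - \<mu> (rep f)) * (\<Sum>i<N. \<xi> i (s i))\<bar>
          \<le> 2 * \<epsilon> * sqrt (real N)" using 1 by linarith
      then show ?thesis unfolding split abs_divide using sN by (simp add: field_simps)
    qed
    then have "linf_dist F (\<lambda>f\<in>F. V s f) (lift_linf F rep (V s)) \<le> 2 * \<epsilon>"
      using \<epsilon>0 by (intro linf_dist_least) (auto simp: lift_linf_def)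
    then show ?thesis using BL1_linf_lipschitz[OF h V[of s] lift_in_linf[of "V s"]] False by simp
  qed
  have "\<bar>prod_exp N B q (\<lambda>s. h (\<lambda>f\<in>F. V s f)) - prod_exp N B q (\<lambda>s. h (lift_linf F rep (V s)))\<bar>
      \<le> prod_exp N B q (\<lambda>s. \<bar>h (\<lambda>f\<in>F. V s f) - h (lift_linf F rep (V s))\<bar>)"
    unfolding prod_exp_diff[symmetric] by (rule prod_exp_abs)
  also have "\<dots> \<le> prod_exp N B q (\<lambda>s. 2 * \<epsilon> + (of_bool (E1 s) + of_bool (E2 s)))"
    using pointwise by (rule prod_exp_mono)
  also have "\<dots> = 2 * \<epsilon> + (prod_exp N B q (\<lambda>s. of_bool (E1 s)) + prod_exp N B q (\<lambda>s. of_bool (E2 s)))"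
    unfolding prod_exp_add prod_exp_const ..
  finally show ?thesis using P1 P2 by linarith
qed

end

text \<open>The inclusion in the space guarantees a measurable cover; otherwise the infimum defining
  the outer probability could range over the empty set.\<close>

definition vanishing :: "'a measure \<Rightarrow> (nat \<Rightarrow> 'a set) \<Rightarrow> bool" where
  "vanishing M E \<longleftrightarrow> (\<forall>N. E N \<subseteq> space M) \<and> (\<lambda>N. outer_prob M (E N)) \<longlonglongrightarrow> 0"

lemma vanishing_measure:
  assumes "\<And>N. N \<ge> N0 \<Longrightarrow> E N \<subseteq> B N \<and> B N \<in> sets M" "\<And>N. E N \<subseteq> space M" "(\<lambda>N. measure M (B N)) \<longlonglongrightarrow> 0"
  shows "vanishing M E"
  unfolding vanishing_def
proof (intro conjI allI assms(2))
  show "(\<lambda>N. outer_prob M (E N)) \<longlonglongrightarrow> 0"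
  proof (rule Lim_null_comparison[OF _ assms(3)])
    show "eventually (\<lambda>N. norm (outer_prob M (E N)) \<le> measure M (B N)) sequentially"
      using assms(1) outer_prob_nonneg[OF assms(2)]
      by (intro eventually_sequentiallyI[of N0]) (auto intro: outer_prob_le)
  qed
qed

lemma vanishing_Un:
  assumes M: "prob_space M" and E: "vanishing M E" "vanishing M E'"
  shows "vanishing M (\<lambda>N. E N \<union> E' N)"
  unfolding vanishing_def
proof (intro conjI allI)
  interpret prob_space M by (rule M)
  have sub: "E N \<subseteq> space M" "E' N \<subseteq> space M" for N using E by (auto simp: vanishing_def)
  then show "E N \<union> E' N \<subseteq> space M" for N by blast
  show "(\<lambda>N. outer_prob M (E N \<union> E' N)) \<longlonglongrightarrow> 0"
  proof (rule Lim_null_comparison)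
    show "eventually (\<lambda>N. norm (outer_prob M (E N \<union> E' N)) \<le> outer_prob M (E N) + outer_prob M (E' N)) sequentially"
      using sub outer_prob_Un[OF finite_measure_axioms] outer_prob_nonneg[of _ M]
      by (intro always_eventually allI) simp
    show "(\<lambda>N. outer_prob M (E N) + outer_prob M (E' N)) \<longlonglongrightarrow> 0"
      using E tendsto_add[of "\<lambda>N. outer_prob M (E N)" 0 sequentially "\<lambda>N. outer_prob M (E' N)" 0]
      by (simp add: vanishing_def)
  qed
qed

lemma vanishing_empty: "vanishing M (\<lambda>_. {})"
proof (rule vanishing_measure[where B = "\<lambda>_. {}" and ?N0.0 = 0])
qed auto

lemma vanishing_UN:
  assumes "prob_space M" "finite I" "\<And>i. i \<in> I \<Longrightarrow> vanishing M (E i)"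
  shows "vanishing M (\<lambda>N. \<Union>i\<in>I. E i N)"
  using assms(2,3)
proof (induction I rule: finite_induct)
  case (insert i I)
  then show ?case using vanishing_Un[OF assms(1), of "E i" "\<lambda>N. \<Union>i\<in>I. E i N"] by simp
qed (simp add: vanishing_empty)

section \<open>The sampling design\<close>

text \<open>Where W < a \<le> b', the integrand strictly decreases between b and b'. Equal means
  would thus force W \<ge> a almost surely and make the mean at a equal to 1. The intermediate point
  a covers comparisons of a with larger and with smaller arguments.\<close>

lemma mean_truncated_strict_decreasing:
  fixes W :: "'a \<Rightarrow> real"
  assumes M: "prob_space M" and W: "W \<in> borel_measurable M" "\<And>x. W x > 0"
    and b: "0 < b" "b < b'" and a: "b \<le> a" "a \<le> b'" and less: "(\<integral>x. min (W x / a) 1 \<partial>M) < 1"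
  shows "(\<integral>x. min (W x / b') 1 \<partial>M) < (\<integral>x. min (W x / b) 1 \<partial>M)"
proof -
  interpret prob_space M by (rule M)
  have bound: "0 \<le> min (W x / t) 1" if "0 < t" for x t using W(2)[of x] that by simp
  have int: "integrable M (\<lambda>x. min (W x / t) 1)" if "0 < t" for t
    using W(1) bound[OF that] by (intro integrable_const_bound[where B = 1]) auto
  have le: "min (W x / b') 1 \<le> min (W x / b) 1" for x
    using b W(2)[of x] by (intro min.mono order_refl divide_left_mono) auto
  show ?thesis
  proof (rule ccontr)
    assume "\<not> ?thesis"
    moreover have "(\<integral>x. min (W x / b') 1 \<partial>M) \<le> (\<integral>x. min (W x / b) 1 \<partial>M)"
      using int b le by (intro integral_mono) auto
    ultimately have "(\<integral>x. min (W x / b) 1 - min (W x / b') 1 \<partial>M) = 0" using int b by simp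
    then have "AE x in M. min (W x / b) 1 - min (W x / b') 1 = 0"
      using int b le by (subst (asm) integral_nonneg_eq_0_iff_AE) auto
    moreover have "a \<le> W x" if "min (W x / b) 1 - min (W x / b') 1 = 0" for x
    proof (rule ccontr)
      assume "\<not> a \<le> W x"
      then have "W x / b' < 1" "W x / b' < W x / b"
        using a b W(2)[of x] by (auto simp: divide_strict_left_mono)
      then show False using that by (auto simp: min_def split: if_splits)
    qed
    ultimately have "AE x in M. a \<le> W x" by (auto elim: eventually_mono)
    then have "AE x in M. min (W x / a) 1 = 1" using a b by (auto elim!: eventually_mono)
    then have "(\<integral>x. min (W x / a) 1 \<partial>M) = (\<integral>x. 1 \<partial>M)" using W(1) by (intro integral_cong_AE) auto
    then show False using less by (simp add: prob_space)
  qed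
qed

text \<open>The normalization \<open>A\<close> solves an estimating equation that is monotone in \<open>A\<close>, so comparing it at
  the two points \<open>a \<plusminus> \<eta>\<close> suffices.\<close>

lemma normalization_close:
  fixes W :: "'a \<Rightarrow> real"
  assumes M: "prob_space M" and W: "W \<in> borel_measurable M" "\<And>x. W x > 0"
    and \<alpha>: "(\<integral>x. min (W x / a) 1 \<partial>M) = \<alpha>" "\<alpha> < 1" and \<eta>: "0 < \<eta>" "\<eta> < a"
  obtains \<rho> where "\<rho> > 0"
    "\<And>N (z :: nat \<Rightarrow> 'a) A m. \<lbrakk>N \<ge> 1; A > 0; (\<Sum>i<N. min (W (z i) / A) 1) = m; \<bar>m / real N - \<alpha>\<bar> \<le> \<rho>;
      \<bar>(\<Sum>i<N. min (W (z i) / (a + \<eta>)) 1) / real N - (\<integral>x. min (W x / (a + \<eta>)) 1 \<partial>M)\<bar> \<le> \<rho>;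
      \<bar>(\<Sum>i<N. min (W (z i) / (a - \<eta>)) 1) / real N - (\<integral>x. min (W x / (a - \<eta>)) 1 \<partial>M)\<bar> \<le> \<rho>\<rbrakk>
      \<Longrightarrow> \<bar>A - a\<bar> < \<eta>"
proof -
  define \<Psi> where "\<Psi> b = (\<integral>x. min (W x / b) 1 \<partial>M)" for b
  have up: "\<Psi> (a + \<eta>) < \<alpha>"
    using mean_truncated_strict_decreasing[OF M W, of a "a + \<eta>" a] \<alpha> \<eta> by (simp add: \<Psi>_def)
  have down: "\<alpha> < \<Psi> (a - \<eta>)"
    using mean_truncated_strict_decreasing[OF M W, of "a - \<eta>" a a] \<alpha> \<eta> by (simp add: \<Psi>_def)
  \<comment> \<open>Two errors of \<rho> each, one from the sample size and one from the empirical
    mean, must stay below gaps of at least 3\<rho>.\<close>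
  define \<rho> where "\<rho> = min (\<alpha> - \<Psi> (a + \<eta>)) (\<Psi> (a - \<eta>) - \<alpha>) / 3"
  have \<rho>: "\<rho> > 0" "3 * \<rho> \<le> \<alpha> - \<Psi> (a + \<eta>)" "3 * \<rho> \<le> \<Psi> (a - \<eta>) - \<alpha>"
    using up down by (auto simp: \<rho>_def)
  show ?thesis
  proof (rule that[OF \<rho>(1)])
    fix N :: nat and z :: "nat \<Rightarrow> 'a" and A m
    assume N: "N \<ge> 1" and A: "A > 0" and m: "(\<Sum>i<N. min (W (z i) / A) 1) = m" "\<bar>m / real N - \<alpha>\<bar> \<le> \<rho>"
      and E: "\<bar>(\<Sum>i<N. min (W (z i) / (a + \<eta>)) 1) / real N - (\<integral>x. min (W x / (a + \<eta>)) 1 \<partial>M)\<bar> \<le> \<rho>"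
        "\<bar>(\<Sum>i<N. min (W (z i) / (a - \<eta>)) 1) / real N - (\<integral>x. min (W x / (a - \<eta>)) 1 \<partial>M)\<bar> \<le> \<rho>"
    have mono: "(\<Sum>i<N. min (W (z i) / b') 1) / real N \<le> (\<Sum>i<N. min (W (z i) / b) 1) / real N"
      if "0 < b" "b \<le> b'" for b b'
      using W(2) that by (intro divide_right_mono sum_mono min.mono order_refl divide_left_mono)
        (auto intro: less_imp_le)
    have "\<not> A \<ge> a + \<eta>"
    proof
      assume "A \<ge> a + \<eta>"
      from mono[OF _ this] have "m / real N \<le> (\<Sum>i<N. min (W (z i) / (a + \<eta>)) 1) / real N" using \<eta> m(1) by simp
      then show False using E(1) m(2) \<rho> unfolding \<Psi>_def[symmetric] by linarith
    qed
    moreover have "\<not> A \<le> a - \<eta>"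
    proof
      assume "A \<le> a - \<eta>"
      from mono[OF A this] have "(\<Sum>i<N. min (W (z i) / (a - \<eta>)) 1) / real N \<le> m / real N" using m(1) by simp
      then show False using E(2) m(2) \<rho> unfolding \<Psi>_def[symmetric] by linarith
    qed
    ultimately show "\<bar>A - a\<bar> < \<eta>" by linarith
  qed
qed

section \<open>Sampling set-up, moments and exceptional population events\<close>

locale ht_sampling =
  fixes P :: "('y::{banach, second_countable_topology} \<times> 'x::{banach, second_countable_topology}) measure"
    and Pd :: "'d measure" and Pe :: "'e measure" and D :: "'d \<Rightarrow> real"
    and enum :: "nat \<Rightarrow> nat \<Rightarrow> (nat \<Rightarrow> nat)"
    and \<pi> :: "nat \<Rightarrow> (nat \<Rightarrow> 'x) \<Rightarrow> nat \<Rightarrow> real"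
    and w :: "'x \<Rightarrow> real" and c n :: "nat \<Rightarrow> (nat \<Rightarrow> 'x) \<Rightarrow> real"
    and F :: "('y \<Rightarrow> real) set" and \<alpha> \<theta> :: real
  assumes P: "prob_space P" "sets P = sets borel"
    and Pd: "prob_space Pd" and Pe: "prob_space Pe"
    and D: "D \<in> borel_measurable Pd" "distr Pd borel D = uniform_measure lborel {0..1}"
    and enum: "\<And>N. N \<ge> 1 \<Longrightarrow> bij_betw (enum N) {..<2 ^ N} (indicator_vectors N)"
    and w_pos: "\<And>x. w x > 0"
    and pi: "\<And>N x i. \<lbrakk>N \<ge> 1; x \<in> {..<N} \<rightarrow>\<^sub>E UNIV; i < N\<rbrakk> \<Longrightarrow>
               \<pi> N x i = min (c N x * (w (x i) / (\<Sum>j<N. w (x j)))) 1"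
    and c: "\<And>N x. \<lbrakk>N \<ge> 1; x \<in> {..<N} \<rightarrow>\<^sub>E UNIV\<rbrakk> \<Longrightarrow> c N x > 0 \<and> (\<Sum>i<N. \<pi> N x i) = n N x"
    and n_meas: "\<And>N. N \<ge> 1 \<Longrightarrow> n N \<in> borel_measurable (\<Pi>\<^sub>M i\<in>{..<N}. borel)"
    and \<alpha>: "\<alpha> \<in> {0<..<1}"
    and n_lim: "\<And>\<epsilon>. \<epsilon> > 0 \<Longrightarrow>
         (\<lambda>N. measure (sampling_space P Pd Pe)
            {\<omega> \<in> space (sampling_space P Pd Pe). \<bar>n N (Xvec N \<omega>) / real N - \<alpha>\<bar> > \<epsilon>}) \<longlonglongrightarrow> 0"
    and w_int: "integrable P (\<lambda>(y, x). w x)"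
    and theta: "\<theta> > 0" "(\<integral>(y, x). min (\<theta> * w x / mean_size P w) 1 \<partial>P) = \<alpha>"
    and Donsker: "Donsker_class P ((\<lambda>f. \<lambda>(y, x). f y / w_trunc P w \<theta> x) ` F)"
    and means: "bounded ((\<lambda>f. \<integral>(y, x). f y / w_trunc P w \<theta> x \<partial>P) ` F)"
begin

interpretation P: prob_space P by (rule P(1))

abbreviation \<Omega> :: "((nat \<Rightarrow> 'y \<times> 'x) \<times> 'd \<times> (nat \<Rightarrow> 'e)) measure" where
  "\<Omega> \<equiv> sampling_space P Pd Pe"

definition threshold :: real where "threshold = mean_size P w / \<theta>"

definition ratio :: "('y \<Rightarrow> real) \<Rightarrow> 'y \<times> 'x \<Rightarrow> real" where
  "ratio f = (\<lambda>(y, x). f y / w_trunc P w \<theta> x)"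

definition size_var :: "'y \<times> 'x \<Rightarrow> real" where "size_var z = w (snd z)"

text \<open>The size total and \<open>c\<close> enter the inclusion probabilities only through this
  quotient, which makes them monotone functions of one unknown.\<close>

definition normalization :: "nat \<Rightarrow> (nat \<Rightarrow> 'x) \<Rightarrow> real" where
  "normalization N x = (\<Sum>j<N. w (x j)) / c N x"

definition multiplier :: "nat \<Rightarrow> (nat \<Rightarrow> 'x) \<Rightarrow> nat \<Rightarrow> nat \<Rightarrow> real" where
  "multiplier N x i b = (real b / \<pi> N x i - 1) * min (w (x i)) threshold"

lemma space_P: "space P = UNIV"
  using sets_eq_imp_space_eq[OF P(2)] by simp

lemma space_seq: "space P.sequence_space = UNIV"
  by (simp add: space_PiM space_P)

lemma size_var_pos: "size_var z > 0"
  by (simp add: size_var_def w_pos)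

lemma size_var_nonneg: "size_var z \<ge> 0"
  using size_var_pos by (rule less_imp_le)

lemma size_var_int: "integrable P size_var"
  using w_int by (simp add: size_var_def[abs_def] case_prod_unfold)

lemma size_var_meas [measurable]: "size_var \<in> borel_measurable P"
  using size_var_int by simp

lemma threshold_pos: "threshold > 0"
proof -
  have "mean_size P w = integral\<^sup>L P size_var"
    by (simp add: mean_size_def size_var_def[abs_def] case_prod_unfold)
  moreover have "integral\<^sup>L P size_var \<noteq> 0"
  proof
    assume "integral\<^sup>L P size_var = 0"
    then have "AE z in P. size_var z = 0"
      using size_var_int by (subst (asm) integral_nonneg_eq_0_iff_AE) (auto simp: size_var_nonneg)
    then have "AE z in P. False" by eventually_elim (metis less_irrefl size_var_pos)
    then show False by simp
  qed
  moreover have "0 \<le> integral\<^sup>L P size_var" by (intro Bochner_Integration.integral_nonneg) (simp add: size_var_nonneg)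
  ultimately show ?thesis using theta(1) by (simp add: threshold_def)
qed

lemma w_trunc_eq: "w_trunc P w \<theta> x = min (w x) threshold"
  by (simp add: w_trunc_def threshold_def)

lemma w_trunc_pos: "w_trunc P w \<theta> x > 0"
  by (simp add: w_trunc_eq w_pos threshold_pos)

lemma threshold_eq: "(\<integral>z. min (size_var z / threshold) 1 \<partial>P) = \<alpha>"
proof -
  have "min (size_var z / threshold) 1 = (case z of (y, x) \<Rightarrow> min (\<theta> * w x / mean_size P w) 1)" for z
    by (simp add: size_var_def threshold_def case_prod_unfold mult.commute)
  then show ?thesis using theta(2) by simp
qed

lemma ratio_int: "f \<in> F \<Longrightarrow> integrable P (ratio f)"
  using Donsker unfolding Donsker_class_def ratio_def by blast

lemma ratio_meas: "f \<in> F \<Longrightarrow> ratio f \<in> borel_measurable P"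
  using ratio_int by blast

lemma ratio_square_int: "f \<in> F \<Longrightarrow> integrable P (\<lambda>z. (ratio f z)\<^sup>2)"
  using P.Donsker_class_square_integrable[OF Donsker] unfolding ratio_def by blast

lemma ratio_prod_int:
  assumes "f \<in> F" "g \<in> F"
  shows "integrable P (\<lambda>z. ratio f z * ratio g z)"
proof (rule Bochner_Integration.integrable_bound)
  show "integrable P (\<lambda>z. (ratio f z)\<^sup>2 + (ratio g z)\<^sup>2)" using ratio_square_int assms by simp
  show "AE z in P. norm (ratio f z * ratio g z) \<le> norm ((ratio f z)\<^sup>2 + (ratio g z)\<^sup>2)"
  proof (rule AE_I2)
    fix z
    have "2 * (\<bar>ratio f z\<bar> * \<bar>ratio g z\<bar>) \<le> (ratio f z)\<^sup>2 + (ratio g z)\<^sup>2"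
      using sum_squares_bound[of "\<bar>ratio f z\<bar>" "\<bar>ratio g z\<bar>"] by simp
    moreover have "0 \<le> \<bar>ratio f z\<bar> * \<bar>ratio g z\<bar>" by simp
    ultimately have "\<bar>ratio f z\<bar> * \<bar>ratio g z\<bar> \<le> (ratio f z)\<^sup>2 + (ratio g z)\<^sup>2" by linarith
    then show "norm (ratio f z * ratio g z) \<le> norm ((ratio f z)\<^sup>2 + (ratio g z)\<^sup>2)" by (simp add: abs_mult)
  qed
qed (use ratio_meas assms in measurable)

lemma Sigma_eq:
  "Sigma_HT P w \<theta> f g = (\<integral>z. ht_variance threshold threshold (size_var z) * (ratio f z * ratio g z) \<partial>P)"
  unfolding Sigma_HT_def
proof (intro Bochner_Integration.integral_cong refl)
  fix z :: "'y \<times> 'x"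
  obtain y x where z: "z = (y, x)" by (cases z)
  have m: "min (w x) threshold > 0" using w_trunc_pos[of x] by (simp add: w_trunc_eq)
  have "ht_variance threshold threshold (w x) = (threshold - min (w x) threshold) * min (w x) threshold"
    using m by (simp add: ht_variance_def power2_eq_square)
  moreover have "(case z of (y, x) \<Rightarrow> w_trunc P w \<theta> x * (mean_size P w / \<theta> - w_trunc P w \<theta> x) *
        (f y * g y / (w_trunc P w \<theta> x)\<^sup>2)) =
      min (w x) threshold * (threshold - min (w x) threshold) * (f y * g y / (min (w x) threshold)\<^sup>2)"
    by (simp add: z w_trunc_eq threshold_def)
  moreover have "ratio f z * ratio g z = f y / min (w x) threshold * (g y / min (w x) threshold)"
    by (simp add: z ratio_def w_trunc_eq)
  moreover have "m * (t - m) * (p * q / m\<^sup>2) = (t - m) * m * (p / m * (q / m))" if "m > 0" for m t p q :: real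
    using that by (simp add: power2_eq_square)
  ultimately show "(case z of (y, x) \<Rightarrow> w_trunc P w \<theta> x * (mean_size P w / \<theta> - w_trunc P w \<theta> x) *
        (f y * g y / (w_trunc P w \<theta> x)\<^sup>2)) = ht_variance threshold threshold (size_var z) * (ratio f z * ratio g z)"
    using m by (simp only: z size_var_def snd_conv)
qed

lemma ht_variance_bound: "\<bar>ht_variance threshold threshold (size_var z)\<bar> \<le> threshold\<^sup>2"
proof -
  have m: "0 < min (size_var z) threshold" using size_var_pos threshold_pos by simp
  have "ht_variance threshold threshold (size_var z) = (threshold - min (size_var z) threshold) * min (size_var z) threshold"
    using m by (simp add: ht_variance_def power2_eq_square)
  then show ?thesis
    using m by (simp add: abs_mult power2_eq_square) (intro mult_mono; simp)
qed

lemma ht_variance_meas [measurable]: "(\<lambda>z. ht_variance threshold threshold (size_var z)) \<in> borel_measurable P"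
  unfolding ht_variance_def by measurable

lemma sampling_marginal: "distr \<Omega> P.sequence_space fst = P.sequence_space"
  and fst_meas: "fst \<in> measurable \<Omega> P.sequence_space"
proof -
  have "prob_space (Pd \<Otimes>\<^sub>M (\<Pi>\<^sub>M i\<in>(UNIV :: nat set). Pe))"
    by (intro prob_space_pair prob_space_PiM Pd Pe)
  then show "distr \<Omega> P.sequence_space fst = P.sequence_space"
    unfolding sampling_space_def by (rule prob_space.distr_pair_fst)
  show "fst \<in> measurable \<Omega> P.sequence_space" unfolding sampling_space_def by simp
qed

lemma prob_space_sampling: "prob_space \<Omega>"
  unfolding sampling_space_def by (intro prob_space_pair prob_space_PiM P Pd Pe)

text \<open>Events that depend on the population alone are estimated on its sequence space, because
  the projection preserves measure.\<close>

lemma outer_prob_fst: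
  "outer_prob \<Omega> {\<omega> \<in> space \<Omega>. Q (fst \<omega>)} \<le> outer_prob P.sequence_space {z \<in> space P.sequence_space. Q z}"
proof -
  have "{\<omega> \<in> space \<Omega>. Q (fst \<omega>)} = {\<omega> \<in> space \<Omega>. fst \<omega> \<in> {z \<in> space P.sequence_space. Q z}}"
    by (auto simp: space_seq)
  also have "outer_prob \<Omega> \<dots> \<le> outer_prob P.sequence_space {z \<in> space P.sequence_space. Q z}"
    by (rule outer_prob_preimage_le[OF fst_meas sampling_marginal]) auto
  finally show ?thesis .
qed

lemma vanishing_fst:
  assumes lim: "(\<lambda>N. measure P.sequence_space {z \<in> space P.sequence_space. Q N z}) \<longlonglongrightarrow> 0"
    and meas: "\<And>N. {z \<in> space P.sequence_space. Q N z} \<in> sets P.sequence_space"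
  shows "vanishing \<Omega> (\<lambda>N. {\<omega> \<in> space \<Omega>. Q N (fst \<omega>)})"
  unfolding vanishing_def
proof (intro conjI allI Lim_null_comparison[OF _ lim] always_eventually)
  fix N
  have "outer_prob \<Omega> {\<omega> \<in> space \<Omega>. Q N (fst \<omega>)} \<le> measure P.sequence_space {z \<in> space P.sequence_space. Q N z}"
    using outer_prob_fst[of "Q N"] outer_prob_le[OF meas[of N] order_refl] by linarith
  then show "norm (outer_prob \<Omega> {\<omega> \<in> space \<Omega>. Q N (fst \<omega>)}) \<le> measure P.sequence_space {z \<in> space P.sequence_space. Q N z}"
    using outer_prob_nonneg[of "{\<omega> \<in> space \<Omega>. Q N (fst \<omega>)}" \<Omega>] by simp
qed auto

lemma Xvec_PiE: "Xvec N \<omega> \<in> {..<N} \<rightarrow>\<^sub>E UNIV"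
  by (simp add: Xvec_def)

lemma Xvec_meas: "Xvec N \<in> measurable \<Omega> (\<Pi>\<^sub>M i\<in>{..<N}. borel)"
  unfolding Xvec_def
proof (rule measurable_restrict)
  fix i
  have "snd \<in> measurable P borel"
    unfolding measurable_cong_sets[OF P(2) refl] by (intro borel_measurable_continuous_onI continuous_intros)
  moreover have "(\<lambda>\<omega>. fst \<omega> i) \<in> measurable \<Omega> P"
    by (rule measurable_compose[OF fst_meas P.sequence_component_measurable])
  ultimately show "(\<lambda>\<omega>. snd (fst \<omega> i)) \<in> measurable \<Omega> borel"
    by (rule measurable_compose[rotated])
qed

lemma vanishing_sample_size:
  assumes "\<rho> > 0"
  shows "vanishing \<Omega> (\<lambda>N. {\<omega> \<in> space \<Omega>. \<bar>n N (Xvec N \<omega>) / real N - \<alpha>\<bar> > \<rho>})"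
proof (rule vanishing_measure[OF _ _ n_lim[OF assms], where ?N0.0 = 1])
  fix N :: nat assume "N \<ge> 1"
  then have [measurable]: "(\<lambda>\<omega>. n N (Xvec N \<omega>)) \<in> borel_measurable \<Omega>"
    using measurable_compose[OF Xvec_meas n_meas] by blast
  show "{\<omega> \<in> space \<Omega>. \<bar>n N (Xvec N \<omega>) / real N - \<alpha>\<bar> > \<rho>} \<subseteq> {\<omega> \<in> space \<Omega>. \<rho> < \<bar>n N (Xvec N \<omega>) / real N - \<alpha>\<bar>}
      \<and> {\<omega> \<in> space \<Omega>. \<rho> < \<bar>n N (Xvec N \<omega>) / real N - \<alpha>\<bar>} \<in> sets \<Omega>"
    by auto
qed auto

context
  fixes N :: nat and x :: "nat \<Rightarrow> 'x"
  assumes N: "N \<ge> 1" and x: "x \<in> {..<N} \<rightarrow>\<^sub>E UNIV"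
begin

lemma sum_w_pos: "(\<Sum>j<N. w (x j)) > 0"
  using N w_pos by (intro sum_pos) (auto simp: lessThan_empty_iff)

lemma normalization_pos: "normalization N x > 0"
  using sum_w_pos c[OF N x] by (simp add: normalization_def)

lemma pi_eq: "i < N \<Longrightarrow> \<pi> N x i = min (w (x i) / normalization N x) 1"
  using pi[OF N x] sum_w_pos c[OF N x] by (simp add: normalization_def mult.commute)

lemma design_weights: "product_weights N {0, 1} (bernoulli_weight (\<pi> N x))"
  using ht_multiplier(1)[OF w_pos normalization_pos threshold_pos pi_eq]
  by (intro bernoulli_product_weights) (auto simp: less_imp_le)

lemma multiplier_centered: "i < N \<Longrightarrow> (\<Sum>b\<in>{0, 1}. bernoulli_weight (\<pi> N x) i b * multiplier N x i b) = 0"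
  using ht_multiplier(2)[OF w_pos normalization_pos threshold_pos pi_eq] unfolding bernoulli_weight_def multiplier_def .

lemma multiplier_bound: "i < N \<Longrightarrow> b \<in> {0, 1} \<Longrightarrow> \<bar>multiplier N x i b\<bar> \<le> max (normalization N x) threshold"
  using ht_multiplier(3)[OF w_pos normalization_pos threshold_pos pi_eq] unfolding multiplier_def .

lemma multiplier_variance: "i < N \<Longrightarrow>
    (\<Sum>b\<in>{0, 1}. bernoulli_weight (\<pi> N x) i b * (multiplier N x i b)\<^sup>2) = ht_variance threshold (normalization N x) (w (x i))"
  using ht_multiplier(4)[OF w_pos normalization_pos threshold_pos pi_eq] unfolding bernoulli_weight_def multiplier_def .

end

definition design_process :: "nat \<Rightarrow> (nat \<Rightarrow> 'y \<times> 'x) \<Rightarrow> (nat \<Rightarrow> 'x) \<Rightarrow> (nat \<Rightarrow> nat) \<Rightarrow> ('y \<Rightarrow> real) \<Rightarrow> real" where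
  "design_process N z x s f = (\<Sum>i<N. multiplier N x i (s i) * (ratio f (z i) / sqrt (real N)))"

text \<open>The identity holds at every \<omega> and for arbitrary h, as the expectation over the
  design is a finite sum. The truncated size in \<open>multiplier\<close> cancels the one in
  \<open>ratio\<close>.\<close>

lemma design_expectation_HT:
  assumes N: "N \<ge> 1"
  shows "design_expectation Pd (\<lambda>\<eta>. h (HT_process F D enum \<pi> N \<eta>)) \<omega> =
    prod_exp N {0, 1} (bernoulli_weight (\<pi> N (Xvec N \<omega>))) (\<lambda>s. h (\<lambda>f\<in>F. design_process N (fst \<omega>) (Xvec N \<omega>) s f))"
proof -
  let ?g = "\<lambda>s y x. h (\<lambda>f\<in>F. (1 / sqrt (real N)) * (\<Sum>i<N. (real (s i) / \<pi> N x i - 1) * f (y i)))"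
  have "design_expectation Pd (\<lambda>\<eta>. h (HT_process F D enum \<pi> N \<eta>)) \<omega> =
      (\<Sum>s\<in>indicator_vectors N. ?g s (Yseq \<omega>) (Xvec N \<omega>) * poisson_prob N (\<pi> N (Xvec N \<omega>)) s)"
    unfolding HT_process_def
  proof (rule design_expectation_eq_sum[where enum = enum and N = N and \<pi> = \<pi> and \<omega> = \<omega> and g = ?g, OF D enum[OF N]])
    fix i assume "i < N"
    from ht_multiplier(1)[OF w_pos normalization_pos[OF N Xvec_PiE] threshold_pos pi_eq[OF N Xvec_PiE this], of \<omega>]
    show "\<pi> N (Xvec N \<omega>) i \<in> {0..1}" by simp
  qed
  also have "\<dots> = prod_exp N {0, 1} (bernoulli_weight (\<pi> N (Xvec N \<omega>))) (\<lambda>s. ?g s (Yseq \<omega>) (Xvec N \<omega>))"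
    by (simp only: prod_exp_bernoulli)
  also have "(\<lambda>s. ?g s (Yseq \<omega>) (Xvec N \<omega>)) = (\<lambda>s. h (\<lambda>f\<in>F. design_process N (fst \<omega>) (Xvec N \<omega>) s f))"
  proof (rule ext, rule arg_cong[of _ _ h], rule restrict_ext)
    fix s f
    assume "f \<in> F"
    have "multiplier N (Xvec N \<omega>) i (s i) * (ratio f (fst \<omega> i) / sqrt (real N)) =
        (1 / sqrt (real N)) * ((real (s i) / \<pi> N (Xvec N \<omega>) i - 1) * f (Yseq \<omega> i))" if "i < N" for i
      using that less_imp_neq[OF w_trunc_pos[of "snd (fst \<omega> i)"], unfolded w_trunc_eq, symmetric]
      by (simp add: multiplier_def ratio_def w_trunc_eq Xvec_def Yseq_def case_prod_unfold)
    then show "(1 / sqrt (real N)) * (\<Sum>i<N. (real (s i) / \<pi> N (Xvec N \<omega>) i - 1) * f (Yseq \<omega> i)) =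
        design_process N (fst \<omega>) (Xvec N \<omega>) s f"
      unfolding design_process_def sum_distrib_left by (intro sum.cong) auto
  qed
  finally show ?thesis .
qed

text \<open>The Donsker property bounds the centred values at a point and the assumption on the
  means bounds the centring. Both are needed for the uncentred process to have paths in
  \<open>linf F\<close>.\<close>

lemma ratio_bounded: "bounded ((\<lambda>f. ratio f z) ` F)"
proof -
  have 1: "bounded ((\<lambda>g. g z - integral\<^sup>L P g) ` ratio ` F)"
    using Donsker space_P unfolding Donsker_class_def ratio_def by blast
  have "bounded ((\<lambda>f. (ratio f z - integral\<^sup>L P (ratio f)) + integral\<^sup>L P (ratio f)) ` F)"
    using 1 means unfolding image_image by (intro bounded_plus_comp) (simp_all add: ratio_def)
  then show ?thesis by simp
qed

lemma design_process_linf: "(\<lambda>f\<in>F. design_process N z x s f) \<in> linf F"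
proof -
  have "bounded ((\<lambda>f. \<Sum>i<m. multiplier N x i (s i) * (ratio f (z i) / sqrt (real N))) ` F)" for m
  proof (induction m)
    case (Suc m)
    have "bounded ((\<lambda>f. (multiplier N x m (s m) / sqrt (real N)) *\<^sub>R ratio f (z m)) ` F)"
      using bounded_scaling[OF ratio_bounded[of "z m"], of "multiplier N x m (s m) / sqrt (real N)"] by (simp add: image_image)
    then show ?case using bounded_plus_comp[OF Suc] by simp
  qed (auto simp: bounded_iff)
  then show ?thesis by (simp add: linf_def design_process_def)
qed

lemma vanishing_average:
  assumes \<phi>: "integrable P \<phi>" and \<kappa>: "\<kappa> > 0"
  shows "vanishing \<Omega> (\<lambda>N. {\<omega> \<in> space \<Omega>. \<bar>(\<Sum>i<N. \<phi> (fst \<omega> i)) / real N - integral\<^sup>L P \<phi>\<bar> > \<kappa>})"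
proof (rule vanishing_fst)
  have [measurable]: "\<phi> \<in> borel_measurable P" using \<phi> by simp
  show "{z \<in> space P.sequence_space. \<bar>(\<Sum>i<N. \<phi> (z i)) / real N - integral\<^sup>L P \<phi>\<bar> > \<kappa>} \<in> sets P.sequence_space" for N
    by measurable
  show "(\<lambda>N. measure P.sequence_space {z \<in> space P.sequence_space. \<bar>(\<Sum>i<N. \<phi> (z i)) / real N - integral\<^sup>L P \<phi>\<bar> > \<kappa>}) \<longlonglongrightarrow> 0"
    using \<phi> \<kappa> by (rule P.weak_law)
qed

text \<open>The summands change with N, so the law of large numbers for a fixed function does not
  apply. Their mean tends to 0 by dominated convergence with majorant B^2, and Markov's inequality
  concludes.\<close>

lemma vanishing_lindeberg:
  assumes B: "B \<in> borel_measurable P" "\<And>z. 0 \<le> B z" "integrable P (\<lambda>z. (B z)\<^sup>2)" and \<delta>: "\<delta> > 0"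
  shows "vanishing \<Omega> (\<lambda>N. {\<omega> \<in> space \<Omega>. (\<Sum>i<N. (B (fst \<omega> i))\<^sup>2 * min 1 (B (fst \<omega> i) / sqrt (real N))) / real N \<ge> \<delta>})"
proof (rule vanishing_fst)
  note [measurable] = B(1)
  show "{z \<in> space P.sequence_space. (\<Sum>i<N. (B (z i))\<^sup>2 * min 1 (B (z i) / sqrt (real N))) / real N \<ge> \<delta>} \<in> sets P.sequence_space" for N
    by measurable
  let ?\<psi> = "\<lambda>N z. (B z)\<^sup>2 * min 1 (B z / sqrt (real N))"
  have \<psi>0: "0 \<le> ?\<psi> N z" for N z using B(2) by simp
  have \<psi>1: "?\<psi> N z \<le> (B z)\<^sup>2" for N z using B(2) by (intro mult_left_le) auto
  have int: "integrable P (?\<psi> N)" for N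
    using \<psi>0 \<psi>1 by (intro Bochner_Integration.integrable_bound[OF B(3)]) auto
  have "(\<lambda>N. integral\<^sup>L P (?\<psi> N)) \<longlonglongrightarrow> (\<integral>z. 0 \<partial>P)"
  proof (rule integral_dominated_convergence[OF _ _ B(3)])
    show "AE z in P. (\<lambda>N. ?\<psi> N z) \<longlonglongrightarrow> 0"
    proof (rule AE_I2, rule tendsto_mult_right_zero)
      fix z
      have "(\<lambda>N. B z / sqrt (real N)) \<longlonglongrightarrow> 0"
        by (intro tendsto_divide_0[OF tendsto_const] filterlim_at_top_imp_at_infinity
            filterlim_compose[OF sqrt_at_top filterlim_real_sequentially])
      then have "(\<lambda>N. min 1 (B z / sqrt (real N))) \<longlonglongrightarrow> min 1 0" by (intro tendsto_min tendsto_const)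
      then show "(\<lambda>N. min 1 (B z / sqrt (real N))) \<longlonglongrightarrow> 0" by simp
    qed
  qed (use \<psi>0 \<psi>1 in auto)
  then have lim: "(\<lambda>N. integral\<^sup>L P (?\<psi> N) / \<delta>) \<longlonglongrightarrow> 0"
    using tendsto_divide[of "\<lambda>N. integral\<^sup>L P (?\<psi> N)" 0 sequentially "\<lambda>_. \<delta>" \<delta>] \<delta> by simp
  show "(\<lambda>N. measure P.sequence_space {z \<in> space P.sequence_space. (\<Sum>i<N. (B (z i))\<^sup>2 * min 1 (B (z i) / sqrt (real N))) / real N \<ge> \<delta>}) \<longlonglongrightarrow> 0"
    using P.average_markov[OF int \<psi>0 \<delta>] by (intro Lim_null_comparison[OF _ lim] always_eventually allI) simp
qed

lemma zero_in_BL1_linf: "(\<lambda>_. 0) \<in> BL1_linf F"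
  by (simp add: BL1_linf_def linf_dist_nonneg)

text \<open>All constants, the partition and the representatives are fixed before N. Outside the
  population events \<open>R N\<close> and \<open>bad N\<close> the estimate is deterministic and
  holds for all h together, so the supremum needs no measurability.\<close>

lemma HT_conditional_weak_convergence:
  fixes M' :: "'g measure" and G' :: "'g \<Rightarrow> ('y \<Rightarrow> real) \<Rightarrow> real"
  assumes M: "prob_space M'" and G: "G' \<in> M' \<rightarrow>\<^sub>M linf_borel F"
    and tight: "tight_measure_on (linf_topology F) (distr M' (linf_borel F) G')"
    and gauss: "centered_gaussian_process M' F (Sigma_HT P w \<theta>) G'"
  shows "tendsto_zero_outer_prob \<Omega> (\<lambda>N \<omega>. SUP h\<in>BL1_linf F.
       \<bar>design_expectation Pd (\<lambda>\<eta>. h (HT_process F D enum \<pi> N \<eta>)) \<omega> - (\<integral>\<omega>'. h (G' \<omega>') \<partial>M')\<bar>)"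
  unfolding tendsto_zero_outer_prob_def
proof (intro allI impI LIMSEQ_I)
  fix e0 \<eta>0 :: real assume e0: "e0 > 0" and \<eta>0: "\<eta>0 > 0"
  interpret S: prob_space \<Omega> by (rule prob_space_sampling)
  define a where "a = threshold"
  \<comment> \<open>\<open>C\<close> is at least 1 and bounds max A a once \<bar>A - a\<bar> < a.
    The cap 1/12 on \<epsilon> is the threshold of the Rademacher comparison and e0 / 10 gives
    8\<epsilon> < e0. The others are solved from C^2 \<tau>^2 / \<epsilon>^2 = \<epsilon>^2, 12 C u
    = \<epsilon> and 2 e1 / \<epsilon> = \<eta>0 / 4.\<close>
  define C where "C = 2 * a + 1"
  define \<epsilon> where "\<epsilon> = min (1 / 12) (e0 / 10)"
  define \<tau> where "\<tau> = \<epsilon>\<^sup>2 / C"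
  define u where "u = \<epsilon> / (12 * C)"
  define e1 where "e1 = \<eta>0 * \<epsilon> / 8"
  define H where "H = ratio ` F"
  define \<mu> where "\<mu> f = integral\<^sup>L P (ratio f)" for f
  have a: "a > 0" unfolding a_def by (rule threshold_pos)
  have C: "C > 0" "1 \<le> C" "2 * a \<le> C" using a by (auto simp: C_def)
  have \<epsilon>: "\<epsilon> > 0" "\<epsilon> \<le> 1 / 12" "8 * \<epsilon> < e0" using e0 by (auto simp: \<epsilon>_def)
  have \<tau>: "\<tau> > 0" and u: "u > 0" and e1: "e1 > 0" using \<epsilon> C \<eta>0 by (auto simp: \<tau>_def u_def e1_def)
  have DH: "Donsker_class P H" using Donsker by (simp add: H_def ratio_def[abs_def])
  interpret M: prob_space M' by (rule M)
  obtain bump :: "(('y \<Rightarrow> real) \<Rightarrow> real) \<Rightarrow> real" and c1 :: "('y \<Rightarrow> real) \<Rightarrow> (('y \<Rightarrow> real) \<Rightarrow> real) \<Rightarrow> int"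
    where bump: "finite (c1 ` F)" "continuous_map (linf_topology F) euclideanreal bump"
      "integral\<^sup>L (distr M' (linf_borel F) G') bump \<le> \<epsilon>" "\<And>z. 0 \<le> bump z" "\<And>z. bump z \<le> 1"
      "\<And>z f g. z \<in> linf F \<Longrightarrow> bump z < 1 \<Longrightarrow> f \<in> F \<Longrightarrow> g \<in> F \<Longrightarrow> c1 f = c1 g \<Longrightarrow> \<bar>z f - z g\<bar> \<le> \<epsilon>"
    by (rule tight_finite_partition[OF M.prob_space_distr[OF G] sets_distr tight \<epsilon>(1) \<epsilon>(1)]) (rule that; assumption)
  obtain c2 :: "('y \<times> 'x \<Rightarrow> real) \<Rightarrow> (('y \<times> 'x \<Rightarrow> real) \<Rightarrow> real) \<Rightarrow> int" and N1
    where c2: "finite (c2 ` H)" and N1: "\<And>m. m \<ge> N1 \<Longrightarrow> outer_prob P.sequence_space {z \<in> space P.sequence_space.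
        \<exists>k\<in>osc_class P H c2. \<bar>\<Sum>i<m. k (z i)\<bar> > u * sqrt (real m)} < e1"
    using Donsker_class_tails(1)[OF P(1) DH u e1] by blast
  \<comment> \<open>A common refinement of three partitions: one for the paths of the limit process,
    one for the empirical process of the quotient class and one for its means.\<close>
  define lab where "lab f = (c1 f, c2 (ratio f), \<lfloor>\<mu> f / \<tau>\<rfloor>)" for f
  have fin3: "finite ((\<lambda>f. \<lfloor>\<mu> f / \<tau>\<rfloor>) ` F)"
  proof -
    obtain t where t: "\<And>f. f \<in> F \<Longrightarrow> \<bar>\<mu> f\<bar> \<le> t" using means unfolding bounded_iff \<mu>_def ratio_def by auto
    have "(\<lambda>f. \<lfloor>\<mu> f / \<tau>\<rfloor>) ` F \<subseteq> {\<lfloor>- t / \<tau>\<rfloor>..\<lfloor>t / \<tau>\<rfloor>}"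
    proof clarify
      fix f assume "f \<in> F"
      then have "- t \<le> \<mu> f" "\<mu> f \<le> t" using t[of f] by linarith+
      then have "- t / \<tau> \<le> \<mu> f / \<tau>" "\<mu> f / \<tau> \<le> t / \<tau>"
        using \<tau> by (meson divide_right_mono less_imp_le)+
      then show "\<lfloor>\<mu> f / \<tau>\<rfloor> \<in> {\<lfloor>- t / \<tau>\<rfloor>..\<lfloor>t / \<tau>\<rfloor>}" by (auto intro: floor_mono)
    qed
    then show ?thesis using finite_subset by blast
  qed
  have "lab ` F \<subseteq> c1 ` F \<times> c2 ` H \<times> (\<lambda>f. \<lfloor>\<mu> f / \<tau>\<rfloor>) ` F" by (auto simp: lab_def H_def)
  then have "finite (lab ` F)"
    by (rule finite_subset) (intro finite_cartesian_product bump(1) c2 fin3)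
  then obtain rep where rep: "finite (rep ` F)" "rep ` F \<subseteq> F" and rep_lab: "\<And>f. f \<in> F \<Longrightarrow> lab (rep f) = lab f"
    by (rule exists_representatives) (rule that; assumption)
  have rep_c1: "c1 f = c1 (rep f)" and rep_c2: "c2 (ratio f) = c2 (ratio (rep f))" if "f \<in> F" for f
    using rep_lab[OF that] by (auto simp: lab_def)
  have rep_\<mu>: "\<bar>\<mu> f - \<mu> (rep f)\<bar> \<le> \<tau>" if "f \<in> F" for f
  proof -
    have "\<lfloor>\<mu> (rep f) / \<tau>\<rfloor> = \<lfloor>\<mu> f / \<tau>\<rfloor>" using rep_lab[OF that] by (simp add: lab_def)
    then have "\<bar>\<mu> f / \<tau> - \<mu> (rep f) / \<tau>\<bar> \<le> 1" by linarith
    then have "\<bar>\<mu> f - \<mu> (rep f)\<bar> / \<tau> \<le> 1" using \<tau> by (simp add: diff_divide_distrib[symmetric] abs_divide)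
    then show ?thesis using \<tau> by (simp add: field_simps)
  qed
  define J where "J = rep ` F"
  have J: "finite J" "J \<subseteq> F" using rep by (auto simp: J_def)
  have G_meas: "(\<lambda>\<omega>. G' \<omega> f) \<in> borel_measurable M'" if "f \<in> J" for f
    using gauss J(2) that unfolding centered_gaussian_process_def gaussian_process_def by blast
  obtain \<delta> where \<delta>: "\<delta> > 0" and clt: "\<forall>N q \<xi> v. product_weights N {0, 1 :: nat} q \<longrightarrow>
      (\<forall>i<N. (\<Sum>b\<in>{0, 1}. q i b * \<xi> i b) = 0) \<longrightarrow> (\<forall>i<N. \<forall>b\<in>{0, 1}. \<bar>\<xi> i b\<bar> \<le> C) \<longrightarrow>
      (\<forall>f\<in>J. \<forall>g\<in>J. \<bar>(\<Sum>i<N. (\<Sum>b\<in>{0, 1}. q i b * (\<xi> i b)\<^sup>2) * (v i f * v i g)) - Sigma_HT P w \<theta> f g\<bar> \<le> \<delta>) \<longrightarrow>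
      (\<Sum>i<N. (\<Sum>f\<in>J. \<bar>v i f\<bar>)\<^sup>2 * min 1 (\<Sum>f\<in>J. \<bar>v i f\<bar>)) \<le> \<delta> \<longrightarrow>
      (\<forall>h\<in>coord_BL1 J. (\<lambda>\<omega>. h (G' \<omega>)) \<in> borel_measurable M' \<longrightarrow>
        \<bar>prod_exp N {0, 1} q (\<lambda>s. h (\<lambda>f. \<Sum>i<N. \<xi> i (s i) * v i f)) - (\<integral>\<omega>. h (G' \<omega>) \<partial>M')\<bar> \<le> \<epsilon>)"
    using bounded_multiplier_clt[OF M J(1) G_meas centered_gaussian_charfun[OF M gauss J] C(2) \<epsilon>(1), where B = "{0, 1 :: nat}"]
    by blast
  define m2 where "m2 f g = (\<integral>z. \<bar>ratio f z * ratio g z\<bar> \<partial>P)" for f g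
  define S2 where "S2 = (\<Sum>p\<in>J \<times> J. m2 (fst p) (snd p))"
  have m2: "0 \<le> m2 f g" for f g unfolding m2_def by (intro Bochner_Integration.integral_nonneg) simp
  have S2: "0 \<le> S2" unfolding S2_def by (intro sum_nonneg m2)
  have m2_le: "m2 f g \<le> S2" if "f \<in> J" "g \<in> J" for f g
    unfolding S2_def using member_le_sum[of "(f, g)" "J \<times> J" "\<lambda>p. m2 (fst p) (snd p)"] that J(1) m2 by simp
  \<comment> \<open>Exchanging A for a changes an empirical covariance by at most a \<eta> times an
    average that is kept below S2 + 1, hence by at most \<delta> / 2. The bound a / 2 keeps a -
    \<eta> positive.\<close>
  define \<eta> where "\<eta> = min (a / 2) (\<delta> / (2 * a * (S2 + 1)))"
  have \<eta>: "0 < \<eta>" "\<eta> < a" "a * \<eta> * (S2 + 1) \<le> \<delta> / 2"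
  proof -
    show "0 < \<eta>" "\<eta> < a" using a \<delta> S2 by (auto simp: \<eta>_def)
    have "\<eta> \<le> \<delta> / (2 * a * (S2 + 1))" by (simp add: \<eta>_def)
    moreover have "2 * a * (S2 + 1) > 0" using a S2 by simp
    ultimately have "\<eta> * (2 * a * (S2 + 1)) \<le> \<delta>" by (simp only: pos_le_divide_eq)
    then show "a * \<eta> * (S2 + 1) \<le> \<delta> / 2" by (simp add: mult_ac)
  qed
  have \<alpha>1: "\<alpha> < 1" using \<alpha> by simp
  obtain \<rho> where \<rho>: "\<rho> > 0" and close: "\<And>N (z :: nat \<Rightarrow> 'y \<times> 'x) A m. \<lbrakk>N \<ge> 1; A > 0;
      (\<Sum>i<N. min (size_var (z i) / A) 1) = m; \<bar>m / real N - \<alpha>\<bar> \<le> \<rho>;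
      \<bar>(\<Sum>i<N. min (size_var (z i) / (a + \<eta>)) 1) / real N - (\<integral>x. min (size_var x / (a + \<eta>)) 1 \<partial>P)\<bar> \<le> \<rho>;
      \<bar>(\<Sum>i<N. min (size_var (z i) / (a - \<eta>)) 1) / real N - (\<integral>x. min (size_var x / (a - \<eta>)) 1 \<partial>P)\<bar> \<le> \<rho>\<rbrakk>
      \<Longrightarrow> \<bar>A - a\<bar> < \<eta>"
    by (rule normalization_close[OF P(1) size_var_meas size_var_pos threshold_eq[folded a_def] \<alpha>1 \<eta>(1,2)])
      (rule that; assumption)
  define far where "far \<phi> \<kappa> N = {\<omega> \<in> space \<Omega>. \<bar>(\<Sum>i<N. \<phi> (fst \<omega> i)) / real N - integral\<^sup>L P \<phi>\<bar> > \<kappa>}"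
    for \<phi> :: "'y \<times> 'x \<Rightarrow> real" and \<kappa> N
  have far_vanish: "vanishing \<Omega> (far \<phi> \<kappa>)" if "integrable P \<phi>" "\<kappa> > 0" for \<phi> \<kappa>
    unfolding far_def[abs_def] using that by (rule vanishing_average)
  define B where "B z = (\<Sum>f\<in>J. \<bar>ratio f z\<bar>)" for z
  define cov where "cov p z = ht_variance a a (size_var z) * (ratio (fst p) z * ratio (snd p) z)" for p z
  define apr where "apr p z = \<bar>ratio (fst p) z * ratio (snd p) z\<bar>" for p z
  define lind where "lind N = {\<omega> \<in> space \<Omega>. (\<Sum>i<N. (B (fst \<omega> i))\<^sup>2 * min 1 (B (fst \<omega> i) / sqrt (real N))) / real N \<ge> \<delta>}" for N
  define size where "size N = {\<omega> \<in> space \<Omega>. \<bar>n N (Xvec N \<omega>) / real N - \<alpha>\<bar> > \<rho>}" for N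
  let ?t = "\<lambda>b z. min (size_var z / b) 1"
  \<comment> \<open>The two truncated means and the sample size locate the normalization,
    \<open>lind\<close> is the failure of the Lindeberg condition, \<open>cov\<close> yields the
    limit covariance, and \<open>apr\<close> bounds the average that multiplies the error of
    exchanging A for a.\<close>
  define bad where "bad N = (far (?t (a + \<eta>)) \<rho> N \<union> far (?t (a - \<eta>)) \<rho> N) \<union> (size N \<union> lind N) \<union>
      ((\<Union>p\<in>J \<times> J. far (cov p) (\<delta> / 2) N) \<union> (\<Union>p\<in>J \<times> J. far (apr p) 1 N))" for N
  have prod_int: "integrable P (\<lambda>z. ratio (fst p) z * ratio (snd p) z)" if "p \<in> J \<times> J" for p
    using that J(2) by (intro ratio_prod_int) auto
  have bad_vanish: "vanishing \<Omega> bad"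
    unfolding bad_def[abs_def]
  proof (intro vanishing_Un vanishing_UN prob_space_sampling far_vanish finite_cartesian_product J(1))
    show "integrable P (?t (a + \<eta>))" "integrable P (?t (a - \<eta>))"
      using \<eta> a size_var_nonneg by (intro P.integrable_const_bound[where B = 1]; auto)+
    show "\<rho> > 0" "\<rho> > 0" "\<delta> / 2 > 0" "(1 :: real) > 0" using \<rho> \<delta> by auto
    show "vanishing \<Omega> size" unfolding size_def[abs_def] using \<rho> by (rule vanishing_sample_size)
    show "vanishing \<Omega> lind"
      unfolding lind_def[abs_def]
    proof (rule vanishing_lindeberg[OF _ _ _ \<delta>])
      show "B \<in> borel_measurable P" unfolding B_def[abs_def] using ratio_meas J(2) by (intro borel_measurable_sum) auto
      show "0 \<le> B z" for z by (simp add: B_def sum_nonneg)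
      have "(B z)\<^sup>2 = (\<Sum>f\<in>J. \<Sum>g\<in>J. \<bar>ratio f z * ratio g z\<bar>)" for z
        by (simp add: B_def power2_eq_square sum_product abs_mult)
      moreover have "integrable P (\<lambda>z. \<Sum>f\<in>J. \<Sum>g\<in>J. \<bar>ratio f z * ratio g z\<bar>)"
        using ratio_prod_int J(2) by (intro Bochner_Integration.integrable_sum integrable_abs) auto
      ultimately show "integrable P (\<lambda>z. (B z)\<^sup>2)" by simp
    qed
    fix p assume p: "p \<in> J \<times> J"
    show "integrable P (apr p)" unfolding apr_def[abs_def] using prod_int[OF p] by (rule integrable_abs)
    show "integrable P (cov p)"
    proof (rule Bochner_Integration.integrable_bound)
      show "integrable P (\<lambda>z. a\<^sup>2 * (ratio (fst p) z * ratio (snd p) z))" using prod_int[OF p] by (rule integrable_mult_right)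
      have [measurable]: "(\<lambda>z. ratio (fst p) z * ratio (snd p) z) \<in> borel_measurable P"
        "(\<lambda>z. ht_variance a a (size_var z)) \<in> borel_measurable P"
        using prod_int[OF p] ht_variance_meas by (auto simp: a_def)
      show "cov p \<in> borel_measurable P" unfolding cov_def[abs_def] by measurable
      show "AE z in P. norm (cov p z) \<le> norm (a\<^sup>2 * (ratio (fst p) z * ratio (snd p) z))"
      proof (rule AE_I2)
        fix z
        have "\<bar>ht_variance a a (size_var z)\<bar> \<le> \<bar>a\<^sup>2\<bar>" using ht_variance_bound[of z] by (simp add: a_def)
        then show "norm (cov p z) \<le> norm (a\<^sup>2 * (ratio (fst p) z * ratio (snd p) z))"
          unfolding cov_def real_norm_def abs_mult[of "ht_variance a a (size_var z)"] abs_mult[of "a\<^sup>2"]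
          by (rule mult_right_mono) simp
      qed
    qed
  qed
  \<comment> \<open>Kept apart from \<open>bad\<close>: for the partition fixed above, its outer
    probability is only shown to be eventually at most \<eta>0 / 4, not to vanish.\<close>
  define R where "R N = {\<omega> \<in> space \<Omega>. rademacher_exp N (\<lambda>e. of_bool (\<exists>k\<in>osc_class P H c2.
      \<bar>\<Sum>i<N. e i * k (fst \<omega> i)\<bar> > 3 * u * sqrt (real N))) \<ge> \<epsilon>}" for N
  have R_small: "outer_prob \<Omega> (R N) \<le> \<eta>0 / 4" if "N \<ge> N1" for N
  proof -
    have "outer_prob \<Omega> (R N) \<le> outer_prob P.sequence_space {z \<in> space P.sequence_space.
        rademacher_exp N (\<lambda>e. of_bool (\<exists>k\<in>osc_class P H c2. \<bar>\<Sum>i<N. e i * k (z i)\<bar> > 3 * u * sqrt (real N))) \<ge> \<epsilon>}"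
      unfolding R_def by (rule outer_prob_fst)
    also have "\<dots> \<le> 2 * e1 / \<epsilon>"
      using N1 that u \<epsilon>(1) by (intro rademacher_tail_outer P(1)) auto
    also have "\<dots> = \<eta>0 / 4" using \<epsilon>(1) by (simp add: e1_def)
    finally show ?thesis .
  qed
  let ?T = "\<lambda>N \<omega> h. \<bar>design_expectation Pd (\<lambda>\<eta>. h (HT_process F D enum \<pi> N \<eta>)) \<omega> - (\<integral>\<omega>'. h (G' \<omega>') \<partial>M')\<bar>"
  have good: "?T N \<omega> h \<le> 8 * \<epsilon>"
    if N: "N \<ge> 1" and \<omega>: "\<omega> \<in> space \<Omega>" "\<omega> \<notin> R N" "\<omega> \<notin> bad N" and h: "h \<in> BL1_linf F" for N \<omega> h
  proof -
    define z where "z = fst \<omega>"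
    define x where "x = Xvec N \<omega>"
    define A where "A = normalization N x"
    define q where "q = bernoulli_weight (\<pi> N x)"
    have x: "x \<in> {..<N} \<rightarrow>\<^sub>E UNIV" unfolding x_def by (rule Xvec_PiE)
    have wx: "w (x i) = size_var (z i)" if "i < N" for i using that by (simp add: x_def z_def Xvec_def size_var_def)
    have A: "A > 0" unfolding A_def using N x by (rule normalization_pos)
    have near: "\<bar>A - a\<bar> < \<eta>"
    proof (rule close[OF N A, of z "n N x"])
      \<comment> \<open>The inclusion probabilities sum to the expected sample size, which is the
        estimating equation for A.\<close>
      have "(\<Sum>i<N. min (size_var (z i) / A) 1) = (\<Sum>i<N. \<pi> N x i)"
        using wx by (intro sum.cong) (auto simp: pi_eq[OF N x] A_def)
      then show "(\<Sum>i<N. min (size_var (z i) / A) 1) = n N x" using c[OF N x] by simp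
      show "\<bar>n N x / real N - \<alpha>\<bar> \<le> \<rho>" using \<omega> by (simp add: bad_def size_def x_def not_less)
    qed (use \<omega> in \<open>simp_all add: bad_def far_def z_def not_less\<close>)
    have AC: "max A threshold \<le> C" using near \<eta>(2) C(3) a by (simp add: a_def)
    have pw: "product_weights N {0, 1} q" unfolding q_def using N x by (rule design_weights)
    have centered: "(\<Sum>b\<in>{0, 1}. q i b * multiplier N x i b) = 0" if "i < N" for i
      unfolding q_def using N x that by (rule multiplier_centered)
    have mbound: "\<bar>multiplier N x i b\<bar> \<le> C" if "i < N" "b \<in> {0, 1}" for i b
      using multiplier_bound[OF N x that] AC unfolding A_def by linarith
    have tauC: "C\<^sup>2 * \<tau>\<^sup>2 / \<epsilon>\<^sup>2 \<le> \<epsilon>"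
    proof -
      have "C\<^sup>2 * \<tau>\<^sup>2 / \<epsilon>\<^sup>2 = \<epsilon>\<^sup>2" using C(1) \<epsilon>(1) by (simp add: \<tau>_def power_divide power2_eq_square)
      also have "\<dots> \<le> \<epsilon>" using \<epsilon> by (simp add: power2_eq_square mult_left_le)
      finally show ?thesis .
    qed
    have proj: "\<bar>prod_exp N {0, 1} q (\<lambda>s. h (\<lambda>f\<in>F. design_process N z x s f))
        - prod_exp N {0, 1} q (\<lambda>s. h (lift_linf F rep (design_process N z x s)))\<bar>
      \<le> 2 * \<epsilon> + 9 / 7 * \<epsilon> + C\<^sup>2 * \<tau>\<^sup>2 / \<epsilon>\<^sup>2"
      unfolding design_process_def
    proof (rule design_projection[OF rep pw N centered C(1) mbound, where K = "osc_class P H c2" and \<mu> = \<mu> and u = u])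
      show "(\<lambda>x. ratio f x - \<mu> f - (ratio (rep f) x - \<mu> (rep f))) \<in> osc_class P H c2" if "f \<in> F" for f
        unfolding osc_class_def \<mu>_def H_def using that rep(2) rep_c2[OF that]
        by (intro CollectI exI[of _ "ratio f"] exI[of _ "ratio (rep f)"]) auto
      show "rademacher_exp N (\<lambda>e. of_bool (\<exists>k\<in>osc_class P H c2. \<bar>\<Sum>i<N. e i * k (z i)\<bar> > 3 * u * sqrt (real N))) < \<epsilon>"
        using \<omega>(1,2) by (simp add: R_def z_def not_le)
      show "12 * C * u \<le> \<epsilon>" using C(1) by (simp add: u_def)
      show "(\<lambda>f\<in>F. \<Sum>i<N. multiplier N x i (s i) * (ratio f (z i) / sqrt (real N))) \<in> linf F" for s
        using design_process_linf[of N z x s] unfolding design_process_def .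
    qed (use \<tau> rep_\<mu> \<epsilon> u h in auto)
    have covs: "\<bar>(\<Sum>i<N. (\<Sum>b\<in>{0, 1}. q i b * (multiplier N x i b)\<^sup>2) * (ratio f (z i) / sqrt (real N) * (ratio g (z i) / sqrt (real N))))
        - Sigma_HT P w \<theta> f g\<bar> \<le> \<delta>" if fg: "f \<in> J" "g \<in> J" for f g
    proof -
      let ?r = "\<lambda>i. ratio f (z i) * ratio g (z i)"
      have "(\<Sum>i<N. (\<Sum>b\<in>{0, 1}. q i b * (multiplier N x i b)\<^sup>2) * (ratio f (z i) / sqrt (real N) * (ratio g (z i) / sqrt (real N))))
          = (\<Sum>i<N. ht_variance a A (size_var (z i)) * ?r i) / real N"
        unfolding sum_divide_distrib
      proof (intro sum.cong refl)
        fix i assume "i \<in> {..<N}"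
        then have i: "i < N" by simp
        have "ratio f (z i) / sqrt (real N) * (ratio g (z i) / sqrt (real N)) = ?r i / real N"
          by (simp only: times_divide_times_eq real_sqrt_mult_self abs_of_nat)
        moreover have "(\<Sum>b\<in>{0, 1}. q i b * (multiplier N x i b)\<^sup>2) = ht_variance a A (size_var (z i))"
          unfolding q_def multiplier_variance[OF N x i] wx[OF i] a_def A_def ..
        ultimately show "(\<Sum>b\<in>{0, 1}. q i b * (multiplier N x i b)\<^sup>2) * (ratio f (z i) / sqrt (real N) * (ratio g (z i) / sqrt (real N)))
            = ht_variance a A (size_var (z i)) * ?r i / real N"
          by (simp only: times_divide_eq_right)
      qed
      \<comment> \<open>The random normalization is exchanged for its limit. The Lipschitz bound is
        uniform in the size variable, so it survives the dependence of A on the whole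
        sample.\<close>
      moreover have "\<bar>(\<Sum>i<N. ht_variance a A (size_var (z i)) * ?r i) / real N - (\<Sum>i<N. ht_variance a a (size_var (z i)) * ?r i) / real N\<bar>
          \<le> a * \<eta> * ((\<Sum>i<N. \<bar>?r i\<bar>) / real N)"
      proof -
        have "\<bar>\<Sum>i<N. (ht_variance a A (size_var (z i)) - ht_variance a a (size_var (z i))) * ?r i\<bar>
            \<le> (\<Sum>i<N. a * \<eta> * \<bar>?r i\<bar>)"
        proof (intro order_trans[OF sum_abs] sum_mono)
          fix i
          have "\<bar>ht_variance a A (size_var (z i)) - ht_variance a a (size_var (z i))\<bar> \<le> a * \<bar>A - a\<bar>"
            by (rule ht_variance_lipschitz[OF size_var_pos A a])
          also have "\<dots> \<le> a * \<eta>" using near a by simp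
          finally show "\<bar>(ht_variance a A (size_var (z i)) - ht_variance a a (size_var (z i))) * ?r i\<bar> \<le> a * \<eta> * \<bar>?r i\<bar>"
            unfolding abs_mult[of "ht_variance a A (size_var (z i)) - ht_variance a a (size_var (z i))"]
            by (rule mult_right_mono) simp
        qed
        then have "\<bar>\<Sum>i<N. (ht_variance a A (size_var (z i)) - ht_variance a a (size_var (z i))) * ?r i\<bar> / real N
            \<le> (\<Sum>i<N. a * \<eta> * \<bar>?r i\<bar>) / real N" by (rule divide_right_mono) simp
        then show ?thesis
          by (simp add: left_diff_distrib sum_subtractf diff_divide_distrib[symmetric] sum_distrib_left[symmetric])
      qed
      moreover have "a * \<eta> * ((\<Sum>i<N. \<bar>?r i\<bar>) / real N) \<le> \<delta> / 2"
      proof -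
        have "\<omega> \<notin> far (apr (f, g)) 1 N" using \<omega>(3) fg unfolding bad_def by blast
        then have "(\<Sum>i<N. \<bar>?r i\<bar>) / real N \<le> m2 f g + 1"
          using \<omega>(1) unfolding far_def apr_def[abs_def] m2_def z_def fst_conv snd_conv by simp
        then have "(\<Sum>i<N. \<bar>?r i\<bar>) / real N \<le> S2 + 1" using m2_le[OF fg] by linarith
        then have "a * \<eta> * ((\<Sum>i<N. \<bar>?r i\<bar>) / real N) \<le> a * \<eta> * (S2 + 1)" using a \<eta>(1) by (intro mult_left_mono) auto
        then show ?thesis using \<eta>(3) by linarith
      qed
      moreover have "\<bar>(\<Sum>i<N. ht_variance a a (size_var (z i)) * ?r i) / real N - Sigma_HT P w \<theta> f g\<bar> \<le> \<delta> / 2"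
      proof -
        have "\<omega> \<notin> far (cov (f, g)) (\<delta> / 2) N" using \<omega>(3) fg unfolding bad_def by blast
        then show ?thesis
          using \<omega>(1) unfolding far_def cov_def[abs_def] Sigma_eq z_def fst_conv snd_conv a_def by simp
      qed
      ultimately show ?thesis by linarith
    qed
    have lindeberg: "(\<Sum>i<N. (\<Sum>f\<in>J. \<bar>ratio f (z i) / sqrt (real N)\<bar>)\<^sup>2 * min 1 (\<Sum>f\<in>J. \<bar>ratio f (z i) / sqrt (real N)\<bar>)) \<le> \<delta>"
    proof -
      have "(\<Sum>f\<in>J. \<bar>ratio f (z i) / sqrt (real N)\<bar>) = B (z i) / sqrt (real N)" for i
        by (simp add: B_def sum_divide_distrib abs_divide)
      then have "(\<Sum>i<N. (\<Sum>f\<in>J. \<bar>ratio f (z i) / sqrt (real N)\<bar>)\<^sup>2 * min 1 (\<Sum>f\<in>J. \<bar>ratio f (z i) / sqrt (real N)\<bar>))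
          = (\<Sum>i<N. (B (z i))\<^sup>2 * min 1 (B (z i) / sqrt (real N))) / real N"
        by (simp add: power_divide sum_divide_distrib)
      moreover have "\<omega> \<notin> lind N" using \<omega>(3) unfolding bad_def by blast
      ultimately show ?thesis using \<omega>(1) by (simp add: lind_def z_def not_le)
    qed
    have Gh: "(\<lambda>\<omega>. h (lift_linf F rep (G' \<omega>))) \<in> borel_measurable M'"
      using measurable_compose[OF G BL1_linf_measurable[OF lift_BL1_linf[OF rep h]]] .
    have lim: "\<bar>prod_exp N {0, 1} q (\<lambda>s. h (lift_linf F rep (design_process N z x s)))
        - (\<integral>\<omega>. h (lift_linf F rep (G' \<omega>)) \<partial>M')\<bar> \<le> \<epsilon>"
      using clt[rule_format, OF pw centered mbound covs lindeberg, of "\<lambda>v. h (lift_linf F rep v)"]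
        lift_coord_BL1[OF rep h] Gh
      unfolding J_def design_process_def[abs_def] by blast
    have limG: "\<bar>(\<integral>\<omega>. h (G' \<omega>) \<partial>M') - (\<integral>\<omega>. h (lift_linf F rep (G' \<omega>)) \<partial>M')\<bar> \<le> \<epsilon> + \<epsilon>"
    proof (rule limit_projection[OF rep M G h _ bump(2,3,4,5)])
      show "\<bar>z f - z (rep f)\<bar> \<le> \<epsilon>" if "z \<in> linf F" "bump z < 1" "f \<in> F" for z f
        using bump(6)[OF that _ rep_c1] that(3) rep(2) by blast
    qed (use \<epsilon> in simp)
    have "design_expectation Pd (\<lambda>\<eta>. h (HT_process F D enum \<pi> N \<eta>)) \<omega> =
        prod_exp N {0, 1} q (\<lambda>s. h (\<lambda>f\<in>F. design_process N z x s f))"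
      unfolding q_def x_def z_def by (rule design_expectation_HT[OF N])
    \<comment> \<open>Projection of the design process costs (2 + 9/7 + 1)\<epsilon>, the
      finite-dimensional limit \<epsilon> and projection of the limit process 2\<epsilon>, less than
      8\<epsilon> in total.\<close>
    then show ?thesis using proj lim limG tauC \<epsilon>(1) by linarith
  qed
  have "eventually (\<lambda>N. outer_prob \<Omega> (bad N) < \<eta>0 / 2) sequentially"
    using bad_vanish \<eta>0 unfolding vanishing_def by (intro order_tendstoD) auto
  then obtain N2 where N2: "\<And>N. N \<ge> N2 \<Longrightarrow> outer_prob \<Omega> (bad N) < \<eta>0 / 2"
    unfolding eventually_sequentially by blast
  have bad_sub: "bad N \<subseteq> space \<Omega>" for N using bad_vanish by (simp add: vanishing_def)
  show "\<exists>no. \<forall>N\<ge>no. norm (outer_prob \<Omega> {\<omega> \<in> space \<Omega>. \<bar>SUP h\<in>BL1_linf F. ?T N \<omega> h\<bar> > e0} - 0) < \<eta>0"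
  proof (intro exI[of _ "max 1 (max N1 N2)"] allI impI)
    fix N assume N: "N \<ge> max 1 (max N1 N2)"
    let ?E = "{\<omega> \<in> space \<Omega>. \<bar>SUP h\<in>BL1_linf F. ?T N \<omega> h\<bar> > e0}"
    have "?E \<subseteq> R N \<union> bad N"
    proof (rule subsetI, rule ccontr)
      fix \<omega> assume E: "\<omega> \<in> ?E" and "\<omega> \<notin> R N \<union> bad N"
      then have T: "?T N \<omega> h \<le> 8 * \<epsilon>" if "h \<in> BL1_linf F" for h using good[of N \<omega> h] N that by simp
      have "(SUP h\<in>BL1_linf F. ?T N \<omega> h) \<le> 8 * \<epsilon>"
        using zero_in_BL1_linf T by (intro cSUP_least) auto
      moreover have "?T N \<omega> (\<lambda>_. 0) \<le> (SUP h\<in>BL1_linf F. ?T N \<omega> h)"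
        using zero_in_BL1_linf T by (intro cSUP_upper bdd_aboveI2) auto
      ultimately show False using E \<epsilon>(3) by (simp add: design_expectation_def)
    qed
    then have "outer_prob \<Omega> ?E \<le> outer_prob \<Omega> (R N \<union> bad N)"
      using bad_sub by (intro outer_prob_mono) (auto simp: R_def)
    also have "\<dots> \<le> outer_prob \<Omega> (R N) + outer_prob \<Omega> (bad N)"
      using bad_sub by (intro outer_prob_Un S.finite_measure_axioms) (auto simp: R_def)
    also have "\<dots> < \<eta>0" using R_small[of N] N2[of N] N \<eta>0 by simp
    finally show "norm (outer_prob \<Omega> ?E - 0) < \<eta>0" using outer_prob_nonneg[of ?E \<Omega>] by simp
  qed
qed

end

theorem theorem3p5:
  fixes P :: "('y::{banach, second_countable_topology} \<times> 'x::{banach, second_countable_topology}) measure"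
    and Pd :: "'d measure" and Pe :: "'e measure" and D :: "'d \<Rightarrow> real"
    and enum :: "nat \<Rightarrow> nat \<Rightarrow> (nat \<Rightarrow> nat)"
    and \<pi> :: "nat \<Rightarrow> (nat \<Rightarrow> 'x) \<Rightarrow> nat \<Rightarrow> real"
    and w :: "'x \<Rightarrow> real" and c n :: "nat \<Rightarrow> (nat \<Rightarrow> 'x) \<Rightarrow> real"
    and F :: "('y \<Rightarrow> real) set" and \<alpha> \<theta> :: real
    and M' :: "'g measure" and G' :: "'g \<Rightarrow> ('y \<Rightarrow> real) \<Rightarrow> real"
  assumes "prob_space P" and "sets P = sets borel"
    and "prob_space Pd" and "prob_space Pe"
    and D: "D \<in> borel_measurable Pd" "distr Pd borel D = uniform_measure lborel {0..1}"
    and enum: "\<And>N. N \<ge> 1 \<Longrightarrow> bij_betw (enum N) {..<2 ^ N} (indicator_vectors N)"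
    and design: "\<And>N. N \<ge> 1 \<Longrightarrow> measurable_poisson_design borel N (\<pi> N)"
    and w_pos: "\<And>x. w x > 0"
    and pi: "\<And>N x i. \<lbrakk>N \<ge> 1; x \<in> {..<N} \<rightarrow>\<^sub>E UNIV; i < N\<rbrakk> \<Longrightarrow>
               \<pi> N x i = min (c N x * (w (x i) / (\<Sum>j<N. w (x j)))) 1"
    and c: "\<And>N x. \<lbrakk>N \<ge> 1; x \<in> {..<N} \<rightarrow>\<^sub>E UNIV\<rbrakk> \<Longrightarrow> c N x > 0 \<and> (\<Sum>i<N. \<pi> N x i) = n N x"
    and F: "F \<subseteq> borel_measurable borel"
    and B0: "\<And>N x. \<lbrakk>N \<ge> 1; x \<in> {..<N} \<rightarrow>\<^sub>E UNIV\<rbrakk> \<Longrightarrow> n N x \<in> {0..real N}"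
      "\<And>N. N \<ge> 1 \<Longrightarrow> n N \<in> borel_measurable (\<Pi>\<^sub>M i\<in>{..<N}. borel)"
      "\<alpha> \<in> {0<..<1}"
      "\<And>\<epsilon>. \<epsilon> > 0 \<Longrightarrow>
         (\<lambda>N. measure (sampling_space P Pd Pe)
            {\<omega> \<in> space (sampling_space P Pd Pe). \<bar>n N (Xvec N \<omega>) / real N - \<alpha>\<bar> > \<epsilon>}) \<longlonglongrightarrow> 0"
    and B1: "w \<in> borel_measurable borel" "integrable P (\<lambda>(y, x). w x)"
    and theta: "\<theta> > 0" "(\<integral>(y, x). min (\<theta> * w x / mean_size P w) 1 \<partial>P) = \<alpha>"
    and B2: "Donsker_class P ((\<lambda>f. \<lambda>(y, x). f y / w_trunc P w \<theta> x) ` F)"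
    and B3: "bounded ((\<lambda>f. \<integral>(y, x). f y / w_trunc P w \<theta> x \<partial>P) ` F)"
    and "prob_space M'"
    and G'_borel: "G' \<in> M' \<rightarrow>\<^sub>M linf_borel F"
    and G'_tight: "tight_measure_on (linf_topology F) (distr M' (linf_borel F) G')"
    and G'_gauss: "centered_gaussian_process M' F (Sigma_HT P w \<theta>) G'"
  shows "tendsto_zero_outer_prob (sampling_space P Pd Pe)
    (\<lambda>N \<omega>. SUP h\<in>BL1_linf F.
       \<bar>design_expectation Pd (\<lambda>\<eta>. h (HT_process F D enum \<pi> N \<eta>)) \<omega> - (\<integral>\<omega>'. h (G' \<omega>') \<partial>M')\<bar>)"
proof -
  interpret ht_sampling P Pd Pe D enum \<pi> w c n F \<alpha> \<theta>
    by (rule ht_sampling.intro) (fact assms)+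
  show ?thesis by (rule HT_conditional_weak_convergence) fact+
qed

end
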